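(* There is an algorithm for estimating $\Psi(x,y)$, consisting of a precomputation phase depending only on a bound $y$ and an evaluation phase, with the following properties. (1) Precomputation: given $y\ge 2$, the algorithm computes the coefficients $d_n(y')$ for all $y'\le y$ and all $0\le n\le \pi(y')$, using $O(y^2/\log y)$ arithmetic operations in total and $O(\pi(y)^2)$ words of space to store all these coefficients. (2) Evaluation: after the precomputation, given $x>y$, the algorithm outputs the number $$E(x,y):=\left(\prod_{p\le y}\frac{\log x}{\log p}\right)\sum_{n=0}^{m}\frac{d_n(y)\,(\log x)^{-n}}{(\pi(y)-n)!},$$ where $$m=\left\lfloor \min\left\{\pi(y),\ \max\left\{\log_2\log x,\ e\log y,\ \frac{e y^2}{\log x\,\log y}\right\}\right\}\right\rfloor,$$ using $O(\pi(y))$ arithmetic operations, with an implied constant independent of $x$ and $y$. (3) Accuracy: for each fixed $\theta$ with $0<\theta<3/4$ and each fixed $\epsilon>0$, the output satisfies $$\Psi(x,y)=E(x,y)\left(1+O\left((\log x)^{-1/8+\epsilon}\right)\right)$$ whenever $2\le y\le(\log x)^{\theta}$.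
   Context: $\Psi(x,y)$ is the number of positive integers $n\le x$ all of whose prime divisors are at most $y$. $\pi(y)$ is the number of primes $\le y$; $p$ always denotes a prime; $\log$ is the natural logarithm, $\log_2$ the base-2 logarithm, and $e$ the base of the natural logarithm. Define the sequence $(c_n)_{n\ge0}$ by $c_0=1$, $c_1=1/2$, $c_{2k+1}=0$ for $k\ge1$, and $$c_{2k}=(-1)^{k+1}\frac{2\zeta(2k)}{(2\pi)^{2k}}\qquad(k\ge1),$$ where $\zeta$ is the Riemann zeta function (and $\pi$ in this formula is the circle constant). For $y\ge2$ and $n\ge 0$, $d_n(y)$ is the coefficient of $s^n$ in the power series $$\prod_{p\le y}\left(\sum_{k=0}^{\infty}c_k(\log p)^k s^k\right).$$ Computational model: basic arithmetic operations on integers and on (floating-point) real numbers take constant time, as do evaluations of basic special functions such as $\log$ and $\exp$; space is measured in machine words, each holding one number of the necessary precision. Thus numbers may be treated as real numbers on which each arithmetic operation or evaluation of a basic special function has unit cost. *)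

theory Defs
  imports "HOL-Analysis.Analysis" "HOL-Computational_Algebra.Computational_Algebra"
begin

section \<open>Smooth numbers and the approximation\<close>

definition primes_upto :: "real \<Rightarrow> nat set" where
  "primes_upto y = {p. prime p \<and> real p \<le> y}"

definition prime_pi :: "real \<Rightarrow> nat" where
  "prime_pi y = card (primes_upto y)"

definition Psi :: "real \<Rightarrow> real \<Rightarrow> nat" where
  "Psi x y = card {n::nat. 1 \<le> n \<and> real n \<le> x \<and> (\<forall>p. prime p \<and> p dvd n \<longrightarrow> real p \<le> y)}"

text \<open>The Riemann zeta function, by its Dirichlet series; only used for real \<open>s > 1\<close>.\<close>

definition zeta :: "real \<Rightarrow> real" where
  "zeta s = (\<Sum>n. 1 / real (Suc n) powr s)"

definition c :: "nat \<Rightarrow> real" where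
  "c n = (if n = 0 then 1
          else if n = 1 then 1 / 2
          else if odd n then 0
          else (-1) ^ (n div 2 + 1) * (2 * zeta (real n) / (2 * pi) ^ n))"

definition d :: "nat \<Rightarrow> real \<Rightarrow> real" where
  "d n y = fps_nth (\<Prod>p\<in>primes_upto y. Abs_fps (\<lambda>k. c k * ln (real p) ^ k)) n"

definition cutoff :: "real \<Rightarrow> real \<Rightarrow> nat" where
  "cutoff x y = nat \<lfloor>min (real (prime_pi y))
     (max (log 2 (ln x)) (max (exp 1 * ln y) (exp 1 * y\<^sup>2 / (ln x * ln y))))\<rfloor>"

definition E :: "real \<Rightarrow> real \<Rightarrow> real" where
  "E x y = (\<Prod>p\<in>primes_upto y. ln x / ln (real p)) *
     (\<Sum>n=0..cutoff x y. d n y * ln x powi (- int n) / fact (prime_pi y - n))"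

section \<open>The computational model\<close>

text \<open>
  A unit-cost random access machine over the integers and the reals, programmed in a
  while-language.  The memory consists of arrays of integers and arrays of reals, named by
  natural numbers; a scalar variable is a cell of an array.  The machine is parametrised by
  the length \<open>S\<close> of its arrays: an access outside \<open>{0..<S}\<close> has no execution, and neither
  have a division by zero or a logarithm of a nonpositive number.  A fixed program mentions
  finitely many arrays, so running it with parameter \<open>S\<close> takes \<open>O(S)\<close> words.

  The only constants are integers, and the only passage from reals to integers is by comparing
  and branching.  A floor operation of unit cost, which together with exact reals would make
  the machine unrealistically strong, is deliberately left out.
\<close>

datatype int_op = IAdd | ISub | IMul | IDiv | IMod

datatype real_op = RAdd | RSub | RMul | RDiv

datatype real_fun = Ln | Exp | Sin | Cos | Arctan

datatype iexp =
    IConst int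
  | IGet nat iexp
  | IOp int_op iexp iexp

datatype rexp =
    OfInt iexp
  | RGet nat iexp
  | ROp real_op rexp rexp
  | RFun real_fun rexp

datatype bexp =
    ILe iexp iexp
  | RLe rexp rexp
  | BNot bexp
  | BAnd bexp bexp

datatype com =
    Skip
  | ISet nat iexp iexp
  | RSet nat iexp rexp
  | Seq com com
  | Cond bexp com com
  | While bexp com

record memory =
  ints :: "nat \<Rightarrow> int \<Rightarrow> int"
  reals :: "nat \<Rightarrow> int \<Rightarrow> real"

primrec int_op_sem :: "int_op \<Rightarrow> int \<Rightarrow> int \<Rightarrow> int" where
  "int_op_sem IAdd i j = i + j"
| "int_op_sem ISub i j = i - j"
| "int_op_sem IMul i j = i * j"
| "int_op_sem IDiv i j = i div j"
| "int_op_sem IMod i j = i mod j"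

primrec real_op_sem :: "real_op \<Rightarrow> real \<Rightarrow> real \<Rightarrow> real" where
  "real_op_sem RAdd u v = u + v"
| "real_op_sem RSub u v = u - v"
| "real_op_sem RMul u v = u * v"
| "real_op_sem RDiv u v = u / v"

primrec real_fun_sem :: "real_fun \<Rightarrow> real \<Rightarrow> real" where
  "real_fun_sem Ln u = ln u"
| "real_fun_sem Exp u = exp u"
| "real_fun_sem Sin u = sin u"
| "real_fun_sem Cos u = cos u"
| "real_fun_sem Arctan u = arctan u"

primrec ival :: "memory \<Rightarrow> iexp \<Rightarrow> int" where
  "ival s (IConst k) = k"
| "ival s (IGet a e) = ints s a (ival s e)"
| "ival s (IOp f e1 e2) = int_op_sem f (ival s e1) (ival s e2)"

primrec rval :: "memory \<Rightarrow> rexp \<Rightarrow> real" where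
  "rval s (OfInt e) = real_of_int (ival s e)"
| "rval s (RGet a e) = reals s a (ival s e)"
| "rval s (ROp f e1 e2) = real_op_sem f (rval s e1) (rval s e2)"
| "rval s (RFun f e) = real_fun_sem f (rval s e)"

primrec bval :: "memory \<Rightarrow> bexp \<Rightarrow> bool" where
  "bval s (ILe e1 e2) \<longleftrightarrow> ival s e1 \<le> ival s e2"
| "bval s (RLe e1 e2) \<longleftrightarrow> rval s e1 \<le> rval s e2"
| "bval s (BNot b) \<longleftrightarrow> \<not> bval s b"
| "bval s (BAnd b1 b2) \<longleftrightarrow> bval s b1 \<and> bval s b2"

text \<open>Well-definedness of an expression in a memory whose arrays have length \<open>S\<close>.\<close>

primrec iok :: "nat \<Rightarrow> memory \<Rightarrow> iexp \<Rightarrow> bool" where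
  "iok S s (IConst k) \<longleftrightarrow> True"
| "iok S s (IGet a e) \<longleftrightarrow> iok S s e \<and> 0 \<le> ival s e \<and> ival s e < int S"
| "iok S s (IOp f e1 e2) \<longleftrightarrow> iok S s e1 \<and> iok S s e2 \<and> (f \<in> {IDiv, IMod} \<longrightarrow> ival s e2 \<noteq> 0)"

primrec rok :: "nat \<Rightarrow> memory \<Rightarrow> rexp \<Rightarrow> bool" where
  "rok S s (OfInt e) \<longleftrightarrow> iok S s e"
| "rok S s (RGet a e) \<longleftrightarrow> iok S s e \<and> 0 \<le> ival s e \<and> ival s e < int S"
| "rok S s (ROp f e1 e2) \<longleftrightarrow> rok S s e1 \<and> rok S s e2 \<and> (f = RDiv \<longrightarrow> rval s e2 \<noteq> 0)"
| "rok S s (RFun f e) \<longleftrightarrow> rok S s e \<and> (f = Ln \<longrightarrow> 0 < rval s e)"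

primrec bok :: "nat \<Rightarrow> memory \<Rightarrow> bexp \<Rightarrow> bool" where
  "bok S s (ILe e1 e2) \<longleftrightarrow> iok S s e1 \<and> iok S s e2"
| "bok S s (RLe e1 e2) \<longleftrightarrow> rok S s e1 \<and> rok S s e2"
| "bok S s (BNot b) \<longleftrightarrow> bok S s b"
| "bok S s (BAnd b1 b2) \<longleftrightarrow> bok S s b1 \<and> bok S s b2"

text \<open>
  Every constant, memory access, arithmetic operation, special function, comparison,
  connective, assignment and branch costs one unit, so the cost bounds from above the number
  of arithmetic operations performed.
\<close>

primrec icost :: "iexp \<Rightarrow> nat" where
  "icost (IConst k) = 1"
| "icost (IGet a e) = icost e + 1"
| "icost (IOp f e1 e2) = icost e1 + icost e2 + 1"

primrec rcost :: "rexp \<Rightarrow> nat" where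
  "rcost (OfInt e) = icost e + 1"
| "rcost (RGet a e) = icost e + 1"
| "rcost (ROp f e1 e2) = rcost e1 + rcost e2 + 1"
| "rcost (RFun f e) = rcost e + 1"

primrec bcost :: "bexp \<Rightarrow> nat" where
  "bcost (ILe e1 e2) = icost e1 + icost e2 + 1"
| "bcost (RLe e1 e2) = rcost e1 + rcost e2 + 1"
| "bcost (BNot b) = bcost b + 1"
| "bcost (BAnd b1 b2) = bcost b1 + bcost b2 + 1"

definition set_int :: "nat \<Rightarrow> int \<Rightarrow> int \<Rightarrow> memory \<Rightarrow> memory" where
  "set_int a i k s = s\<lparr>ints := (ints s)(a := (ints s a)(i := k))\<rparr>"

definition set_real :: "nat \<Rightarrow> int \<Rightarrow> real \<Rightarrow> memory \<Rightarrow> memory" where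
  "set_real a i u s = s\<lparr>reals := (reals s)(a := (reals s a)(i := u))\<rparr>"

text \<open>
  \<open>exec S P s t s'\<close>: with arrays of length \<open>S\<close>, the program \<open>P\<close> started in \<open>s\<close> terminates
  in \<open>s'\<close> at total cost \<open>t\<close>.
\<close>

inductive exec :: "nat \<Rightarrow> com \<Rightarrow> memory \<Rightarrow> nat \<Rightarrow> memory \<Rightarrow> bool" for S :: nat where
  Skip: "exec S Skip s 1 s"
| ISet: "iok S s e1 \<Longrightarrow> iok S s e2 \<Longrightarrow> 0 \<le> ival s e1 \<Longrightarrow> ival s e1 < int S \<Longrightarrow>
    exec S (ISet a e1 e2) s (icost e1 + icost e2 + 1) (set_int a (ival s e1) (ival s e2) s)"
| RSet: "iok S s e1 \<Longrightarrow> rok S s e2 \<Longrightarrow> 0 \<le> ival s e1 \<Longrightarrow> ival s e1 < int S \<Longrightarrow>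
    exec S (RSet a e1 e2) s (icost e1 + rcost e2 + 1) (set_real a (ival s e1) (rval s e2) s)"
| Seq: "exec S P1 s1 t1 s2 \<Longrightarrow> exec S P2 s2 t2 s3 \<Longrightarrow> exec S (Seq P1 P2) s1 (t1 + t2) s3"
| CondTrue: "bok S s b \<Longrightarrow> bval s b \<Longrightarrow> exec S P1 s t s' \<Longrightarrow>
    exec S (Cond b P1 P2) s (bcost b + 1 + t) s'"
| CondFalse: "bok S s b \<Longrightarrow> \<not> bval s b \<Longrightarrow> exec S P2 s t s' \<Longrightarrow>
    exec S (Cond b P1 P2) s (bcost b + 1 + t) s'"
| WhileFalse: "bok S s b \<Longrightarrow> \<not> bval s b \<Longrightarrow> exec S (While b P) s (bcost b + 1) s"
| WhileTrue: "bok S s1 b \<Longrightarrow> bval s1 b \<Longrightarrow> exec S P s1 t1 s2 \<Longrightarrow>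
    exec S (While b P) s2 t2 s3 \<Longrightarrow> exec S (While b P) s1 (bcost b + 1 + t1 + t2) s3"

section \<open>Input and output conventions\<close>

definition blank :: memory where
  "blank = \<lparr>ints = (\<lambda>_ _. 0), reals = (\<lambda>_ _. 0)\<rparr>"

text \<open>
  Real array 0 holds the coefficients; cell 0 of the real arrays 1, 2 and 3 holds respectively
  the input \<open>y\<close>, the input \<open>x\<close> and the output of the evaluation phase.
\<close>

abbreviation input_y :: "real \<Rightarrow> memory \<Rightarrow> memory" where
  "input_y y \<equiv> set_real 1 0 y"

abbreviation input_x :: "real \<Rightarrow> memory \<Rightarrow> memory" where
  "input_x x \<equiv> set_real 2 0 x"

abbreviation out_cell :: "memory \<Rightarrow> real" where
  "out_cell s \<equiv> reals s 3 0"

text \<open>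
  As \<open>d n y'\<close> depends on \<open>y'\<close> only through the set of primes up to \<open>y'\<close>, it is stored once for
  each value \<open>k\<close> of \<open>prime_pi y'\<close>; the rows \<open>0 \<le> n \<le> k\<close> are packed as a triangle.
\<close>

definition slot :: "nat \<Rightarrow> nat \<Rightarrow> nat" where
  "slot k n = k * (k + 1) div 2 + n"

definition coeffs_stored :: "nat \<Rightarrow> real \<Rightarrow> memory \<Rightarrow> bool" where
  "coeffs_stored S y s \<longleftrightarrow>
     (\<forall>y' n. 2 \<le> y' \<and> y' \<le> y \<and> n \<le> prime_pi y' \<longrightarrow>
        slot (prime_pi y') n < S \<and> reals s 0 (int (slot (prime_pi y') n)) = d n y')"

end

theory Submission
  imports Defs "HOL-Complex_Analysis.Complex_Analysis" "HOL-Real_Asymp.Real_Asymp"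
begin

text \<open>
  Write \<open>u = log x\<close>, \<open>N = \<pi>(y)\<close> and \<open>L\<^sub>j = log p\<^sub>j\<close>.  Then \<open>\<Psi>(x, y)\<close> is the number \<open>A\<^sub>N(u)\<close> of lattice
  points of the simplex \<open>\<Sum>e\<^sub>jL\<^sub>j \<le> u\<close>.  The \<open>c\<^sub>n\<close> are the Taylor coefficients of
  \<open>f(s) = s / (1 - exp (-s))\<close>, so the polynomial \<open>P\<^sub>k(u)\<close>, the coefficient of \<open>s\<^sup>k\<close> in
  \<open>exp (u s) \<Prod>f(L\<^sub>js) / \<Prod>L\<^sub>j\<close> (products over \<open>j \<le> k\<close>), satisfies for all \<open>u\<close> the recurrence
  \<open>P\<^sub>k(u) - P\<^sub>k(u - L\<^sub>k) = P\<^bsub>k-1\<^esub>(u)\<close> that \<open>A\<^sub>k\<close> satisfies for \<open>u \<ge> 0\<close>.  Unrolling the recurrence for the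
  difference bounds \<open>\<bar>A\<^sub>k - P\<^sub>k\<bar>\<close> by the sum over \<open>i\<close> of \<open>sup \<bar>P\<^sub>i\<bar>\<close> on \<open>[-L\<^sub>i, 0)\<close> times the number of
  lattice points whose first \<open>i\<close> coordinates vanish.  Each vanishing coordinate costs a factor
  \<open>L\<^sub>j k / u\<close>, so this is a geometric series, of relative size \<open>O(y / u)\<close>.

  \<open>E(x, y)\<close> is \<open>P\<^sub>N(u)\<close> with its sum truncated.  The tail is estimated by Rankin's method, for which
  an elementary bound \<open>\<pi>(y) \<le> 1.34 y / log y\<close> is just good enough.  That \<open>E(x, y)\<close> stays away from 0,
  also for small \<open>x\<close>, holds because the negative \<open>c\<^sub>n\<close> only start at \<open>n = 4\<close>, so that replacing
  them by 0 changes the sum by less than half.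

  Passing from the coefficients for one prime to those for the next is a multiplication by
  \<open>f(L\<^sub>ks)\<close>.  Done naively for every prime this takes \<open>O(\<pi>(y)\<^sup>3)\<close> operations; with a fast Fourier
  transform, whose roots of unity are exact in this model, it takes
  \<open>O(\<pi>(y)\<^sup>2 log y) = O(y\<^sup>2 / log y)\<close>.
\<close>

section \<open>The Taylor coefficients of the local factors\<close>


text \<open>Perron's formula would give P_N(u) as a residue and the error as a contour integral; the
  difference equation achieves the same with real variables only. Its one defect is the initial
  data: A_k vanishes at negative arguments while P_k does not, and the whole error is what these
  values, on one period, feed into the recurrence. The exponent 1/8 comes from the tail. By Rankin's
  method the n-th term beyond the cutoff is at most (e N^2 log y / (2 u X))^n, where X is the
  maximum in the definition of m. If pi(y) log y <= a y, then X >= e y^2 / (u log y) makes the base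
  at most a^2 / 2, and n > X >= log_2 u turns the geometric tail into a multiple of u^(log_2 (a^2 /
  2)). The exponent is at most -1/8 exactly when a <= 2^(7/16) = 1.354..., hence the care about
  1.34. The other error, y / u, is at most u^(-1/4). The lower bound for E has to be uniform from y
  = 2 on, where no asymptotic bound helps; there the trivial pi(y) <= (y + 1) / 2 is used.\<close>

lemma sinh_product_formula:
  fixes x :: real
  shows "(\<lambda>n. pi * x * (\<Prod>k=1..n. 1 + x^2 / of_nat k^2)) \<longlonglongrightarrow> sinh (pi * x)"
proof -
  have "(\<lambda>n. of_real pi * (\<i> * of_real x) * (\<Prod>k=1..n. 1 - (\<i> * of_real x)^2 / (of_nat k)^2))
          \<longlonglongrightarrow> sin (of_real pi * (\<i> * of_real x) :: complex)"
    by (rule sin_product_formula_complex)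
  moreover have "(\<lambda>n. of_real pi * (\<i> * of_real x) * (\<Prod>k=1..n. 1 - (\<i> * of_real x)^2 / (of_nat k)^2))
      = (\<lambda>n. \<i> * of_real (pi * x * (\<Prod>k=1..n. 1 + x^2 / of_nat k^2)) :: complex)"
    by (simp add: power_mult_distrib fun_eq_iff)
  moreover have "sin (of_real pi * (\<i> * of_real x) :: complex) = \<i> * of_real (sinh (pi * x))"
    by (simp add: sinh_def sin_exp_eq exp_of_real[symmetric] scaleR_conv_of_real field_simps
             del: exp_of_real)
  ultimately have "(\<lambda>n. \<i> * of_real (pi * x * (\<Prod>k=1..n. 1 + x^2 / of_nat k^2)) :: complex)
      \<longlonglongrightarrow> \<i> * of_real (sinh (pi * x))" by metis
  from tendsto_mult[OF tendsto_const[of "-\<i>"] this]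
  have "(\<lambda>n. of_real (pi * x * (\<Prod>k=1..n. 1 + x^2 / of_nat k^2)) :: complex)
      \<longlonglongrightarrow> of_real (sinh (pi * x))" by (simp add: mult.assoc[symmetric])
  thus ?thesis by (subst (asm) tendsto_of_real_iff)
qed

lemma ln_sinh_sums:
  fixes x :: real
  assumes x: "x > 0"
  shows "(\<lambda>n. ln (1 + x^2 / (real n + 1)^2)) sums ln (sinh (pi * x) / (pi * x))"
proof -
  have "(\<lambda>n. (pi * x * (\<Prod>k=1..n. 1 + x^2 / of_nat k^2)) / (pi * x)) \<longlonglongrightarrow> sinh (pi * x) / (pi * x)"
    by (intro tendsto_divide sinh_product_formula tendsto_const) (use x in auto)
  hence "(\<lambda>n. \<Prod>k=1..n. 1 + x^2 / of_nat k^2) \<longlonglongrightarrow> sinh (pi * x) / (pi * x)"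
    using x by simp
  moreover have "sinh (pi * x) / (pi * x) > 0" using x by simp
  ultimately have "(\<lambda>n. ln (\<Prod>k=1..n. 1 + x^2 / of_nat k^2)) \<longlonglongrightarrow> ln (sinh (pi * x) / (pi * x))"
    by (intro tendsto_ln) auto
  moreover have "ln (\<Prod>k=1..n. 1 + x^2 / of_nat k^2) = (\<Sum>k<n. ln (1 + x^2 / (real k + 1)^2))" for n
  proof -
    have "ln (\<Prod>k=1..n. 1 + x^2 / of_nat k^2) = (\<Sum>k=1..n. ln (1 + x^2 / real k^2))"
    proof (rule ln_prod)
      fix i assume "i \<in> {1..n}"
      have "0 \<le> x\<^sup>2 / (real i)\<^sup>2" by simp
      thus "1 + x\<^sup>2 / (real i)\<^sup>2 \<noteq> 0" by linarith
    qed simp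
    also have "\<dots> = (\<Sum>k<n. ln (1 + x^2 / (real k + 1)^2))"
      by (rule sum.reindex_bij_witness[of _ Suc "\<lambda>k. k - 1"]) (auto simp: add.commute)
    finally show ?thesis .
  qed
  ultimately show ?thesis by (simp add: sums_def)
qed

text \<open>The logarithmic derivative of the product for sinh. Termwise differentiation is
  justified on (0, 1) by the majorants \<open>2 / (real n + 1)^2\<close>; a neighbourhood of 0 is
  enough to determine Taylor coefficients.\<close>

lemma coth_partial_fractions:
  fixes x :: real
  assumes x: "0 < x" "x < 1"
  shows "(\<lambda>n. 2 * x / ((real n + 1)^2 + x^2)) sums (pi * cosh (pi * x) / sinh (pi * x) - 1 / x)"
proof -
  let ?S = "{0<..<1::real}"
  let ?f = "\<lambda>n (x::real). ln (1 + x^2 / (real n + 1)^2)"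
  let ?f' = "\<lambda>n (x::real). 2 * x / ((real n + 1)^2 + x^2)"
  have sm: "summable (\<lambda>n. 2 / (real n + 1)^2)"
    using sums_summable[OF sums_mult[OF inverse_squares_sums, of 2]] by (simp add: add.commute)
  have bd: "norm (?f' n x) \<le> 2 / (real n + 1)^2" if "x \<in> ?S" for n x
  proof -
    have "2 * x / ((real n + 1)^2 + x^2) \<le> 2 / ((real n + 1)^2)"
      using that by (intro frac_le) auto
    thus ?thesis using that by (simp add: abs_of_nonneg)
  qed
  have der: "(?f n has_field_derivative ?f' n x) (at x within ?S)" if "x \<in> ?S" for n x
  proof -
    have p: "1 + x^2 / (real n + 1)^2 > 0" by (intro add_pos_nonneg) auto
    have q: "(real n + 1)^2 > 0" by simp
    have r: "(real n + 1)^2 + x^2 > 0" by (intro add_pos_nonneg) auto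
    have "(?f n has_field_derivative (1 / (1 + x^2 / (real n + 1)^2)) * (2 * x / (real n + 1)^2)) (at x within ?S)"
    proof -
      have "((\<lambda>x. 1 + x^2 / (real n + 1)^2) has_field_derivative 2 * x / (real n + 1)^2) (at x within ?S)"
      proof -
        have "((\<lambda>x. 1 + x^2 / m) has_field_derivative 2 * x / m) (at x within ?S)" for m :: real
          by (cases "m = 0") (auto intro!: derivative_eq_intros simp: field_simps)
        thus ?thesis .
      qed
      from DERIV_chain'[OF this DERIV_ln_divide[OF p]] show ?thesis by simp
    qed
    also have "(1 / (1 + x^2 / (real n + 1)^2)) * (2 * x / (real n + 1)^2) = ?f' n x"
    proof -
      have "(1 / (1 + x^2 / m)) * (2 * x / m) = 2 * x / (m + x^2)" if "m > 0" for m :: real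
      proof -
        have "(1 + x^2 / m) * m = m + x^2" using that by (simp add: field_simps)
        thus ?thesis by (metis divide_divide_eq_left mult.left_neutral times_divide_times_eq mult_1 mult.commute)
      qed
      from this[OF q] show ?thesis .
    qed
    finally show ?thesis .
  qed
  have uc: "uniformly_convergent_on ?S (\<lambda>n x. \<Sum>i<n. ?f' i x)"
    by (rule Weierstrass_m_test'[OF bd sm])
  have "((\<lambda>x. \<Sum>n. ?f n x) has_field_derivative (\<Sum>n. ?f' n x)) (at x)"
    by (rule has_field_derivative_series'(2)[OF _ der uc, of "1/2"])
       (use x sums_summable[OF ln_sinh_sums[of "1/2"]] in auto)
  hence "((\<lambda>x. ln (sinh (pi * x) / (pi * x))) has_field_derivative (\<Sum>n. ?f' n x)) (at x)"
    by (rule has_field_derivative_transform_within[of _ _ _ _ x])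
       (use x sums_unique[OF ln_sinh_sums] in \<open>auto simp: dist_real_def\<close>)
  moreover have "((\<lambda>x. ln (sinh (pi * x) / (pi * x))) has_field_derivative
      (pi * cosh (pi * x) / sinh (pi * x) - 1 / x)) (at x)"
  proof -
    have nz: "sinh (pi * x) > 0" "sinh (pi*x) / (pi * x) > 0" using x by auto
    show ?thesis
      using nz x by (auto intro!: derivative_eq_intros simp: power2_eq_square divide_simps)
        (auto simp: algebra_simps)
  qed
  ultimately have "(\<Sum>n. ?f' n x) = pi * cosh (pi * x) / sinh (pi * x) - 1 / x"
    by (rule DERIV_unique)
  moreover have "summable (\<lambda>n. ?f' n x)"
    by (rule summable_comparison_test'[OF sm bd]) (use x in auto)
  ultimately show ?thesis by (simp add: sums_iff)
qed

lemma zeta_even_sums: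
  assumes "n \<ge> 2"
  shows "(\<lambda>k. 1 / (real k + 1) ^ n) sums zeta (real n)"
proof -
  have "summable (\<lambda>k. 1 / (real k + 1) ^ n)"
    using inverse_power_summable[OF assms, where 'a = real]
    by (subst (asm) summable_Suc_iff[symmetric]) (simp add: inverse_eq_divide add.commute)
  thus ?thesis by (simp add: zeta_def sums_iff powr_realpow add.commute)
qed

lemma zeta_bounds:
  assumes "n \<ge> 2"
  shows "0 < zeta (real n)" "zeta (real n) \<le> pi\<^sup>2 / 6"
proof -
  show "0 < zeta (real n)"
    using suminf_pos[OF sums_summable[OF zeta_even_sums[OF assms]]] sums_unique[OF zeta_even_sums[OF assms]]
    by simp
  have "zeta (real n) \<le> zeta (real 2)"
    by (rule sums_le[OF _ zeta_even_sums[OF assms] zeta_even_sums[of 2]])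
       (use assms in \<open>auto intro!: divide_left_mono power_increasing\<close>)
  also have "zeta (real 2) = pi\<^sup>2 / 6"
    by (rule sums_unique2[OF zeta_even_sums[of 2]]) (use inverse_squares_sums in \<open>auto simp: add.commute\<close>)
  finally show "zeta (real n) \<le> pi\<^sup>2 / 6" .
qed

text \<open>Each partial fraction is expanded geometrically in \<open>x^2 / m^2\<close> and the sums
  are exchanged. Stopping after \<open>K\<close> terms leaves the exact remainder
  \<open>geo\<close>, the fraction itself times a power of size at most \<open>(x^2)^K\<close>; so
  only a finite sum is exchanged with a series, and the total error is at most
  \<open>(x^2)^K * T\<close>.\<close>

lemma zeta_series_coth:
  fixes x :: real
  assumes x: "0 < x" "x < 1"
  shows "(\<lambda>k. (-1)^k * (2 * zeta (real (2 * k + 2))) * x^(2*k+2)) sums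
           (pi * x * cosh (pi * x) / sinh (pi * x) - 1)"
proof -
  define T where "T = pi * x * cosh (pi * x) / sinh (pi * x) - 1"
  have T: "(\<lambda>n. 2 * x^2 / ((real n + 1)^2 + x^2)) sums T"
    using sums_mult[OF coth_partial_fractions[OF x], of x] x
    by (simp add: T_def algebra_simps power2_eq_square)
  have fin: "(\<lambda>n. \<Sum>k<K. (-1)^k * (2 * x^(2*k+2)) * (1 / (real n + 1)^(2*k+2))) sums
     (\<Sum>k<K. (-1)^k * (2 * x^(2*k+2)) * zeta (real (2*k+2)))" for K
    by (intro sums_sum sums_mult zeta_even_sums) auto
  have geo: "(\<Sum>k<K. (-1)^k * (2 * x^(2*k+2)) * (1 / m^(2*k+2))) - 2 * x^2 / (m^2 + x^2)
       = - ((-1)^K * (x^2/m^2)^K * (2 * x^2 / (m^2 + x^2)))" if "m \<ge> 1" for m :: real and K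
  proof (induction K)
    case (Suc K)
    have nz: "m^2 + x^2 > 0" "m^2 > 0" using that x by (auto intro!: add_pos_pos)
    have "(-1)^K * (2 * x^(2*K+2)) * (1 / m^(2*K+2)) = (-1)^K * (x^2/m^2)^K * (2 * x^2 / m^2)"
    proof -
      have "z^(2*K+2) = (z^2)^K * z^2" for z :: real
        by (simp only: power_add power_mult)
      thus ?thesis by (simp only: power_divide) simp
    qed
    with Suc have "(\<Sum>k<Suc K. (-1)^k * (2 * x^(2*k+2)) * (1 / m^(2*k+2))) - 2 * x^2 / (m^2 + x^2)
       = (-1)^K * (x^2/m^2)^K * (2 * x^2 / m^2 - 2 * x^2 / (m^2 + x^2))"
      by (simp add: algebra_simps)
    also have "2 * x^2 / m^2 - 2 * x^2 / (m^2 + x^2) = (x^2/m^2) * (2 * x^2 / (m^2 + x^2))"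
      using nz by (simp add: divide_simps) (simp add: algebra_simps)
    finally show ?case by (simp add: mult_ac)
  qed auto
  have "norm ((\<Sum>k<K. (-1)^k * (2 * x^(2*k+2)) * zeta (real (2*k+2))) - T) \<le> (x^2)^K * T" for K
  proof -
    have s1: "(\<lambda>n. - ((-1)^K * (x^2/(real n + 1)^2)^K * (2 * x^2 / ((real n + 1)^2 + x^2)))) sums
       ((\<Sum>k<K. (-1)^k * (2 * x^(2*k+2)) * zeta (real (2*k+2))) - T)"
      using sums_diff[OF fin[of K] T] by (subst (asm) geo) auto
    have le: "norm (- ((-1)^K * (x^2/(real n + 1)^2)^K * (2 * x^2 / ((real n + 1)^2 + x^2))))
         \<le> (x^2)^K * (2 * x^2 / ((real n + 1)^2 + x^2))" for n
    proof -
      have "(x^2/(real n + 1)^2)^K \<le> (x^2 / 1)^K"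
        by (intro power_mono divide_left_mono) auto
      moreover have "2 * x^2 / ((real n + 1)^2 + x^2) \<ge> 0" by auto
      ultimately have "(x^2/(real n + 1)^2)^K * (2 * x^2 / ((real n + 1)^2 + x^2))
          \<le> (x^2)^K * (2 * x^2 / ((real n + 1)^2 + x^2))" by (intro mult_right_mono) auto
      thus ?thesis by (simp add: abs_mult power_abs)
    qed
    have s2: "(\<lambda>n. (x^2)^K * (2 * x^2 / ((real n + 1)^2 + x^2))) sums ((x^2)^K * T)"
      by (intro sums_mult T)
    show ?thesis
      using norm_suminf_le[OF le sums_summable[OF s2]] sums_unique[OF s1] sums_unique[OF s2] by simp
  qed
  moreover have "(\<lambda>K. (x^2)^K * T) \<longlonglongrightarrow> 0"
    using x by (intro tendsto_mult_left_zero LIMSEQ_realpow_zero) (auto simp: power_less_one_iff)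
  ultimately have "(\<lambda>K. (\<Sum>k<K. (-1)^k * (2 * x^(2*k+2)) * zeta (real (2*k+2))) - T) \<longlonglongrightarrow> 0"
    by (rule Lim_null_comparison[OF always_eventually[OF allI]])
  hence "(\<lambda>K. (\<Sum>k<K. (-1)^k * (2 * x^(2*k+2)) * zeta (real (2*k+2)))) \<longlonglongrightarrow> T"
    by (simp add: LIM_zero_iff)
  thus ?thesis by (simp add: sums_def T_def mult_ac)
qed

lemma c_even: "c (2 * k + 2) = (-1) ^ k * (2 * zeta (real (2 * k + 2))) / (2 * pi) ^ (2 * k + 2)"
  by (simp add: c_def)

lemma c_sums_pos:
  fixes s :: real
  assumes s: "0 < s" "s < 2 * pi"
  shows "(\<lambda>k. c (2 * k) * s ^ (2 * k)) sums (s / 2 * cosh (s / 2) / sinh (s / 2))"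
proof -
  define x where "x = s / (2 * pi)"
  have x: "0 < x" "x < 1" and sx: "s = 2 * pi * x" using s by (auto simp: x_def)
  have "(\<lambda>k. (-1)^k * (2 * zeta (real (2 * k + 2))) * x^(2*k+2)) =
        (\<lambda>k. c (2 * Suc k) * s ^ (2 * Suc k))"
    using c_even unfolding sx by (auto simp: fun_eq_iff power_mult_distrib)
  with zeta_series_coth[OF x]
  have "(\<lambda>k. c (2 * Suc k) * s ^ (2 * Suc k)) sums (s / 2 * cosh (s / 2) / sinh (s / 2) - 1)"
    by (simp add: sx)
  thus ?thesis by (subst (asm) sums_Suc_iff) (simp add: c_def)
qed

text \<open>The even part is \<open>(s/2) coth (s/2)\<close>, which takes the same value at
  \<open>s\<close> and \<open>- s\<close>, so that \<open>c_sums_pos\<close> covers both signs; the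
  odd part is the single term \<open>s / 2\<close> from \<open>c 1\<close>.\<close>

lemma c_sums:
  fixes s :: real
  assumes s: "s \<noteq> 0" "\<bar>s\<bar> < 2 * pi"
  shows "(\<lambda>k. c k * s ^ k) sums (s / (1 - exp (- s)))"
proof -
  have "(\<lambda>k. c (2 * k) * \<bar>s\<bar> ^ (2 * k)) sums (\<bar>s\<bar> / 2 * cosh (\<bar>s\<bar> / 2) / sinh (\<bar>s\<bar> / 2))"
    using s by (intro c_sums_pos) auto
  moreover have "\<bar>s\<bar> / 2 * cosh (\<bar>s\<bar> / 2) / sinh (\<bar>s\<bar> / 2) = s / 2 * cosh (s / 2) / sinh (s / 2)"
    by (cases "s \<ge> 0") (auto simp: abs_if)
  moreover have "\<bar>s\<bar> ^ (2 * k) = s ^ (2 * k)" for k by (simp add: power_even_abs)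
  ultimately have ev: "(\<lambda>k. c (2 * k) * s ^ (2 * k)) sums (s / 2 * cosh (s / 2) / sinh (s / 2))"
    by simp
  have od: "(\<lambda>k. if k = 0 then s / 2 else 0) sums (s / 2)"
    using sums_single[of 0 "\<lambda>_. s / 2"] by simp
  have "c n * s ^ n = (if even n then c (2 * (n div 2)) * s ^ (2 * (n div 2))
             else if (n - 1) div 2 = 0 then s / 2 else 0)" for n
  proof (cases "even n")
    case False
    then obtain k where "n = 2 * k + 1" by (elim oddE)
    thus ?thesis by (cases k) (auto simp: c_def)
  qed auto
  with sums_if[OF od ev] have "(\<lambda>n. c n * s ^ n) sums (s / 2 + s / 2 * cosh (s / 2) / sinh (s / 2))"
    by simp
  moreover have "s / 2 + s / 2 * cosh (s / 2) / sinh (s / 2) = s / (1 - exp (- s))"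
  proof -
    define q where "q = exp (s / 2)"
    have q: "q > 0" "q \<noteq> 1" "q^2 \<noteq> 1" using s by (auto simp: q_def power2_eq_square exp_add[symmetric])
    have e: "exp (-s) = 1 / q^2" by (simp add: q_def power2_eq_square exp_add[symmetric] exp_minus field_simps)
    have sc: "sinh (s/2) = (q^2 - 1) / (2 * q)" "cosh (s/2) = (q^2 + 1) / (2 * q)"
      using q by (auto simp: sinh_def cosh_def q_def exp_minus field_simps power2_eq_square)
    thus ?thesis using q unfolding e sc by (simp add: divide_simps) (simp add: algebra_simps)
  qed
  ultimately show ?thesis by simp
qed

text \<open>A formal identity from an analytic one: the difference \<open>D\<close> of the two sides
  has radius of convergence at least 1 and evaluates to 0 there, so its coefficients vanish.\<close>

lemma fps_c_mult: "Abs_fps c * (1 - fps_exp (-1)) = fps_X"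
proof -
  define D where "D = Abs_fps c * (1 - fps_exp (-1)) - (fps_X :: real fps)"
  define F where "F = Abs_fps c"
  have rF: "fps_conv_radius F \<ge> ereal 1"
    unfolding fps_conv_radius_def
  proof (rule conv_radius_geI_ex)
    fix r :: real assume r: "0 < r" "ereal r < ereal 1"
    have "(\<lambda>k. c k * r ^ k) sums (r / (1 - exp (- r)))"
      by (rule c_sums) (use r pi_gt3 in auto)
    thus "\<exists>z. norm z = r \<and> summable (\<lambda>n. fps_nth F n * z ^ n)"
      using r by (intro exI[of _ r]) (auto simp: F_def sums_iff)
  qed
  have r1: "fps_conv_radius (1 - fps_exp (-1) :: real fps) = \<infinity>"
    using fps_conv_radius_diff[of "1 :: real fps" "fps_exp (-1)"] by simp
  have rp: "fps_conv_radius (F * (1 - fps_exp (-1))) \<ge> ereal 1"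
    using fps_conv_radius_mult[of F "1 - fps_exp (-1)"] rF r1 by auto
  have rD: "fps_conv_radius D \<ge> ereal 1"
    using fps_conv_radius_diff[of "F * (1 - fps_exp (-1))" fps_X] rp by (auto simp: D_def F_def)
  have ev: "eval_fps D s = 0" if "norm s < 1" for s :: real
  proof -
    have l: "ereal (norm s) < ereal 1" using that by simp
    have l1: "ereal (norm s) < fps_conv_radius F" using less_le_trans[OF l rF] .
    have l2: "ereal (norm s) < fps_conv_radius (F * (1 - fps_exp (-1)))"
      using less_le_trans[OF l rp] .
    have "eval_fps D s = eval_fps (F * (1 - fps_exp (-1))) s - eval_fps fps_X s"
      unfolding D_def F_def[symmetric] by (rule eval_fps_diff) (use l2 in simp_all)
    also have "eval_fps (F * (1 - fps_exp (-1))) s = eval_fps F s * eval_fps (1 - fps_exp (-1)) s"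
      by (rule eval_fps_mult) (use l1 r1 in simp_all)
    also have "eval_fps (1 - fps_exp (-1)) s = eval_fps 1 s - eval_fps (fps_exp (-1)) s"
      by (rule eval_fps_diff) simp_all
    finally have "eval_fps D s = eval_fps F s * (1 - exp (- s)) - s"
      by simp
    also have "eval_fps F s * (1 - exp (- s)) = s"
      using c_sums[of s] that pi_gt3 by (cases "s = 0") (auto simp: eval_fps_def F_def sums_iff)
    finally show ?thesis by simp
  qed
  have sm: "(\<lambda>n. fps_nth D n * (s - 0) ^ n) sums 0" if "norm (s - 0) < 1" for s :: real
  proof -
    have "ereal (norm s) < fps_conv_radius D"
      by (rule less_le_trans[OF _ rD]) (use that in simp)
    from sums_eval_fps[OF this] ev[of s] that show ?thesis by simp
  qed
  have "fps_nth D n = 0" for n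
  proof (cases "n = 0")
    case True
    thus ?thesis by (simp add: D_def)
  next
    case False
    show ?thesis
    proof (rule ccontr)
      assume "fps_nth D n \<noteq> 0"
      \<comment> \<open>Isolated zeros, applied to the zero function: a nonzero coefficient would
        give a punctured disc on which 0 is nonzero.\<close>
      from powser_0_nonzero[of 1 0 "fps_nth D" "\<lambda>_. 0" n, OF zero_less_one sm refl this] False
      obtain r :: real where r: "0 < r" "\<And>z :: real. z \<in> cball 0 r - {0} \<Longrightarrow> (0::real) \<noteq> 0" by blast
      from r(2)[of r] r(1) show False by auto
    qed
  qed
  hence "D = 0" by (simp add: fps_eq_iff)
  thus ?thesis by (simp add: D_def)
qed


section \<open>Majorants of power series\<close>

definition fps_majorized :: "real fps \<Rightarrow> real fps \<Rightarrow> bool" (infix "\<sqsubseteq>" 50) where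
  "G \<sqsubseteq> H \<longleftrightarrow> (\<forall>n. \<bar>fps_nth G n\<bar> \<le> fps_nth H n)"

lemma majorizedI: "(\<And>n. \<bar>fps_nth G n\<bar> \<le> fps_nth H n) \<Longrightarrow> G \<sqsubseteq> H"
  by (simp add: fps_majorized_def)

lemma majorizedD: "G \<sqsubseteq> H \<Longrightarrow> \<bar>fps_nth G n\<bar> \<le> fps_nth H n"
  by (simp add: fps_majorized_def)

lemma majorized_nonneg: "G \<sqsubseteq> H \<Longrightarrow> fps_nth H n \<ge> 0"
  using majorizedD[of G H n] by linarith

lemma majorized_self_nonneg: "H \<sqsubseteq> H \<longleftrightarrow> (\<forall>n. fps_nth H n \<ge> 0)"
  by (simp add: fps_majorized_def abs_le_iff)

lemma majorized_add: "G \<sqsubseteq> H \<Longrightarrow> G' \<sqsubseteq> H' \<Longrightarrow> G + G' \<sqsubseteq> H + H'"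
  unfolding fps_majorized_def by (auto intro: order_trans[OF abs_triangle_ineq] add_mono)

lemma majorized_diff: "G \<sqsubseteq> H \<Longrightarrow> G' \<sqsubseteq> H' \<Longrightarrow> G - G' \<sqsubseteq> H + H'"
  unfolding fps_majorized_def by (auto intro: order_trans[OF abs_triangle_ineq4] add_mono)

lemma majorized_mult:
  assumes "G \<sqsubseteq> H" "G' \<sqsubseteq> H'"
  shows "G * G' \<sqsubseteq> H * H'"
proof (rule majorizedI)
  fix n
  have "\<bar>fps_nth (G * G') n\<bar> \<le> (\<Sum>i=0..n. \<bar>fps_nth G i * fps_nth G' (n - i)\<bar>)"
    unfolding fps_mult_nth by (rule sum_abs)
  also have "\<dots> \<le> (\<Sum>i=0..n. fps_nth H i * fps_nth H' (n - i))"
    unfolding abs_mult using assms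
    by (intro sum_mono mult_mono majorizedD majorized_nonneg[OF assms(1)] abs_ge_zero)
  finally show "\<bar>fps_nth (G * G') n\<bar> \<le> fps_nth (H * H') n" by (simp add: fps_mult_nth)
qed

lemma majorized_1: "1 \<sqsubseteq> 1"
  by (rule majorizedI) (simp add: fps_one_nth)

text \<open>The norm \<open>sum |g_j| r^j <= K\<close>, phrased by partial sums so that no
  convergence has to be tracked. It is submultiplicative, and \<open>K / r^n\<close> bounds the n-th
  coefficient.\<close>

definition fps_bounded :: "real fps \<Rightarrow> real \<Rightarrow> real \<Rightarrow> bool" where
  "fps_bounded G r K \<longleftrightarrow> (\<forall>n. (\<Sum>j\<le>n. \<bar>fps_nth G j\<bar> * r ^ j) \<le> K)"

lemma fps_boundedD: "fps_bounded G r K \<Longrightarrow> (\<Sum>j\<le>n. \<bar>fps_nth G j\<bar> * r ^ j) \<le> K"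
  by (simp add: fps_bounded_def)

lemma fps_bounded_mono: "fps_bounded G r K \<Longrightarrow> K \<le> K' \<Longrightarrow> fps_bounded G r K'"
  unfolding fps_bounded_def by (meson order_trans)

lemma fps_bounded_nonneg:
  assumes "fps_bounded G r K"
  shows "K \<ge> 0"
  using fps_boundedD[OF assms, of 0] by (simp add: order_trans[OF abs_ge_zero])

lemma fps_bounded_nth:
  assumes "fps_bounded G r K" "r \<ge> 0"
  shows "\<bar>fps_nth G n\<bar> * r ^ n \<le> K"
proof -
  have "\<bar>fps_nth G n\<bar> * r ^ n \<le> (\<Sum>j\<le>n. \<bar>fps_nth G j\<bar> * r ^ j)"
    by (rule member_le_sum) (use assms in auto)
  also have "\<dots> \<le> K" by (rule fps_boundedD[OF assms(1)])
  finally show ?thesis .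
qed

lemma sum_convolution_le:
  fixes f g :: "nat \<Rightarrow> real"
  assumes "\<And>i. f i \<ge> 0" "\<And>i. g i \<ge> 0"
  shows "(\<Sum>n\<le>N. \<Sum>i\<le>n. f i * g (n - i)) \<le> (\<Sum>i\<le>N. f i) * (\<Sum>j\<le>N. g j)"
proof -
  have "(\<Sum>n\<le>N. \<Sum>i\<le>n. f i * g (n - i)) = (\<Sum>(i,j) \<in> {(i,j). i + j \<le> N}. f i * g j)"
    by (rule sum.triangle_reindex_eq[symmetric])
  also have "\<dots> \<le> (\<Sum>(i,j) \<in> {..N} \<times> {..N}. f i * g j)"
    by (rule sum_mono2) (use assms in auto)
  also have "\<dots> = (\<Sum>i\<le>N. f i) * (\<Sum>j\<le>N. g j)"
    by (simp add: sum_product sum.cartesian_product)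
  finally show ?thesis .
qed

lemma fps_bounded_mult:
  assumes "fps_bounded G r K" "fps_bounded H r K'" "r \<ge> 0"
  shows "fps_bounded (G * H) r (K * K')"
  unfolding fps_bounded_def
proof
  fix N
  have "(\<Sum>n\<le>N. \<bar>fps_nth (G * H) n\<bar> * r ^ n) \<le>
        (\<Sum>n\<le>N. \<Sum>i\<le>n. (\<bar>fps_nth G i\<bar> * r ^ i) * (\<bar>fps_nth H (n - i)\<bar> * r ^ (n - i)))"
  proof (rule sum_mono)
    fix n
    have "\<bar>fps_nth (G * H) n\<bar> * r ^ n \<le> (\<Sum>i=0..n. \<bar>fps_nth G i * fps_nth H (n - i)\<bar>) * r ^ n"
      unfolding fps_mult_nth by (intro mult_right_mono sum_abs) (use assms in auto)
    also have "\<dots> = (\<Sum>i\<le>n. (\<bar>fps_nth G i\<bar> * r ^ i) * (\<bar>fps_nth H (n - i)\<bar> * r ^ (n - i)))"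
      unfolding sum_distrib_right atLeast0AtMost
      by (intro sum.cong refl) (auto simp: abs_mult mult_ac simp flip: power_add)
    finally show "\<bar>fps_nth (G * H) n\<bar> * r ^ n \<le> \<dots>" .
  qed
  also have "\<dots> \<le> (\<Sum>i\<le>N. \<bar>fps_nth G i\<bar> * r ^ i) * (\<Sum>i\<le>N. \<bar>fps_nth H i\<bar> * r ^ i)"
    by (rule sum_convolution_le) (use assms in auto)
  also have "\<dots> \<le> K * K'"
    by (intro mult_mono fps_boundedD assms fps_bounded_nonneg[OF assms(1)] sum_nonneg)
       (use assms in auto)
  finally show "(\<Sum>n\<le>N. \<bar>fps_nth (G * H) n\<bar> * r ^ n) \<le> K * K'" .
qed

lemma fps_bounded_1: "fps_bounded 1 r 1"
  unfolding fps_bounded_def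
proof
  fix n
  have "(\<Sum>j\<le>n. \<bar>fps_nth (1 :: real fps) j\<bar> * r ^ j) = (\<Sum>j\<le>n. if j = 0 then 1 else 0)"
    by (intro sum.cong) (auto simp: fps_one_nth)
  thus "(\<Sum>j\<le>n. \<bar>fps_nth (1 :: real fps) j\<bar> * r ^ j) \<le> 1" by simp
qed

lemma fps_bounded_prod:
  assumes "finite I" "\<And>i. i \<in> I \<Longrightarrow> fps_bounded (G i) r (K i)" "r \<ge> 0"
  shows "fps_bounded (\<Prod>i\<in>I. G i) r (\<Prod>i\<in>I. K i)"
  using assms(1,2) by (induction I) (auto intro!: fps_bounded_mult fps_bounded_1 assms(3))

lemma fps_bounded_exp:
  assumes "r \<ge> 0"
  shows "fps_bounded (fps_exp v) r (exp (\<bar>v\<bar> * r))"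
  unfolding fps_bounded_def
proof
  fix n
  have s: "(\<lambda>j. (\<bar>v\<bar> * r) ^ j / fact j) sums exp (\<bar>v\<bar> * r)"
    using exp_converges[of "\<bar>v\<bar> * r"] by (simp add: divide_inverse mult.commute)
  have "(\<Sum>j\<le>n. \<bar>fps_nth (fps_exp v) j\<bar> * r ^ j) = (\<Sum>j\<le>n. (\<bar>v\<bar> * r) ^ j / fact j)"
    by (intro sum.cong) (auto simp: power_mult_distrib power_abs abs_divide)
  also have "\<dots> \<le> (\<Sum>j. (\<bar>v\<bar> * r) ^ j / fact j)"
    by (rule sum_le_suminf) (use s assms in \<open>auto simp: sums_iff\<close>)
  finally show "(\<Sum>j\<le>n. \<bar>fps_nth (fps_exp v) j\<bar> * r ^ j) \<le> exp (\<bar>v\<bar> * r)"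
    using s by (simp add: sums_iff)
qed



section \<open>The Todd series \<open>l s / (1 - exp (- l s))\<close> of one prime\<close>

definition todd :: "real \<Rightarrow> real fps" where
  "todd l = Abs_fps (\<lambda>k. c k * l ^ k)"

lemma todd_nth [simp]: "fps_nth (todd l) k = c k * l ^ k"
  by (simp add: todd_def)

lemma todd_mult: "todd l * (1 - fps_exp (- l)) = fps_const l * fps_X"
proof (rule fps_ext)
  fix n
  have e: "fps_nth (1 - fps_exp (- l)) j = l ^ j * fps_nth (1 - fps_exp (- 1)) j" for j
    by (simp add: fps_one_nth power_minus[of l] mult.commute)
  have "fps_nth (todd l * (1 - fps_exp (- l))) n =
     (\<Sum>i=0..n. l ^ n * (c i * fps_nth (1 - fps_exp (- 1)) (n - i)))"
    unfolding fps_mult_nth e by (intro sum.cong refl) (auto simp: mult_ac simp flip: power_add)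
  also have "\<dots> = l ^ n * fps_nth (Abs_fps c * (1 - fps_exp (- 1))) n"
    by (simp add: fps_mult_nth sum_distrib_left)
  also have "\<dots> = fps_nth (fps_const l * fps_X) n"
    by (subst fps_c_mult) (simp add: fps_X_def)
  finally show "fps_nth (todd l * (1 - fps_exp (- l))) n = fps_nth (fps_const l * fps_X) n" .
qed

lemma abs_c_le:
  assumes "n \<ge> 2"
  shows "\<bar>c n\<bar> \<le> 3 / 6 ^ n"
proof (cases "odd n")
  case True
  thus ?thesis using assms by (simp add: c_def)
next
  case False
  have "\<bar>c n\<bar> = 2 * zeta (real n) / (2 * pi) ^ n"
    using assms False zeta_bounds(1)[OF assms] by (simp add: c_def abs_mult power_abs)
  also have "\<dots> \<le> (pi^2 / 3) / (2 * pi) ^ n"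
    using zeta_bounds(2)[OF assms] by (intro divide_right_mono) auto
  \<comment> \<open>Two of the factors \<open>2 * pi\<close> cancel \<open>pi^2\<close>, and only
    then is \<open>pi\<close> replaced by 3.\<close>
  also have "\<dots> = (1 / 12) / (2 * pi) ^ (n - 2)"
    using assms by (simp add: power_diff power2_eq_square field_simps)
  also have "\<dots> \<le> (1 / 12) / 6 ^ (n - 2)"
    using pi_gt3 by (intro divide_left_mono power_mono) auto
  also have "\<dots> = 3 / 6 ^ n" using assms by (simp add: power_diff)
  finally show ?thesis .
qed

lemma sum_geometric_tail_le:
  fixes q :: real
  assumes "0 \<le> q" "q < 1" "finite A" "\<And>j. j \<in> A \<Longrightarrow> j \<ge> k"
  shows "(\<Sum>j\<in>A. q ^ j) \<le> q ^ k / (1 - q)"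
proof -
  have s: "(\<lambda>j. q ^ k * q ^ j) sums (q ^ k * (1 / (1 - q)))"
    using assms by (intro sums_mult geometric_sums) auto
  have "(\<Sum>j\<in>A. q ^ j) = (\<Sum>j\<in>(\<lambda>j. j - k) ` A. q ^ k * q ^ j)"
    using assms(4)
    by (intro sum.reindex_bij_witness[of _ "\<lambda>j. j + k" "\<lambda>j. j - k"])
       (auto simp flip: power_add)
  also have "\<dots> \<le> (\<Sum>j. q ^ k * q ^ j)"
    by (rule sum_le_suminf) (use s assms in \<open>auto simp: sums_iff\<close>)
  also have "\<dots> = q ^ k / (1 - q)" using s by (simp add: sums_iff)
  finally show ?thesis .
qed

text \<open>The bound is sharp to first order, as \<open>c 1 = 1/2\<close>, and this is what makes
  the product over \<open>N\<close> primes no larger than \<open>exp (N l r / 2)\<close>. For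
  \<open>l * r <= 2\<close> all terms of order at least 2 fit into the quadratic term of the
  exponential.\<close>

lemma fps_bounded_todd:
  assumes "0 \<le> l" "0 \<le> r" "l * r \<le> 2"
  shows "fps_bounded (todd l) r (exp (l * r / 2))"
  unfolding fps_bounded_def
proof
  fix n
  define t where "t = l * r"
  have t: "0 \<le> t" "t \<le> 2" using assms by (auto simp: t_def)
  have "(\<Sum>j\<le>n. \<bar>fps_nth (todd l) j\<bar> * r ^ j) = (\<Sum>j\<le>n. \<bar>c j\<bar> * t ^ j)"
    by (intro sum.cong) (use assms in \<open>auto simp: t_def abs_mult power_abs power_mult_distrib\<close>)
  also have "\<dots> \<le> (\<Sum>j\<in>{0,1} \<union> {2..n}. \<bar>c j\<bar> * t ^ j)"
    by (rule sum_mono2) (use t in auto)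
  also have "\<dots> = (\<Sum>j\<in>{0,1}. \<bar>c j\<bar> * t ^ j) + (\<Sum>j\<in>{2..n}. \<bar>c j\<bar> * t ^ j)"
    by (rule sum.union_disjoint) auto
  also have "(\<Sum>j\<in>{0,1}. \<bar>c j\<bar> * t ^ j) = 1 + t / 2" by (simp add: c_def)
  also have "(\<Sum>j\<in>{2..n}. \<bar>c j\<bar> * t ^ j) \<le> (\<Sum>j\<in>{2..n}. 3 * (t / 6) ^ j)"
  proof (rule sum_mono)
    fix j assume "j \<in> {2..n}"
    hence "\<bar>c j\<bar> * t ^ j \<le> 3 / 6 ^ j * t ^ j" using t by (intro mult_right_mono abs_c_le) auto
    thus "\<bar>c j\<bar> * t ^ j \<le> 3 * (t / 6) ^ j" by (simp add: power_divide)
  qed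
  also have "\<dots> = 3 * (\<Sum>j\<in>{2..n}. (t / 6) ^ j)" by (simp add: sum_distrib_left)
  also have "\<dots> \<le> 3 * ((t / 6) ^ 2 / (1 - t / 6))"
    using t by (intro mult_left_mono sum_geometric_tail_le) auto
  also have "\<dots> \<le> 3 * ((t / 6) ^ 2 / (2 / 3))"
    using t by (intro mult_left_mono divide_left_mono) auto
  also have "\<dots> = (t / 2)^2 / 2" by (simp add: power2_eq_square)
  also have "1 + t / 2 + (t / 2)^2 / 2 \<le> exp (t / 2)"
    by (rule exp_lower_Taylor_quadratic) (use t in auto)
  finally show "(\<Sum>j\<le>n. \<bar>fps_nth (todd l) j\<bar> * r ^ j) \<le> exp (l * r / 2)"
    by (simp add: t_def)
qed


section \<open>Lattice points in a simplex\<close>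

text \<open>Induction along \<open>u, u - l, u - 2 l, ...\<close>, which becomes negative after
  finitely many steps; made for difference equations with step \<open>l\<close>.\<close>

lemma step_induct:
  fixes u l :: real
  assumes l: "l > 0" and neg: "\<And>u. u < 0 \<Longrightarrow> Q u" and step: "\<And>u. u \<ge> 0 \<Longrightarrow> Q (u - l) \<Longrightarrow> Q u"
  shows "Q u"
proof -
  have *: "\<forall>u. u < real n * l \<longrightarrow> Q u" for n
  proof (induction n)
    case 0 thus ?case using neg by simp
  next
    case (Suc n)
    show ?case
    proof safe
      fix u assume "u < real (Suc n) * l"
      hence "Q (u - l)" using Suc by (simp add: algebra_simps)
      thus "Q u" using neg step by (cases "u < 0") auto
    qed
  qed
  obtain n where "u < real n * l" using reals_Archimedean3[OF l] by blast
  with * show ?thesis by blast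
qed

locale weights =
  fixes L :: "nat \<Rightarrow> real"
  assumes L_pos: "L i > 0"
begin

definition wt :: "nat set \<Rightarrow> (nat \<Rightarrow> nat) \<Rightarrow> real" where
  "wt I e = (\<Sum>i\<in>I. real (e i) * L i)"

definition pts :: "nat set \<Rightarrow> real \<Rightarrow> (nat \<Rightarrow> nat) set" where
  "pts I u = {e. (\<forall>i. i \<notin> I \<longrightarrow> e i = 0) \<and> wt I e \<le> u}"

definition cnt :: "nat set \<Rightarrow> real \<Rightarrow> real" where
  "cnt I u = real (card (pts I u))"

lemma wt_nonneg: "wt I e \<ge> 0"
  unfolding wt_def by (intro sum_nonneg mult_nonneg_nonneg) (auto intro: less_imp_le[OF L_pos])

lemma pts_neg: "u < 0 \<Longrightarrow> pts I u = {}"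
proof -
  assume "u < 0"
  hence "\<not> wt I e \<le> u" for e using wt_nonneg[of I e] by linarith
  thus ?thesis by (simp add: pts_def)
qed

lemma cnt_neg: "u < 0 \<Longrightarrow> cnt I u = 0"
  by (simp add: cnt_def pts_neg)

lemma cnt_nonneg: "cnt I u \<ge> 0"
  by (simp add: cnt_def)

lemma cnt_empty: "u \<ge> 0 \<Longrightarrow> cnt {} u = 1"
proof -
  assume "u \<ge> 0"
  hence "pts {} u = {\<lambda>_. 0}" by (auto simp: pts_def wt_def)
  thus ?thesis by (simp add: cnt_def)
qed

lemma finite_pts:
  assumes I: "finite I"
  shows "finite (pts I u)"
proof (cases "u < 0")
  case False
  define B where "B = {..nat \<lfloor>\<Sum>i\<in>I. u / L i\<rfloor>}"
  have "pts I u \<subseteq> {e. \<forall>i. (i \<in> I \<longrightarrow> e i \<in> B) \<and> (i \<notin> I \<longrightarrow> e i = 0)}"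
  proof safe
    fix e i assume e: "e \<in> pts I u" and i: "i \<in> I"
    have "real (e i) * L i \<le> wt I e" unfolding wt_def
      by (rule member_le_sum) (use i I in \<open>auto intro!: mult_nonneg_nonneg less_imp_le[OF L_pos]\<close>)
    also have "\<dots> \<le> u" using e by (simp add: pts_def)
    finally have "real (e i) \<le> u / L i" using L_pos[of i] by (simp add: pos_le_divide_eq)
    also have "\<dots> \<le> (\<Sum>i\<in>I. u / L i)"
      by (rule member_le_sum) (use i I False in \<open>auto intro!: divide_nonneg_nonneg less_imp_le[OF L_pos]\<close>)
    finally show "e i \<in> B" by (simp add: B_def le_nat_floor)
  qed (auto simp: pts_def)
  thus ?thesis by (rule finite_subset) (rule finite_set_of_finite_funs; use I in \<open>simp add: B_def\<close>)
qed (simp add: pts_neg)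

lemma wt_shift:
  assumes "finite I" "k \<in> I"
  shows "wt I (e(k := Suc (e k))) = wt I e + L k"
proof -
  have "wt I (e(k := Suc (e k))) = (\<Sum>i\<in>I. real (e i) * L i + (if i = k then L k else 0))"
    unfolding wt_def by (intro sum.cong) (auto simp: algebra_simps)
  thus ?thesis using assms by (simp add: wt_def sum.distrib)
qed

lemma pts_shift:
  assumes "finite I" "k \<in> I"
  shows "{e \<in> pts I u. e k > 0} = (\<lambda>e. e(k := Suc (e k))) ` pts I (u - L k)"
proof safe
  fix e assume e: "e \<in> pts I u" "e k > 0"
  define e' where "e' = e(k := e k - 1)"
  have ee: "e = e'(k := Suc (e' k))" using e by (auto simp: e'_def)
  have "wt I e = wt I e' + L k" by (subst ee, rule wt_shift[OF assms])
  hence "e' \<in> pts I (u - L k)" using e by (auto simp: pts_def e'_def)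
  with ee show "e \<in> (\<lambda>e. e(k := Suc (e k))) ` pts I (u - L k)" by blast
next
  fix e assume "e \<in> pts I (u - L k)"
  thus "e(k := Suc (e k)) \<in> pts I u" using assms by (auto simp: pts_def wt_shift)
qed auto

lemma inj_shift: "inj_on (\<lambda>e. e(k := Suc (e k))) (X :: (nat \<Rightarrow> nat) set)"
proof (rule inj_onI)
  fix e f :: "nat \<Rightarrow> nat" assume *: "e(k := Suc (e k)) = f(k := Suc (f k))"
  show "e = f"
  proof
    fix i show "e i = f i" using fun_cong[OF *, of i] by (cases "i = k") auto
  qed
qed

lemma pts_zero:
  assumes "finite I" "k \<notin> I"
  shows "{e \<in> pts (insert k I) u. e k = 0} = pts I u"
proof -
  have "wt (insert k I) e = wt I e" if "e k = 0" for e using assms that by (simp add: wt_def)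
  moreover have "(\<forall>i. i \<notin> insert k I \<longrightarrow> e i = 0) \<and> e k = 0 \<longleftrightarrow> (\<forall>i. i \<notin> I \<longrightarrow> e i = 0)" for e
    using assms by (metis insert_iff)
  ultimately show ?thesis unfolding pts_def using assms(2) by (auto; metis)
qed

text \<open>Lowering a positive coordinate \<open>k\<close> by one leads to the points at level
  \<open>u - L k\<close>; if the coordinate is zero, the point already lies over
  \<open>I\<close>.\<close>

lemma cnt_step:
  assumes "finite I" "k \<notin> I"
  shows "cnt (insert k I) u = cnt (insert k I) (u - L k) + cnt I u"
proof -
  let ?J = "insert k I"
  have "pts ?J u = {e \<in> pts ?J u. e k > 0} \<union> {e \<in> pts ?J u. e k = 0}" by auto
  hence "card (pts ?J u) = card ({e \<in> pts ?J u. e k > 0} \<union> {e \<in> pts ?J u. e k = 0})" by simp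
  also have "\<dots> = card {e \<in> pts ?J u. e k > 0} + card {e \<in> pts ?J u. e k = 0}"
    by (rule card_Un_disjoint) (use assms finite_pts[of ?J u] in auto)
  also have "card {e \<in> pts ?J u. e k > 0} = card (pts ?J (u - L k))"
    using assms by (subst pts_shift) (auto simp: card_image[OF inj_shift])
  also have "{e \<in> pts ?J u. e k = 0} = pts I u" by (rule pts_zero[OF assms])
  finally show ?thesis by (simp add: cnt_def)
qed

text \<open>\<open>slack I u\<close> is the integral of \<open>cnt I\<close> over \<open>[0, u]\<close>.\<close>

definition slack :: "nat set \<Rightarrow> real \<Rightarrow> real" where
  "slack I u = (\<Sum>e\<in>pts I u. u - wt I e)"

text \<open>Together with \<open>slack_le\<close>: the integral of the increasing function
  \<open>cnt I\<close> over \<open>[u - l, u]\<close> lies between \<open>l\<close> times its values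
  at the two ends.\<close>

lemma slack_ge:
  assumes "finite I" "l \<ge> 0"
  shows "slack I (u - l) + l * cnt I (u - l) \<le> slack I u"
proof -
  have "slack I (u - l) + l * cnt I (u - l) = (\<Sum>e\<in>pts I (u - l). u - wt I e)"
    by (simp add: slack_def cnt_def sum_subtractf sum.distrib algebra_simps)
  also have "\<dots> \<le> slack I u" unfolding slack_def
    by (rule sum_mono2) (use assms finite_pts in \<open>auto simp: pts_def\<close>)
  finally show ?thesis .
qed

lemma slack_le:
  assumes "finite I" "l \<ge> 0"
  shows "slack I u \<le> slack I (u - l) + l * cnt I u"
proof -
  have "pts I (u - l) \<subseteq> pts I u" using assms by (auto simp: pts_def)
  hence "slack I (u - l) = (\<Sum>e\<in>pts I u. if e \<in> pts I (u - l) then u - l - wt I e else 0)"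
    using finite_pts[OF assms(1), of u]
    by (simp add: slack_def sum.inter_restrict[symmetric] Int_absorb1)
  moreover have "slack I u \<le> (\<Sum>e\<in>pts I u. (if e \<in> pts I (u - l) then u - l - wt I e else 0) + l)"
    unfolding slack_def by (intro sum_mono) (use assms in \<open>auto simp: pts_def\<close>)
  ultimately show ?thesis by (simp add: sum.distrib cnt_def algebra_simps)
qed

text \<open>Along steps of \<open>L k\<close> the left side grows by exactly
  \<open>L k * cnt I (u - L k)\<close>, the right side by at least that.\<close>

lemma sum_coord_le_slack:
  assumes "finite I" "k \<in> I"
  shows "(\<Sum>e\<in>pts I u. real (e k) * L k) \<le> slack I u"
proof (induction u rule: step_induct[where l = "L k"])
  case (3 u)
  let ?g = "\<lambda>e. real (e k) * L k"
  have "(\<Sum>e\<in>pts I u. ?g e) = (\<Sum>e\<in>{e \<in> pts I u. e k > 0}. ?g e)"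
    by (rule sum.mono_neutral_right) (use finite_pts[OF assms(1)] in auto)
  also have "\<dots> = (\<Sum>e\<in>pts I (u - L k). ?g e + L k)"
    unfolding pts_shift[OF assms] by (subst sum.reindex[OF inj_shift]) (simp add: algebra_simps)
  also have "\<dots> = (\<Sum>e\<in>pts I (u - L k). ?g e) + L k * cnt I (u - L k)"
    by (simp add: sum.distrib cnt_def)
  also have "\<dots> \<le> slack I (u - L k) + L k * cnt I (u - L k)" using 3 by simp
  also have "\<dots> \<le> slack I u" by (rule slack_ge) (use assms L_pos less_imp_le in auto)
  finally show ?case .
qed (auto simp: L_pos pts_neg slack_def)

text \<open>\<open>cnt (insert k I) u\<close> is the sum of \<open>cnt I\<close> at
  \<open>u, u - L k, u - 2 L k, ...\<close>, so \<open>L k\<close> times it is an upper Riemann sum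
  for the integral \<open>slack I u\<close>.\<close>

lemma slack_le_cnt:
  assumes "finite I" "k \<notin> I"
  shows "slack I u \<le> L k * cnt (insert k I) u"
proof (induction u rule: step_induct[where l = "L k"])
  case (3 u)
  have "slack I u \<le> slack I (u - L k) + L k * cnt I u"
    by (rule slack_le) (use assms L_pos less_imp_le in auto)
  also have "\<dots> \<le> L k * cnt (insert k I) u" using 3 by (subst cnt_step[OF assms]) (simp add: algebra_simps)
  finally show ?case .
qed (auto simp: L_pos pts_neg slack_def cnt_neg)

text \<open>The price of a vanishing coordinate. The total of \<open>u\<close> over all points
  splits into the slack and the contributions of the \<open>card I\<close> coordinates, each of
  which is at most the slack. For the volumes of the simplices equality holds.\<close>

lemma cnt_add_weight:
  assumes "finite I" "k \<notin> I"
  shows "u * cnt I u \<le> real (card I + 1) * L k * cnt (insert k I) u"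
proof -
  have "u * cnt I u = slack I u + (\<Sum>e\<in>pts I u. wt I e)"
    by (simp add: slack_def cnt_def sum_subtractf)
  also have "(\<Sum>e\<in>pts I u. wt I e) = (\<Sum>i\<in>I. \<Sum>e\<in>pts I u. real (e i) * L i)"
    unfolding wt_def by (rule sum.swap)
  also have "\<dots> \<le> (\<Sum>i\<in>I. slack I u)" by (intro sum_mono sum_coord_le_slack assms)
  also have "slack I u + (\<Sum>i\<in>I. slack I u) = real (card I + 1) * slack I u"
    by (simp add: algebra_simps)
  also have "\<dots> \<le> real (card I + 1) * (L k * cnt (insert k I) u)"
    by (intro mult_left_mono slack_le_cnt assms) auto
  finally show ?thesis by (simp add: mult_ac)
qed

text \<open>Iterates \<open>cnt_add_weight\<close>, restoring one coordinate after the other; the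
  number of coordinates is replaced by \<open>k\<close> throughout, so that a geometric factor
  results.\<close>

lemma cnt_drop_le:
  assumes u: "u > 0" and "i \<le> k"
  shows "cnt {i..<k} u \<le> (\<Prod>j<i. L j) * (real k / u) ^ i * cnt {..<k} u"
  using assms(2)
proof (induction i)
  case 0
  thus ?case by (simp add: atLeast0LessThan)
next
  case (Suc i)
  have ins: "{i..<k} = insert i {Suc i..<k}" using Suc.prems by auto
  have "u * cnt {Suc i..<k} u \<le> real (k - i) * L i * cnt {i..<k} u"
    using cnt_add_weight[of "{Suc i..<k}" i u] Suc.prems unfolding ins by (simp add: Suc_diff_Suc)
  also have "\<dots> \<le> real k * L i * cnt {i..<k} u"
    by (intro mult_right_mono) (auto simp: cnt_nonneg less_imp_le[OF L_pos])
  finally have "cnt {Suc i..<k} u \<le> L i * (real k / u) * cnt {i..<k} u"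
    using u by (simp add: field_simps)
  also have "\<dots> \<le> L i * (real k / u) * ((\<Prod>j<i. L j) * (real k / u) ^ i * cnt {..<k} u)"
    using Suc u by (intro mult_left_mono) (auto simp: less_imp_le[OF L_pos])
  finally show ?case by (simp add: mult_ac)
qed

section \<open>The quasi-polynomial approximation\<close>

definition todd_prod :: "nat \<Rightarrow> real fps" where
  "todd_prod k = (\<Prod>i<k. todd (L i))"

text \<open>The residue at \<open>s = 0\<close> of the integrand in Perron's formula for \<open>cnt {..<k} u\<close>.\<close>

definition pol :: "nat \<Rightarrow> real \<Rightarrow> real" where
  "pol k u = fps_nth (todd_prod k * fps_exp u) k / (\<Prod>i<k. L i)"

lemma pol_0: "pol 0 u = 1"
  by (simp add: pol_def todd_prod_def)

lemma prod_L_pos: "(\<Prod>i<k. L i) > 0"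
  by (intro prod_pos) (auto simp: L_pos)

text \<open>Shifting \<open>u\<close> by \<open>- L k\<close> multiplies the generating function by
  \<open>exp (- L k s)\<close>, and \<open>1 - exp (- L k s)\<close> cancels the last Todd factor up
  to \<open>L k * s\<close>: the \<open>s\<close> lowers the index of the coefficient, the
  \<open>L k\<close> cancels the extra factor in the denominator. The sign of \<open>u\<close> does
  not enter.\<close>

lemma pol_step: "pol (Suc k) u = pol (Suc k) (u - L k) + pol k u"
proof -
  have "fps_exp u - fps_exp (u - L k) = fps_exp u * (1 - fps_exp (- L k))"
    using fps_exp_add_mult[of u "- L k"] by (simp add: algebra_simps)
  hence "todd_prod (Suc k) * fps_exp u - todd_prod (Suc k) * fps_exp (u - L k) =
         todd_prod k * fps_exp u * (todd (L k) * (1 - fps_exp (- L k)))"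
    by (simp add: todd_prod_def algebra_simps)
  also have "\<dots> = fps_const (L k) * (fps_X * (todd_prod k * fps_exp u))"
    by (subst todd_mult) (simp add: mult_ac)
  finally have "fps_nth (todd_prod (Suc k) * fps_exp u - todd_prod (Suc k) * fps_exp (u - L k)) (Suc k)
     = L k * fps_nth (todd_prod k * fps_exp u) k" by simp
  moreover have "fps_nth (todd_prod k * fps_exp u) k / (\<Prod>i<k. L i) =
      L k * fps_nth (todd_prod k * fps_exp u) k / (\<Prod>i<Suc k. L i)" using L_pos[of k] by simp
  moreover have "pol (Suc k) u - pol (Suc k) (u - L k) =
      fps_nth (todd_prod (Suc k) * fps_exp u - todd_prod (Suc k) * fps_exp (u - L k)) (Suc k) / (\<Prod>i<Suc k. L i)"
    by (simp only: pol_def fps_sub_nth diff_divide_distrib)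
  ultimately have "pol (Suc k) u - pol (Suc k) (u - L k) = pol k u"
    unfolding pol_def[of k] by metis
  thus ?thesis by simp
qed

text \<open>The error obeys the recurrence of \<open>cnt\<close>, but on \<open>[- L i, 0)\<close>
  it starts from \<open>- pol (Suc i)\<close> instead of 0. The bound \<open>M i\<close> thus enters
  once along each chain of steps \<open>L i\<close>, and the later coordinates multiply it by the
  number of their lattice points.\<close>

lemma cnt_pol_diff:
  assumes M: "\<And>i v. i < k \<Longrightarrow> - L i \<le> v \<Longrightarrow> v < 0 \<Longrightarrow> \<bar>pol (Suc i) v\<bar> \<le> M i"
    and u: "u \<ge> 0"
  shows "\<bar>cnt {..<k} u - pol k u\<bar> \<le> (\<Sum>i<k. M i * cnt {Suc i..<k} u)"
  using assms
proof (induction k arbitrary: u)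
  case 0
  thus ?case by (simp add: pol_0 cnt_empty)
next
  case (Suc k)
  define R where "R k u = cnt {..<k} u - pol k u" for k u
  define B where "B k u = (\<Sum>i<k. M i * cnt {Suc i..<k} u)" for k u
  have cs: "cnt {i..<Suc k} u = cnt {i..<Suc k} (u - L k) + cnt {i..<k} u" if "i \<le> k" for i u
    using cnt_step[of "{i..<k}" k u] that by (simp add: atLeastLessThanSuc)
  have cs0: "cnt {..<Suc k} u = cnt {..<Suc k} (u - L k) + cnt {..<k} u" for u
    using cs[of 0 u] by (simp add: atLeast0LessThan)
  have Rs: "R (Suc k) u = R (Suc k) (u - L k) + R k u" for u
    using pol_step[of k u] cs0[of u] by (simp add: R_def)
  have IH: "\<bar>R k u\<bar> \<le> B k u" if "u \<ge> 0" for u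
    unfolding R_def B_def by (rule Suc.IH) (use Suc.prems that in auto)
  \<comment> \<open>The term \<open>i = k\<close> counts points without coordinates, of which there
    is one for \<open>u >= 0\<close> and none for \<open>u < 0\<close>; it pays for the one step
    that leads below 0.\<close>
  have B': "B (Suc k) u = M k + (\<Sum>i<k. M i * cnt {Suc i..<Suc k} u)" if "u \<ge> 0" for u
    using that by (simp add: B_def cnt_empty)
  have "u \<ge> 0 \<longrightarrow> \<bar>R (Suc k) u\<bar> \<le> B (Suc k) u" for u
  proof (induction u rule: step_induct[where l = "L k"])
    case (3 u)
    have "(\<Sum>i<k. M i * cnt {Suc i..<Suc k} u) = (\<Sum>i<k. M i * cnt {Suc i..<Suc k} (u - L k)) + B k u"
      unfolding B_def sum.distrib[symmetric]
      by (intro sum.cong refl) (subst cs, auto simp: algebra_simps)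
    hence Bu: "B (Suc k) u = M k + (\<Sum>i<k. M i * cnt {Suc i..<Suc k} (u - L k)) + B k u"
      using B'[of u] 3 by simp
    show ?case
    proof (cases "u - L k < 0")
      case True
      have "\<bar>R (Suc k) (u - L k)\<bar> \<le> M k"
        using Suc.prems(1)[of k "u - L k"] True 3 by (simp add: R_def cnt_neg)
      moreover have "(\<Sum>i<k. M i * cnt {Suc i..<Suc k} (u - L k)) = 0" using True by (simp add: cnt_neg)
      ultimately show ?thesis using Rs[of u] IH[of u] Bu 3 by auto
    next
      case False
      hence "\<bar>R (Suc k) (u - L k)\<bar> \<le> B (Suc k) (u - L k)" using 3 by simp
      thus ?thesis using Rs[of u] IH[of u] Bu B'[of "u - L k"] False 3 by auto
    qed
  qed (auto simp: L_pos)
  thus ?case using Suc.prems(2) by (simp add: R_def B_def)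
qed

lemma fps_bounded_todd_prod:
  assumes "r \<ge> 0" "\<And>i. i < k \<Longrightarrow> L i \<le> l" "l * r \<le> 2"
  shows "fps_bounded (todd_prod k) r (exp (real k * (l * r / 2)))"
proof -
  have "fps_bounded (\<Prod>i<k. todd (L i)) r (\<Prod>i<k. exp (l * r / 2))"
  proof (rule fps_bounded_prod)
    fix i assume "i \<in> {..<k}"
    hence le: "L i * r \<le> l * r" using assms by (intro mult_right_mono) auto
    show "fps_bounded (todd (L i)) r (exp (l * r / 2))"
      by (rule fps_bounded_mono[OF fps_bounded_todd])
         (use le assms less_imp_le[OF L_pos] in auto)
  qed (use assms in auto)
  moreover have "(\<Prod>i<k. exp (l * r / 2)) = exp (real k * (l * r / 2))"
    by (simp only: exp_of_nat_mult prod_constant card_lessThan)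
  ultimately show ?thesis by (simp only: todd_prod_def)
qed

text \<open>The coefficient is bounded at radius \<open>1 / L i\<close>, where each Todd factor
  contributes at most \<open>exp (1/2) <= 2\<close> and \<open>fps_exp v\<close> at most
  \<open>exp 1\<close>.\<close>

lemma pol_bound:
  assumes mono: "\<And>j. j \<le> i \<Longrightarrow> L j \<le> L i" and v: "- L i \<le> v" "v < 0"
  shows "\<bar>pol (Suc i) v\<bar> \<le> exp 1 * (2 * L i) ^ Suc i / (\<Prod>j<Suc i. L j)"
proof -
  define r where "r = 1 / L i"
  have r: "r > 0" "L i * r = 1" using L_pos[of i] by (auto simp: r_def)
  have "fps_bounded (todd_prod (Suc i)) r (exp (real (Suc i) * (L i * r / 2)))"
    by (rule fps_bounded_todd_prod) (use r mono in auto)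
  hence "fps_bounded (todd_prod (Suc i)) r (2 ^ Suc i)"
  proof (rule fps_bounded_mono)
    have "exp (1/2 :: real) \<le> 2"
    proof -
      have "exp (1/2 :: real) ^ 2 \<le> 2 ^ 2" using exp_le by (simp flip: exp_of_nat_mult)
      thus ?thesis by (rule power2_le_imp_le) auto
    qed
    hence "exp (1/2 :: real) ^ Suc i \<le> 2 ^ Suc i" by (intro power_mono) auto
    thus "exp (real (Suc i) * (L i * r / 2)) \<le> 2 ^ Suc i"
      using r by (simp only: exp_of_nat_mult)
  qed
  moreover have "fps_bounded (fps_exp v) r (exp 1)"
  proof (rule fps_bounded_mono[OF fps_bounded_exp])
    have "\<bar>v\<bar> * r \<le> L i * r" using v r by (intro mult_right_mono) auto
    thus "exp (\<bar>v\<bar> * r) \<le> exp 1" using r by simp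
  qed (use r in auto)
  ultimately have "fps_bounded (todd_prod (Suc i) * fps_exp v) r (2 ^ Suc i * exp 1)"
    using r by (intro fps_bounded_mult) auto
  from fps_bounded_nth[OF this, of "Suc i"] r
  have "\<bar>fps_nth (todd_prod (Suc i) * fps_exp v) (Suc i)\<bar> \<le> 2 ^ Suc i * exp 1 / r ^ Suc i"
    by (simp add: pos_le_divide_eq)
  also have "\<dots> = exp 1 * (2 * L i) ^ Suc i" by (simp add: r_def power_divide power_mult_distrib)
  finally show ?thesis
    unfolding pol_def abs_divide abs_of_pos[OF prod_L_pos]
    by (rule divide_right_mono[OF _ less_imp_le[OF prod_L_pos]])
qed

text \<open>The product of the \<open>L j\<close> in the denominator of \<open>pol_bound\<close>
  cancels the one in \<open>cnt_drop_le\<close>, so that relative to the count the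
  \<open>i\<close>-th term is at most \<open>exp 1 * q ^ Suc i\<close>. Since
  \<open>q <= 1/2\<close>, the powers of \<open>q\<close> sum to at most \<open>2 q\<close>.\<close>

lemma cnt_pol_diff_le:
  assumes mono: "\<And>i j. i \<le> j \<Longrightarrow> L i \<le> L j" and l: "\<And>i. i < k \<Longrightarrow> L i \<le> l"
    and u: "u > 0" and q: "4 * l * real k \<le> u" and "k > 0"
  shows "\<bar>cnt {..<k} u - pol k u\<bar> \<le> 4 * exp 1 * (l * real k / u) * cnt {..<k} u"
proof -
  define q where "q = 2 * l * real k / u"
  have "l > 0" using l[of 0] L_pos[of 0] \<open>k > 0\<close> by linarith
  hence q: "0 \<le> q" "q \<le> 1 / 2" using q u by (auto simp: q_def field_simps)
  have "\<bar>cnt {..<k} u - pol k u\<bar> \<le>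
      (\<Sum>i<k. exp 1 * (2 * L i) ^ Suc i / (\<Prod>j<Suc i. L j) * cnt {Suc i..<k} u)"
    by (rule cnt_pol_diff) (use pol_bound mono u in auto)
  also have "\<dots> \<le> (\<Sum>i<k. exp 1 * q ^ Suc i * cnt {..<k} u)"
  proof (rule sum_mono)
    fix i assume i: "i \<in> {..<k}"
    have "exp 1 * (2 * L i) ^ Suc i / (\<Prod>j<Suc i. L j) * cnt {Suc i..<k} u \<le>
          exp 1 * (2 * L i) ^ Suc i / (\<Prod>j<Suc i. L j) *
            ((\<Prod>j<Suc i. L j) * (real k / u) ^ Suc i * cnt {..<k} u)"
      using i u prod_L_pos[of "Suc i"] L_pos[of i]
      by (intro mult_left_mono cnt_drop_le divide_nonneg_pos mult_nonneg_nonneg zero_le_power) auto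
    also have "\<dots> = exp 1 * (2 * L i * (real k / u)) ^ Suc i * cnt {..<k} u"
    proof -
      have "P > 0 \<Longrightarrow> e * a ^ n / P * (P * b ^ n * x) = e * (a * b) ^ n * x" for P e a b x :: real and n
        by (simp add: power_mult_distrib)
      from this[OF prod_L_pos[of "Suc i"]] show ?thesis .
    qed
    also have "\<dots> \<le> exp 1 * q ^ Suc i * cnt {..<k} u"
    proof -
      have "2 * L i * (real k / u) \<le> 2 * l * (real k / u)" using l[of i] i u
        by (intro mult_right_mono) auto
      hence "(2 * L i * (real k / u)) ^ Suc i \<le> q ^ Suc i"
        unfolding q_def using u L_pos[of i] by (intro power_mono) auto
      thus ?thesis by (intro mult_right_mono mult_left_mono cnt_nonneg) auto
    qed
    finally show "exp 1 * (2 * L i) ^ Suc i / (\<Prod>j<Suc i. L j) * cnt {Suc i..<k} u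
        \<le> exp 1 * q ^ Suc i * cnt {..<k} u" .
  qed
  also have "\<dots> = exp 1 * (\<Sum>j\<in>{1..k}. q ^ j) * cnt {..<k} u"
    unfolding sum_distrib_left sum_distrib_right
    by (rule sum.reindex_bij_witness[of _ "\<lambda>j. j - 1" Suc]) auto
  also have "\<dots> \<le> exp 1 * (q ^ 1 / (1 - q)) * cnt {..<k} u"
    using q by (intro mult_right_mono mult_left_mono sum_geometric_tail_le cnt_nonneg) auto
  also have "\<dots> \<le> exp 1 * (q ^ 1 / (1 / 2)) * cnt {..<k} u"
    using q by (intro mult_right_mono mult_left_mono divide_left_mono cnt_nonneg) auto
  finally show ?thesis by (simp add: q_def mult_ac)
qed

end


section \<open>The truncated sum\<close>

text \<open>The falling factorial of \<open>N\<close> over \<open>u ^ n\<close>, that is,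
  \<open>u^(N-n) / (N-n)!\<close> relative to \<open>u^N / N!\<close>; it normalises the sum in
  \<open>E\<close> to begin with 1.\<close>

definition fall :: "nat \<Rightarrow> real \<Rightarrow> nat \<Rightarrow> real" where
  "fall N u n = fact N / fact (N - n) / u ^ n"

definition trunc :: "nat \<Rightarrow> real \<Rightarrow> nat \<Rightarrow> real fps \<Rightarrow> real" where
  "trunc N u m G = (\<Sum>n\<le>m. fps_nth G n * fall N u n)"

lemma fall_nonneg: "u > 0 \<Longrightarrow> fall N u n \<ge> 0"
  by (simp add: fall_def)

lemma fall_0 [simp]: "fall N u 0 = 1"
  by (simp add: fall_def)

lemma fall_add_le:
  assumes "u > 0" "n + k \<le> N"
  shows "fall N u (n + k) \<le> (real N / u) ^ k * fall N u n"
  using assms(2)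
proof (induction k)
  case (Suc k)
  define j where "j = n + k"
  have j: "Suc j \<le> N" using Suc.prems by (simp add: j_def)
  have "fact (N - j) = real (N - j) * fact (N - Suc j)"
    using j by (simp add: fact_reduce of_nat_diff flip: Suc_diff_Suc)
  hence "fall N u (Suc j) = real (N - j) / u * fall N u j"
    using j assms(1) by (simp add: fall_def)
  also have "\<dots> \<le> real N / u * fall N u j"
    using assms(1) by (intro mult_right_mono divide_right_mono fall_nonneg) auto
  also have "\<dots> \<le> real N / u * ((real N / u) ^ k * fall N u n)"
    using Suc assms(1) by (intro mult_left_mono) (auto simp: j_def)
  finally show ?case by (simp add: j_def mult_ac)
qed auto

text \<open>As \<open>fall N u n <= (N/u)^i * fall N u (n - i)\<close>, one factor of a product of
  nonnegative series may be split off and evaluated at \<open>N / u\<close>, as if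
  \<open>fall\<close> were a power.\<close>

lemma trunc_mult_le:
  assumes "u > 0" "m \<le> N" "G \<sqsubseteq> G" "H \<sqsubseteq> H"
  shows "trunc N u m (G * H) \<le> (\<Sum>j\<le>m. fps_nth G j * (real N / u) ^ j) * trunc N u m H"
proof -
  have G: "fps_nth G j \<ge> 0" and H: "fps_nth H j \<ge> 0" for j
    using assms majorized_self_nonneg by blast+
  have "trunc N u m (G * H) = (\<Sum>n\<le>m. \<Sum>i\<le>n. fps_nth G i * fps_nth H (n - i) * fall N u n)"
    by (simp add: trunc_def fps_mult_nth sum_distrib_right atLeast0AtMost)
  also have "\<dots> \<le> (\<Sum>n\<le>m. \<Sum>i\<le>n. (fps_nth G i * (real N / u) ^ i) * (fps_nth H (n - i) * fall N u (n - i)))"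
  proof (intro sum_mono)
    fix n i assume ni: "n \<in> {..m}" "i \<in> {..n}"
    have "fall N u n \<le> (real N / u) ^ i * fall N u (n - i)"
      using fall_add_le[of u "n - i" i N] assms ni by simp
    hence "fps_nth G i * fps_nth H (n - i) * fall N u n \<le>
           fps_nth G i * fps_nth H (n - i) * ((real N / u) ^ i * fall N u (n - i))"
      by (intro mult_left_mono mult_nonneg_nonneg G H)
    thus "fps_nth G i * fps_nth H (n - i) * fall N u n \<le>
       (fps_nth G i * (real N / u) ^ i) * (fps_nth H (n - i) * fall N u (n - i))"
      by (simp add: mult_ac)
  qed
  also have "\<dots> \<le> (\<Sum>j\<le>m. fps_nth G j * (real N / u) ^ j) * (\<Sum>n\<le>m. fps_nth H n * fall N u n)"
    by (rule sum_convolution_le) (use assms G H in \<open>auto intro!: mult_nonneg_nonneg fall_nonneg\<close>)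
  finally show ?thesis by (simp add: trunc_def)
qed

lemma trunc_majorized:
  assumes "u > 0" "G \<sqsubseteq> H"
  shows "\<bar>trunc N u m G\<bar> \<le> trunc N u m H"
proof -
  have "\<bar>trunc N u m G\<bar> \<le> (\<Sum>n\<le>m. \<bar>fps_nth G n * fall N u n\<bar>)"
    unfolding trunc_def by (rule sum_abs)
  also have "\<dots> \<le> trunc N u m H"
    unfolding trunc_def abs_mult using assms
    by (intro sum_mono mult_mono majorizedD majorized_nonneg[OF assms(2)]) (auto simp: fall_nonneg)
  finally show ?thesis .
qed

lemma trunc_diff: "trunc N u m (G - H) = trunc N u m G - trunc N u m H"
  by (simp add: trunc_def sum_subtractf algebra_simps)

section \<open>A lower bound for the truncated sum\<close>

lemma fps_bounded_add:
  assumes "fps_bounded G r K" "fps_bounded H r K'" "r \<ge> 0"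
  shows "fps_bounded (G + H) r (K + K')"
  unfolding fps_bounded_def
proof
  fix n
  have "(\<Sum>j\<le>n. \<bar>fps_nth (G + H) j\<bar> * r ^ j) \<le> (\<Sum>j\<le>n. \<bar>fps_nth G j\<bar> * r ^ j + \<bar>fps_nth H j\<bar> * r ^ j)"
    using assms(3) by (intro sum_mono) (auto simp flip: distrib_right intro!: mult_right_mono)
  also have "\<dots> \<le> K + K'"
    unfolding sum.distrib by (intro add_mono fps_boundedD assms)
  finally show "(\<Sum>j\<le>n. \<bar>fps_nth (G + H) j\<bar> * r ^ j) \<le> K + K'" .
qed

text \<open>The negative part only starts at order 4.\<close>

definition todd_pos :: "real \<Rightarrow> real fps" where
  "todd_pos l = Abs_fps (\<lambda>k. max 0 (c k) * l ^ k)"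

definition todd_neg :: "real \<Rightarrow> real fps" where
  "todd_neg l = Abs_fps (\<lambda>k. max 0 (- c k) * l ^ k)"

lemma todd_pos_neg: "todd l = todd_pos l - todd_neg l"
  by (rule fps_ext) (auto simp: todd_pos_def todd_neg_def max_def)

lemma majorized_todd_pos: "l \<ge> 0 \<Longrightarrow> todd_pos l \<sqsubseteq> todd_pos l"
  and majorized_todd_neg: "l \<ge> 0 \<Longrightarrow> todd_neg l \<sqsubseteq> todd_neg l"
  by (auto simp: majorized_self_nonneg todd_pos_def todd_neg_def)

lemma majorized_1_todd_pos: "l \<ge> 0 \<Longrightarrow> 1 \<sqsubseteq> todd_pos l"
  by (rule majorizedI) (auto simp: todd_pos_def fps_one_nth c_def)

lemma fps_bounded_todd_neg:
  assumes "0 \<le> l" "0 \<le> r" "l * r \<le> 5 / 6"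
  shows "fps_bounded (todd_neg l) r ((l * r) ^ 4 / 372)"
  unfolding fps_bounded_def
proof
  fix n
  define t where "t = l * r"
  have t: "0 \<le> t" "t \<le> 5 / 6" using assms by (auto simp: t_def)
  have le: "max 0 (- c j) * t ^ j \<le> (if 4 \<le> j then 3 * (t / 6) ^ j else 0)" for j
  proof (cases "4 \<le> j")
    case True
    have "max 0 (- c j) \<le> 3 / 6 ^ j" using abs_c_le[of j] True by auto
    hence "max 0 (- c j) * t ^ j \<le> 3 / 6 ^ j * t ^ j" using t by (intro mult_right_mono) auto
    thus ?thesis using True by (simp add: power_divide)
  next
    case False
    hence "j = 0 \<or> j = 1 \<or> j = 2 \<or> j = 3" by auto
    moreover have "c 2 > 0" using zeta_bounds(1)[of 2] by (simp add: c_def)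
    ultimately have "c j \<ge> 0" by (auto simp: c_def)
    thus ?thesis using False by (simp add: max_def)
  qed
  have "(\<Sum>j\<le>n. \<bar>fps_nth (todd_neg l) j\<bar> * r ^ j) = (\<Sum>j\<le>n. max 0 (- c j) * t ^ j)"
    by (intro sum.cong) (use assms in \<open>auto simp: todd_neg_def t_def abs_mult power_abs power_mult_distrib\<close>)
  also have "\<dots> \<le> (\<Sum>j\<le>n. if 4 \<le> j then 3 * (t / 6) ^ j else 0)" by (intro sum_mono le)
  also have "\<dots> = (\<Sum>j | j \<le> n \<and> 4 \<le> j. 3 * (t / 6) ^ j)"
    by (simp flip: sum.inter_filter)
  also have "\<dots> = 3 * (\<Sum>j | j \<le> n \<and> 4 \<le> j. (t / 6) ^ j)" by (simp add: sum_distrib_left)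
  also have "\<dots> \<le> 3 * ((t / 6) ^ 4 / (1 - t / 6))"
    using t by (intro mult_left_mono sum_geometric_tail_le) auto
  \<comment> \<open>\<open>t <= 5/6\<close> gives \<open>1 - t/6 >= 31/36\<close>, and
    \<open>372 = 6^4 * (31/36) / 3\<close>.\<close>
  also have "\<dots> \<le> 3 * ((t / 6) ^ 4 / (31 / 36))"
    using t by (intro mult_left_mono divide_left_mono) auto
  also have "\<dots> = t ^ 4 / 372" by (simp add: power_divide)
  finally show "(\<Sum>j\<le>n. \<bar>fps_nth (todd_neg l) j\<bar> * r ^ j) \<le> (l * r) ^ 4 / 372"
    by (simp add: t_def)
qed

context weights
begin

text \<open>The perturbation has to appear as a multiple of the positive product, to be comparable
  with the main term. Because 1 is majorized by each positive factor \<open>p\<close>, a negative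
  part \<open>n\<close> is majorized by \<open>p * n\<close>, and \<open>p - n\<close> behaves like
  \<open>p * (1 + n)\<close>. The further conjuncts carry nonnegativity through the
  induction.\<close>

lemma todd_prod_diff_majorized:
  "todd_prod k - (\<Prod>i<k. todd_pos (L i)) \<sqsubseteq>
     (\<Prod>i<k. todd_pos (L i)) * ((\<Prod>i<k. 1 + todd_neg (L i)) - 1) \<and>
   (\<Prod>i<k. todd_pos (L i)) \<sqsubseteq> (\<Prod>i<k. todd_pos (L i)) \<and>
   (\<Prod>i<k. 1 + todd_neg (L i)) \<sqsubseteq> (\<Prod>i<k. 1 + todd_neg (L i)) \<and>
   (\<Prod>i<k. 1 + todd_neg (L i)) - 1 \<sqsubseteq> (\<Prod>i<k. 1 + todd_neg (L i)) - 1 \<and>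
   1 \<sqsubseteq> (\<Prod>i<k. todd_pos (L i))"
proof (induction k)
  case 0
  show ?case by (simp add: todd_prod_def majorized_1) (simp add: fps_majorized_def)
next
  case (Suc k)
  define F Phi Pi p n where defs: "F = todd_prod k" "Phi = (\<Prod>i<k. todd_pos (L i))"
    "Pi = (\<Prod>i<k. 1 + todd_neg (L i))" "p = todd_pos (L k)" "n = todd_neg (L k)"
  have IH: "F - Phi \<sqsubseteq> Phi * (Pi - 1)" "Phi \<sqsubseteq> Phi" "Pi \<sqsubseteq> Pi" "Pi - 1 \<sqsubseteq> Pi - 1" "1 \<sqsubseteq> Phi"
    using Suc by (simp_all only: defs)
  have p: "p \<sqsubseteq> p" "n \<sqsubseteq> n" "1 \<sqsubseteq> p"
    using L_pos[of k] by (auto simp: defs intro!: majorized_todd_pos majorized_todd_neg majorized_1_todd_pos)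
  have F: "F \<sqsubseteq> Phi * Pi"
    using majorized_add[OF IH(1) IH(2)] by (simp add: algebra_simps)
  \<comment> \<open>The 1 is written out because it is to be majorized by \<open>p\<close>.\<close>
  have "(F - Phi) * p - F * (1 * n) \<sqsubseteq> Phi * (Pi - 1) * p + (Phi * Pi) * (p * n)"
    by (intro majorized_diff majorized_mult IH p F)
  hence 1: "F * (p - n) - Phi * p \<sqsubseteq> Phi * p * (Pi * (1 + n) - 1)"
    by (simp add: algebra_simps)
  have 2: "Phi * p \<sqsubseteq> Phi * p" and 5: "1 * 1 \<sqsubseteq> Phi * p" by (intro majorized_mult IH p)+
  have 3: "Pi * (1 + n) \<sqsubseteq> Pi * (1 + n)" by (intro majorized_mult majorized_add IH p majorized_1)
  have "(Pi - 1) + Pi * n \<sqsubseteq> (Pi - 1) + Pi * n" by (intro majorized_mult majorized_add IH p)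
  hence 4: "Pi * (1 + n) - 1 \<sqsubseteq> Pi * (1 + n) - 1" by (simp add: algebra_simps)
  have "todd_prod (Suc k) = F * (p - n)" by (simp add: todd_prod_def defs todd_pos_neg)
  with 1 2 3 4 5 show ?case by (simp add: defs)
qed

text \<open>The error is at most the positive main term times the value at \<open>N / u\<close> of
  the product of the \<open>1 + todd_neg (L i)\<close>, less 1. Each factor is at most
  \<open>exp ((l w)^4 / 372)\<close>, and \<open>93 / 372 = 1/4\<close> with
  \<open>exp (1/4) <= 3/2\<close> leaves at least half of a main term that is at least 1. The values
  \<open>5/6\<close> and \<open>93\<close> are what \<open>E_ge_volume\<close> can guarantee for all
  \<open>y >= 2\<close>.\<close>

lemma trunc_todd_prod_ge:
  assumes u: "u > 0" and m: "m \<le> N" and l: "\<And>i. i < N \<Longrightarrow> L i \<le> l"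
    and t: "l * (real N / u) \<le> 5 / 6" "real N * (l * (real N / u)) ^ 4 \<le> 93"
  shows "trunc N u m (todd_prod N) \<ge> 1 / 2"
proof -
  define Phi Pi w where defs: "Phi = (\<Prod>i<N. todd_pos (L i))"
    "Pi = (\<Prod>i<N. 1 + todd_neg (L i))" "w = real N / u"
  have M: "todd_prod N - Phi \<sqsubseteq> Phi * (Pi - 1)" "Phi \<sqsubseteq> Phi" "Pi \<sqsubseteq> Pi" "Pi - 1 \<sqsubseteq> Pi - 1" "1 \<sqsubseteq> Phi"
    using todd_prod_diff_majorized[of N] by (simp_all only: defs)
  have w: "w \<ge> 0" using u by (simp add: defs)
  have "fps_bounded Pi w (\<Prod>i<N. exp ((l * w) ^ 4 / 372))"
    unfolding defs(2)
  proof (rule fps_bounded_prod)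
    fix i assume i: "i \<in> {..<N}"
    have Li: "L i * w \<le> l * w" using l i w by (intro mult_right_mono) auto
    have "L i * w \<le> 5 / 6" using Li t(1) by (simp only: defs)
    hence "fps_bounded (1 + todd_neg (L i)) w (1 + (L i * w) ^ 4 / 372)"
      using w less_imp_le[OF L_pos[of i]] by (intro fps_bounded_add fps_bounded_1 fps_bounded_todd_neg)
    moreover have "1 + (L i * w) ^ 4 / 372 \<le> exp ((l * w) ^ 4 / 372)"
    proof -
      have "(L i * w) ^ 4 \<le> (l * w) ^ 4" using Li w L_pos[of i] by (intro power_mono) auto
      thus ?thesis using exp_ge_add_one_self[of "(l * w) ^ 4 / 372"] by linarith
    qed
    ultimately show "fps_bounded (1 + todd_neg (L i)) w (exp ((l * w) ^ 4 / 372))"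
      by (rule fps_bounded_mono)
  qed (use w in auto)
  moreover have "(\<Prod>i<N. exp ((l * w) ^ 4 / 372)) \<le> 3 / 2"
  proof -
    have "(\<Prod>i<N. exp ((l * w) ^ 4 / 372)) = exp (real N * ((l * w) ^ 4 / 372))"
      by (simp only: exp_of_nat_mult prod_constant card_lessThan)
    also have "\<dots> \<le> exp (1 / 4)" using t by (simp add: defs)
    also have "\<dots> \<le> 3 / 2"
    proof (rule power_le_imp_le_base[of _ 3])
      show "exp (1 / 4 :: real) ^ Suc 3 \<le> (3 / 2) ^ Suc 3"
      proof -
        have "exp (1 / 4 :: real) ^ Suc 3 = exp (real (Suc 3) * (1 / 4))" by (rule exp_of_nat_mult[symmetric])
        also have "\<dots> = exp 1" by simp
        also have "\<dots> \<le> (3 / 2) ^ Suc 3" using exp_le by (simp add: eval_nat_numeral)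
        finally show ?thesis .
      qed
    qed auto
    finally show ?thesis .
  qed
  ultimately have Pi: "fps_bounded Pi w (3 / 2)" by (rule fps_bounded_mono)
  have tPhi: "trunc N u m Phi \<ge> 1"
  proof -
    have "fps_nth Phi 0 * fall N u 0 \<le> trunc N u m Phi" unfolding trunc_def
      by (rule member_le_sum) (use u M(2) in \<open>auto simp: majorized_self_nonneg fall_nonneg\<close>)
    moreover have "fps_nth Phi 0 \<ge> 1" using majorizedD[OF M(5), of 0] by simp
    ultimately show ?thesis by simp
  qed
  have s: "(\<Sum>j\<le>m. fps_nth (Pi - 1) j * w ^ j) \<le> 1 / 2"
  proof -
    have "(\<Sum>j\<le>m. fps_nth (Pi - 1) j * w ^ j) = (\<Sum>j\<le>m. fps_nth Pi j * w ^ j - (if j = 0 then 1 else 0))"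
      by (intro sum.cong) (auto simp: fps_one_nth)
    also have "\<dots> \<le> (\<Sum>j\<le>m. \<bar>fps_nth Pi j\<bar> * w ^ j) - 1"
      unfolding sum_subtractf using w by (auto intro!: sum_mono mult_right_mono)
    also have "\<dots> \<le> 3 / 2 - 1" by (intro diff_right_mono fps_boundedD[OF Pi])
    finally show ?thesis by simp
  qed
  have "\<bar>trunc N u m (todd_prod N) - trunc N u m Phi\<bar> \<le> trunc N u m ((Pi - 1) * Phi)"
    using trunc_majorized[OF u M(1), of N m] by (simp add: trunc_diff mult.commute)
  also have "\<dots> \<le> (\<Sum>j\<le>m. fps_nth (Pi - 1) j * w ^ j) * trunc N u m Phi"
    unfolding defs(3) by (rule trunc_mult_le[OF u m M(4,2)])
  also have "\<dots> \<le> 1 / 2 * trunc N u m Phi"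
    by (rule mult_right_mono[OF s]) (use tPhi in auto)
  finally show ?thesis using tPhi by linarith
qed

text \<open>Rankin's method: a coefficient is at most \<open>exp X / r^n\<close>,
  \<open>fall\<close> at most \<open>(N/u)^n\<close>, and \<open>X <= n\<close> gives
  \<open>exp X <= exp n\<close>. The terms are then powers of
  \<open>exp 1 * N^2 * l / (2 u X)\<close>, which the last hypothesis bounds by \<open>9/10\<close>.
  The condition \<open>X <= N\<close> keeps \<open>l * r <= 2\<close>, the range of
  \<open>fps_bounded_todd\<close>.\<close>

lemma trunc_todd_prod_tail:
  assumes u: "u > 0" and m: "m \<le> N" and l: "l > 0" "\<And>i. i < N \<Longrightarrow> L i \<le> l"
    and X: "0 < X" "X \<le> real N" "X < real (m + 1)"
    and le: "exp 1 * (real N)^2 * l \<le> 9 / 10 * (2 * u * X)"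
  shows "\<bar>trunc N u N (todd_prod N) - trunc N u m (todd_prod N)\<bar> \<le> 10 * (9 / 10) ^ (m + 1)"
proof -
  \<comment> \<open>minimises \<open>r\<^sup>-\<^sup>n exp (N l r / 2)\<close> at \<open>n = X\<close>\<close>
  define r where "r = 2 * X / (real N * l)"
  have N: "real N > 0" using X by linarith
  have r: "r > 0" "l * r \<le> 2" "real N * (l * r / 2) = X"
    using X l N by (auto simp: r_def field_simps)
  have b: "fps_bounded (todd_prod N) r (exp X)"
    using fps_bounded_todd_prod[of r N l] r l by simp
  have "trunc N u N (todd_prod N) - trunc N u m (todd_prod N) =
        (\<Sum>n\<in>{m+1..N}. fps_nth (todd_prod N) n * fall N u n)"
  proof -
    have "{..N} = {..m} \<union> {m+1..N}" using m by auto
    hence "trunc N u N (todd_prod N) = (\<Sum>n\<in>{..m} \<union> {m+1..N}. fps_nth (todd_prod N) n * fall N u n)"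
      by (simp add: trunc_def)
    also have "\<dots> = trunc N u m (todd_prod N) + (\<Sum>n\<in>{m+1..N}. fps_nth (todd_prod N) n * fall N u n)"
      unfolding trunc_def by (rule sum.union_disjoint) auto
    finally show ?thesis by simp
  qed
  also have "\<bar>\<dots>\<bar> \<le> (\<Sum>n\<in>{m+1..N}. \<bar>fps_nth (todd_prod N) n * fall N u n\<bar>)" by (rule sum_abs)
  also have "\<dots> \<le> (\<Sum>n\<in>{m+1..N}. (9 / 10) ^ n)"
  proof (rule sum_mono)
    fix n assume n: "n \<in> {m+1..N}"
    have Xn: "X \<le> real n" using X n by auto
    have "\<bar>fps_nth (todd_prod N) n\<bar> \<le> exp X / r ^ n"
      using fps_bounded_nth[OF b, of n] r by (simp add: pos_le_divide_eq)
    moreover have "fall N u n \<le> (real N / u) ^ n"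
      using fall_add_le[of u 0 n N] u n by simp
    ultimately have "\<bar>fps_nth (todd_prod N) n * fall N u n\<bar> \<le> exp X / r ^ n * (real N / u) ^ n"
      unfolding abs_mult using u by (intro mult_mono) (auto simp: fall_nonneg)
    also have "\<dots> = exp X * (real N / u / r) ^ n" by (simp add: power_divide power_mult_distrib mult_ac)
    also have "\<dots> \<le> exp (real n) * (9 / 10 / exp 1) ^ n"
    proof (intro mult_mono power_mono)
      have "real N / u / r = (real N)^2 * l / (2 * u * X)"
        using u X l N by (simp add: r_def field_simps power2_eq_square)
      also have "\<dots> \<le> 9 / 10 / exp 1"
        using le u X by (simp add: field_simps)
      finally show "real N / u / r \<le> 9 / 10 / exp 1" .
    qed (use Xn u r N in auto)
    also have "\<dots> = (9 / 10) ^ n" by (simp add: power_divide flip: exp_of_nat_mult)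
    finally show "\<bar>fps_nth (todd_prod N) n * fall N u n\<bar> \<le> (9 / 10) ^ n" .
  qed
  also have "\<dots> \<le> (9 / 10) ^ (m + 1) / (1 - 9 / 10)"
    by (rule sum_geometric_tail_le) auto
  finally show ?thesis by simp
qed

definition volume :: "nat \<Rightarrow> real \<Rightarrow> real" where
  "volume N u = (\<Prod>i<N. u / L i) / fact N"

lemma pol_eq_trunc:
  assumes "u > 0"
  shows "pol N u = volume N u * trunc N u N (todd_prod N)"
proof -
  have "pol N u = (\<Sum>n\<le>N. fps_nth (todd_prod N) n * (u ^ (N - n) / fact (N - n))) / (\<Prod>i<N. L i)"
    by (simp add: pol_def fps_mult_nth atLeast0AtMost)
  also have "(\<Sum>n\<le>N. fps_nth (todd_prod N) n * (u ^ (N - n) / fact (N - n))) =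
     (\<Sum>n\<le>N. u ^ N / fact N * (fps_nth (todd_prod N) n * fall N u n))"
    by (intro sum.cong refl) (use assms in \<open>auto simp: fall_def power_diff mult_ac\<close>)
  also have "\<dots> = u ^ N / fact N * trunc N u N (todd_prod N)"
    by (simp add: trunc_def sum_distrib_left)
  finally show ?thesis by (simp add: volume_def prod_dividef field_simps)
qed

end


section \<open>Chebyshev bounds\<close>

definition theta :: "nat \<Rightarrow> real" where
  "theta m = (\<Sum>p | prime p \<and> p \<le> m. ln (real p))"

text \<open>One step of Legendre's formula. It suffices below, because the higher powers of
  \<open>p\<close> are handled by divisibility of factorials.\<close>

lemma multiplicity_fact_div:
  assumes p: "prime (p::nat)"
  shows "multiplicity p (fact m :: nat) = m div p + multiplicity p (fact (m div p) :: nat)"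
proof (induction m)
  case (Suc m)
  have p1: "p > 1" using p prime_gt_1_nat by blast
  have *: "multiplicity p (fact (Suc k) :: nat) = multiplicity p (Suc k) + multiplicity p (fact k :: nat)" for k
    unfolding fact_Suc of_nat_id
    by (rule prime_elem_multiplicity_mult_distrib) (use p in auto)
  show ?case
  proof (cases "p dvd Suc m")
    case False
    hence "Suc m div p = m div p" by (simp add: div_Suc dvd_eq_mod_eq_0)
    with Suc * False show ?thesis by (simp add: not_dvd_imp_multiplicity_0)
  next
    case True
    then obtain q where q: "Suc m = p * q" by auto
    have q0: "q > 0" using q by (cases q) auto
    have "Suc m div p = Suc (m div p)" using True by (simp add: div_Suc dvd_eq_mod_eq_0)
    hence mq: "q = Suc (m div p)" using q p1 by simp
    have "multiplicity p (Suc m) = Suc (multiplicity p q)"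
      unfolding q by (rule multiplicity_times_same) (use p1 q0 in auto)
    moreover have "Suc m div p = q" using q p1 by simp
    ultimately show ?thesis using Suc * mq by simp
  qed
qed auto

text \<open>
  The multinomial coefficient \<open>(6n)! / ((3n)! (2n)! n!)\<close> leads to the constant \<open>(log 432) / 5 < 1.25\<close>;
  the constant \<open>2 log 2\<close> obtained from central binomial coefficients would be too large below.
\<close>

lemma prime_dvd_multinomial:
  assumes p: "prime (p::nat)" and np: "n < p" "p \<le> 6 * n"
  shows "p dvd ((6 * n) choose (3 * n)) * ((3 * n) choose n)"
proof -
  define M where "M = ((6 * n) choose (3 * n)) * ((3 * n) choose n)"
  have M0: "M \<noteq> 0" by (simp add: M_def)
  have f1: "fact (6 * n) = fact (3 * n) * fact (3 * n) * ((6 * n) choose (3 * n))"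
    using binomial_fact_lemma[of "3 * n" "6 * n"] by (simp add: mult_ac)
  have f2: "fact (3 * n) = fact n * fact (2 * n) * ((3 * n) choose n)"
    using binomial_fact_lemma[of n "3 * n"] by (simp add: mult_ac)
  have F: "fact (6 * n) = M * (fact (3 * n) * (fact (2 * n) * fact n :: nat))"
    using f1 f2 by (simp add: M_def mult_ac)
  define v where "v m = multiplicity p (fact m :: nat)" for m
  have "v (6 * n) = multiplicity p M + (v (3 * n) + (v (2 * n) + v n))"
    unfolding v_def F using p M0
    by (subst prime_elem_multiplicity_mult_distrib; simp)+
  moreover have v: "v m = m div p + v (m div p)" for m
    unfolding v_def by (rule multiplicity_fact_div[OF p])
  moreover have v0: "v 0 = 0" "v n = 0" using v[of n] np by (auto simp: v_def)
  \<comment> \<open>The powers \<open>p^2, p^3, ...\<close> contribute nonnegatively, because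
    \<open>a! b!\<close> divides \<open>(a + b)!\<close>.\<close>
  moreover have "v (6 * n div p) \<ge> v (3 * n div p) + v (2 * n div p)"
  proof -
    have "3 * n div p + 2 * n div p \<le> 6 * n div p"
    proof -
      have "3 * n div p * p \<le> 3 * n" "2 * n div p * p \<le> 2 * n" by simp_all
      hence "(3 * n div p + 2 * n div p) * p \<le> 6 * n" unfolding add_mult_distrib by linarith
      thus ?thesis using np by (simp add: less_eq_div_iff_mult_less_eq)
    qed
    hence "fact (3 * n div p) * fact (2 * n div p) dvd (fact (6 * n div p) :: nat)"
      by (meson fact_fact_dvd_fact fact_dvd dvd_trans)
    hence "multiplicity p (fact (3 * n div p) * fact (2 * n div p) :: nat) \<le> v (6 * n div p)"
      unfolding v_def by (intro dvd_imp_multiplicity_le) auto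
    thus ?thesis unfolding v_def using p by (subst (asm) prime_elem_multiplicity_mult_distrib) auto
  qed
  \<comment> \<open>With \<open>t = n / p\<close>, which lies in \<open>[1/6, 1)\<close>, this says
    that the floor of \<open>6 t\<close> exceeds the sum of the floors of \<open>3 t\<close> and
    \<open>2 t\<close>.\<close>
  moreover have "6 * n div p > 3 * n div p + 2 * n div p"
  proof -
    have p0: "p > 0" using np by simp
    have le: "j \<le> m div p \<longleftrightarrow> j * p \<le> m" for j m
      using p0 by (simp add: less_eq_div_iff_mult_less_eq)
    have lt: "m div p < j \<longleftrightarrow> m < j * p" for j m using le[of j m] by linarith
    have b: "3 * n div p < 3" and c: "2 * n div p < 2" using np by (simp_all add: lt)
    have a1: "6 * n div p \<ge> 1" using np by (simp add: le)
    consider "3 * n div p \<ge> 2" | "3 * n div p = 1" "2 * n div p = 1"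
      | "3 * n div p = 1" "2 * n div p = 0" | "3 * n div p = 0" using b c by linarith
    thus ?thesis
    proof cases
      case 1
      hence "6 * n div p \<ge> 4" unfolding le by simp
      thus ?thesis using b c by linarith
    next
      case 2
      hence "6 * n div p \<ge> 3" unfolding le using le[of 1 "2 * n"] by simp
      thus ?thesis using 2 by linarith
    next
      case 3
      hence "6 * n div p \<ge> 2" unfolding le using le[of 1 "3 * n"] by simp
      thus ?thesis using 3 by linarith
    next
      case 4
      hence "2 * n div p = 0" using np le[of 1 "3 * n"] by (simp add: lt)
      thus ?thesis using a1 4 by linarith
    qed
  qed
  ultimately have "multiplicity p M > 0" using v[of "6*n"] v[of "3*n"] v[of "2*n"] by linarith
  hence "p dvd M" using not_dvd_imp_multiplicity_0 by fastforce
  thus ?thesis by (simp add: M_def)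
qed

text \<open>\<open>432 = 64 * 27 / 4\<close>. The factor \<open>27 / 4\<close> comes from a single
  term in the expansion of \<open>(1 + 2)^(3 n)\<close>, where \<open>3 n choose n\<close> has
  weight \<open>2^(2 n) = 4^n\<close>.\<close>

lemma multinomial_le: "((6 * n) choose (3 * n)) * ((3 * n) choose n) \<le> 432 ^ n"
proof -
  have a: "(m choose k) * 2 ^ (m - k) \<le> 3 ^ m" if "k \<le> m" for m k :: nat
  proof -
    have "(m choose k) * 2 ^ (m - k) \<le> (\<Sum>k\<le>m. (m choose k) * 2 ^ (m - k))"
      by (rule member_le_sum) (use that in auto)
    also have "\<dots> = (1 + 2) ^ m" by (subst binomial) simp
    also have "(1 + 2 :: nat) = 3" by simp
    finally show ?thesis .
  qed
  have "(3 * n choose n) * 4 ^ n \<le> 27 ^ n"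
    using a[of n "3 * n"] by (simp add: power_mult flip: diff_mult_distrib2)
  moreover have "(6 * n choose (3 * n)) \<le> 64 ^ n" using binomial_le_pow2[of "6 * n" "3 * n"] by (simp add: power_mult)
  ultimately have "(6 * n choose (3 * n)) * ((3 * n choose n) * 4 ^ n) \<le> 64 ^ n * 27 ^ n"
    by (intro mult_mono) auto
  also have "\<dots> = 432 ^ n * 4 ^ n" by (simp flip: power_mult_distrib)
  finally show ?thesis by simp
qed

lemma prod_primes_dvd:
  fixes A :: "nat set"
  assumes "finite A" "\<And>p. p \<in> A \<Longrightarrow> prime p" "\<And>p. p \<in> A \<Longrightarrow> p dvd M"
  shows "\<Prod>A dvd M"
  using assms
proof (induction A)
  case (insert p A)
  have "coprime p (\<Prod>A)"
    by (rule prod_coprime_right) (use insert in \<open>auto intro!: primes_coprime\<close>)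
  with insert show ?case by (auto intro!: divides_mult)
qed auto

lemma theta_mult_6: "theta (6 * n) \<le> theta n + real n * ln 432"
proof -
  let ?A = "{p. prime p \<and> n < p \<and> p \<le> 6 * n}"
  have fin: "finite ?A" by (rule finite_subset[of _ "{..6*n}"]) auto
  have "theta (6 * n) = theta n + (\<Sum>p\<in>?A. ln (real p))"
    unfolding theta_def by (subst sum.union_disjoint[symmetric])
      (use fin in \<open>auto intro!: sum.cong\<close>)
  also have "(\<Sum>p\<in>?A. ln (real p)) = ln (real (\<Prod>?A))"
    by (subst ln_prod[symmetric]) (use fin prime_gt_0_nat in \<open>auto simp: of_nat_prod\<close>)
  also have "\<dots> \<le> ln (432 ^ n)"
  proof -
    have "\<Prod>?A dvd ((6 * n) choose (3 * n)) * ((3 * n) choose n)"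
      by (rule prod_primes_dvd) (use fin prime_dvd_multinomial in auto)
    from dvd_imp_le[OF this] have "\<Prod>?A \<le> 432 ^ n"
      using multinomial_le[of n] by simp
    moreover have "\<Prod>?A > 0" using prime_gt_0_nat by (intro prod_pos) auto
    ultimately show ?thesis
      by (metis (mono_tags, lifting) ln_mono of_nat_0_less_iff of_nat_le_iff of_nat_numeral of_nat_power)
  qed
  also have "ln (432 ^ n :: real) = real n * ln 432" by (simp add: ln_realpow)
  finally show ?thesis by simp
qed

lemma ln_432: "ln (432::real) \<le> 31 / 5"
proof -
  have "(3::real) \<le> (1 + 57/100 + (57/100)^2/2)^2" by (simp add: power2_eq_square)
  also have "\<dots> \<le> exp (57/100)^2" by (intro power_mono exp_lower_Taylor_quadratic) auto
  also have "\<dots> = exp (114/100)" by (simp add: power2_eq_square flip: exp_add)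
  finally have "ln (3::real) \<le> 114/100" using ln_mono[of 3 "exp (114/100)"] by simp
  moreover have "ln (432::real) = 4 * ln 2 + 3 * ln 3"
    using ln_mult[of "2^4" "3^3 :: real"] ln_realpow[of "2::real" 4] ln_realpow[of "3::real" 3] by simp
  ultimately show ?thesis using ln2_le_25_over_36 by simp
qed

lemma theta_mono: "m \<le> n \<Longrightarrow> theta m \<le> theta n"
  unfolding theta_def by (intro sum_mono2) (auto dest: prime_ge_1_nat)

text \<open>Induction from \<open>m div 6\<close> to \<open>m\<close>. The slope closes up because
  \<open>5/4 + 31/5 + 1/20 = 6 * 5/4\<close>; the spare \<open>1/20\<close> absorbs the at most five
  primes between \<open>6 * (m div 6)\<close> and \<open>m\<close> once \<open>m\<close> is
  large.\<close>

lemma theta_bound: "\<exists>K. \<forall>m. theta m \<le> 5 / 4 * real m + K"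
proof -
  have "eventually (\<lambda>m. 5 * ln (real m) \<le> 1/20 * ((real m - 5) / 6)) at_top"
    by real_asymp
  then obtain m0 where m0: "\<And>m. m \<ge> m0 \<Longrightarrow> 5 * ln (real m) \<le> 1/20 * ((real m - 5) / 6)"
    unfolding eventually_at_top_linorder by blast
  have "theta m \<le> 5 / 4 * real m + theta (m0 + 1)" for m
  proof (induction m rule: less_induct)
    case (less m)
    show ?case
    proof (cases "m \<le> m0 + 1")
      case True
      thus ?thesis using theta_mono[OF True] by simp
    next
      case False
      define n where "n = m div 6"
      have mn: "6 * n \<le> m" "m \<le> 6 * n + 5" unfolding n_def by presburger+
      have "theta m \<le> theta (6 * n) + 5 * ln (real m)"
      proof -
        let ?B = "{p. prime p \<and> 6 * n < p \<and> p \<le> m}"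
        have sub: "?B \<subseteq> {6*n<..m}" by auto
        have fin: "finite ?B" by (rule finite_subset[OF sub]) simp
        have "theta m = theta (6 * n) + (\<Sum>p\<in>?B. ln (real p))"
          unfolding theta_def by (subst sum.union_disjoint[symmetric])
            (use fin mn in \<open>auto intro!: sum.cong\<close>)
        also have "(\<Sum>p\<in>?B. ln (real p)) \<le> (\<Sum>p\<in>?B. ln (real m))"
          by (intro sum_mono) (auto simp: prime_gt_0_nat)
        also have "\<dots> = real (card ?B) * ln (real m)" by simp
        also have "\<dots> \<le> 5 * ln (real m)"
        proof (intro mult_right_mono)
          have "card ?B \<le> card {6*n<..m}" by (rule card_mono[OF _ sub]) simp
          also have "\<dots> \<le> 5" using mn by simp
          finally show "real (card ?B) \<le> 5" by simp
        qed (use False in auto)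
        finally show ?thesis by simp
      qed
      also have "theta (6 * n) \<le> theta n + real n * ln 432" by (rule theta_mult_6)
      also have "theta n \<le> 5 / 4 * real n + theta (m0 + 1)"
        by (rule less) (use False in \<open>auto simp: n_def\<close>)
      also have "real n * ln 432 \<le> real n * (31 / 5)" by (intro mult_left_mono ln_432) auto
      also have "5 * ln (real m) \<le> 1/20 * ((real m - 5) / 6)" by (rule m0) (use False in auto)
      also have "1/20 * ((real m - 5) / 6) \<le> 1/20 * real n" using mn by (simp add: field_simps)
      finally have "theta m \<le> 5/4 * (6 * real n) + theta (m0 + 1)" by simp
      also have "5/4 * (6 * real n) \<le> 5/4 * real m" using mn(1) by (simp flip: of_nat_le_iff[where 'a = real])
      finally show ?thesis by simp
    qed
  qed
  thus ?thesis by blast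
qed

section \<open>From theta to the prime counting function\<close>

lemma finite_primes_upto [simp, intro]: "finite (primes_upto y)"
proof (rule finite_subset)
  show "primes_upto y \<subseteq> {..nat \<lfloor>y\<rfloor>}" by (auto simp: primes_upto_def le_nat_floor)
qed auto

text \<open>At most every second number is prime: in the map \<open>p\<close> to
  \<open>(p - 1) div 2\<close> the prime 2 takes the place of the odd number 1. Unlike the Chebyshev
  bounds this is explicit for small \<open>y\<close>.\<close>

lemma prime_pi_le_half:
  assumes "y \<ge> 2"
  shows "real (prime_pi y) \<le> (y + 1) / 2"
proof -
  let ?g = "\<lambda>p::nat. (p - 1) div 2"
  have inj: "inj_on ?g (primes_upto y)"
  proof (rule inj_onI)
    fix p q assume pq: "p \<in> primes_upto y" "q \<in> primes_upto y" "(p - 1) div 2 = (q - 1) div 2"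
    have P: "r \<ge> 2 \<and> (r = 2 \<or> odd r)" if "r \<in> primes_upto y" for r
      using that prime_odd_nat[of r] prime_ge_2_nat[of r] by (cases "r = 2") (auto simp: primes_upto_def)
    from P[OF pq(1)] P[OF pq(2)] pq(3) show "p = q" by presburger
  qed
  have sub: "?g ` primes_upto y \<subseteq> {..nat \<lfloor>(y - 1) / 2\<rfloor>}"
  proof safe
    fix p assume "p \<in> primes_upto y"
    hence "real p \<le> y" "p \<ge> 2" by (auto simp: primes_upto_def dest: prime_ge_2_nat)
    moreover have "2 * ((p - 1) div 2) \<le> p - 1" by simp
    hence "2 * real ((p - 1) div 2) \<le> real (p - 1)" by (metis of_nat_le_iff of_nat_mult of_nat_numeral)
    ultimately have "real ((p - 1) div 2) \<le> (y - 1) / 2" by (simp add: of_nat_diff)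
    thus "(p - 1) div 2 \<le> nat \<lfloor>(y - 1) / 2\<rfloor>" by (rule le_nat_floor)
  qed
  have "prime_pi y = card (?g ` primes_upto y)" unfolding prime_pi_def by (rule card_image[OF inj, symmetric])
  also have "\<dots> \<le> nat \<lfloor>(y - 1) / 2\<rfloor> + 1" using card_mono[OF _ sub] by simp
  also have "real \<dots> \<le> (y - 1) / 2 + 1"
  proof -
    have "real_of_int \<lfloor>(y - 1) / 2\<rfloor> \<le> (y - 1) / 2" by (rule of_int_floor_le)
    moreover have "real (nat \<lfloor>(y - 1) / 2\<rfloor>) = real_of_int \<lfloor>(y - 1) / 2\<rfloor>" using assms by simp
    ultimately show ?thesis by linarith
  qed
  finally show ?thesis by (simp add: field_simps)
qed

lemma prime_pi_le_theta:
  assumes z: "1 < z" "z \<le> y"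
  shows "real (prime_pi y) \<le> z + theta (nat \<lfloor>y\<rfloor>) / ln z"
proof -
  let ?B = "{p \<in> primes_upto y. z < real p}"
  let ?A = "{p \<in> primes_upto y. real p \<le> z}"
  have "prime_pi y = card ?A + card ?B"
    unfolding prime_pi_def by (subst card_Un_disjoint[symmetric]) (auto intro!: arg_cong[where f = card])
  moreover have "real (card ?A) \<le> z"
  proof -
    have "?A \<subseteq> {1..nat \<lfloor>z\<rfloor>}" by (auto simp: primes_upto_def le_nat_floor dest: prime_ge_1_nat)
    from card_mono[OF _ this] have "card ?A \<le> nat \<lfloor>z\<rfloor>" by simp
    also have "real \<dots> \<le> z" using z by simp
    finally show ?thesis by simp
  qed
  moreover have "real (card ?B) * ln z \<le> theta (nat \<lfloor>y\<rfloor>)"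
  proof -
    have "real (card ?B) * ln z = (\<Sum>p\<in>?B. ln z)" by simp
    also have "\<dots> \<le> (\<Sum>p\<in>?B. ln (real p))" using z by (intro sum_mono) auto
    also have "\<dots> \<le> theta (nat \<lfloor>y\<rfloor>)" unfolding theta_def
      by (intro sum_mono2) (auto simp: primes_upto_def le_nat_floor dest: prime_ge_1_nat)
    finally show ?thesis .
  qed
  hence "real (card ?B) \<le> theta (nat \<lfloor>y\<rfloor>) / ln z" using z by (simp add: pos_le_divide_eq)
  ultimately show ?thesis by simp
qed

text \<open>Primes below \<open>y powr 0.95\<close> are negligible, and the others have logarithm at
  least \<open>0.95 * ln y\<close>; so the leading constant is \<open>(5/4) / 0.95 < 1.316\<close>,
  and 1.34 leaves room for the lower order terms.\<close>

lemma prime_pi_asymp: "\<exists>Y\<ge>2. \<forall>y\<ge>Y. real (prime_pi y) * ln y \<le> 134 / 100 * y"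
proof -
  obtain K where K: "\<And>m. theta m \<le> 5 / 4 * real m + K" using theta_bound by blast
  have "eventually (\<lambda>y. (y powr (95/100) + (5/4 * y + K) / ((95/100) * ln y)) * ln y \<le> 134/100 * y) at_top"
    by real_asymp
  then obtain Y where Y: "\<And>y. y \<ge> Y \<Longrightarrow> (y powr (95/100) + (5/4 * y + K) / ((95/100) * ln y)) * ln y \<le> 134/100 * y"
    unfolding eventually_at_top_linorder by blast
  have "real (prime_pi y) * ln y \<le> 134 / 100 * y" if y: "y \<ge> max Y 2" for y
  proof -
    have l: "ln y > 0" using y by simp
    have "real (prime_pi y) \<le> y powr (95/100) + theta (nat \<lfloor>y\<rfloor>) / ln (y powr (95/100))"
      by (rule prime_pi_le_theta) (use y powr_mono[of "95/100" 1 y] in auto)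
    also have "theta (nat \<lfloor>y\<rfloor>) \<le> 5/4 * y + K"
      using K[of "nat \<lfloor>y\<rfloor>"] y by (simp add: of_nat_nat) linarith
    also have "ln (y powr (95/100)) = 95/100 * ln y" by (simp add: ln_powr)
    finally have "real (prime_pi y) \<le> y powr (95/100) + (5/4 * y + K) / (95/100 * ln y)"
      using l by (simp add: divide_right_mono)
    hence "real (prime_pi y) * ln y \<le> (y powr (95/100) + (5/4 * y + K) / (95/100 * ln y)) * ln y"
      using l by (intro mult_right_mono) auto
    also have "\<dots> \<le> 134/100 * y" by (rule Y) (use y in auto)
    finally show ?thesis .
  qed
  thus ?thesis by (intro exI[of _ "max Y 2"]) auto
qed

lemma prime_pi_upper: "\<exists>C\<ge>1. \<forall>y\<ge>2. real (prime_pi y) * ln y \<le> C * y"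
proof -
  obtain Y where Y: "Y \<ge> 2" "\<And>y. y \<ge> Y \<Longrightarrow> real (prime_pi y) * ln y \<le> 134 / 100 * y"
    using prime_pi_asymp by blast
  have "real (prime_pi y) * ln y \<le> (Y + 2) * y" if y: "y \<ge> 2" for y
  proof (cases "y \<ge> Y")
    case True
    have "134 / 100 * y \<le> (Y + 2) * y" using Y(1) y by (intro mult_right_mono) auto
    thus ?thesis using Y(2)[OF True] by linarith
  next
    case False
    have "real (prime_pi y) \<le> Y" using prime_pi_le_half[OF y] False y by simp
    moreover have "ln y \<le> y" using y ln_bound[of y] by simp
    ultimately have "real (prime_pi y) * ln y \<le> Y * y" using y Y by (intro mult_mono) auto
    thus ?thesis using y by (simp add: algebra_simps)
  qed
  thus ?thesis using Y(1) by (intro exI[of _ "Y + 2"]) auto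
qed


section \<open>Smooth numbers as lattice points\<close>

definition pr :: "nat \<Rightarrow> nat" where
  "pr i = enumerate {p. prime p} i"

lemma prime_pr: "prime (pr i)"
  using enumerate_in_set[OF primes_infinite, of i] by (simp add: pr_def)

lemma pr_less_iff [simp]: "pr i < pr j \<longleftrightarrow> i < j"
  by (simp add: pr_def enumerate_mono_iff primes_infinite)

lemma pr_le_iff [simp]: "pr i \<le> pr j \<longleftrightarrow> i \<le> j"
  by (simp add: pr_def enumerate_mono_le_iff primes_infinite)

lemma pr_eq_iff [simp]: "pr i = pr j \<longleftrightarrow> i = j"
  by (metis order_eq_iff pr_le_iff)

lemma inj_pr: "inj_on pr X"
  by (rule inj_onI) simp

lemma prime_imp_pr: "prime p \<Longrightarrow> \<exists>i. p = pr i"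
  using enumerate_Ex[of "{p. prime p}" p] primes_infinite by (auto simp: pr_def)

lemma pr_ge_2: "pr i \<ge> 2"
  using prime_pr prime_ge_2_nat by blast

lemma pr_pos [simp]: "pr i > 0"
  using pr_ge_2[of i] by linarith

lemma pr_neq [simp]: "pr i \<noteq> 0" "pr i \<noteq> Suc 0"
  using pr_ge_2[of i] by linarith+

lemma pr_le_iff_prime_pi: "real (pr i) \<le> y \<longleftrightarrow> i < prime_pi y"
  and primes_upto_pr: "primes_upto y = pr ` {..<prime_pi y}"
proof -
  define I where "I = {i. real (pr i) \<le> y}"
  have img: "primes_upto y = pr ` I"
    using prime_imp_pr prime_pr by (auto simp: primes_upto_def I_def)
  have "finite I" using finite_imageD[OF _ inj_pr, of I] img finite_primes_upto by metis
  then obtain k where k: "k \<notin> I" "\<And>i. i < k \<Longrightarrow> i \<in> I"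
  proof -
    obtain j where "j \<notin> I" using \<open>finite I\<close> ex_new_if_finite infinite_UNIV_nat by blast
    thus ?thesis using that[of "LEAST i. i \<notin> I"] LeastI[of "\<lambda>i. i \<notin> I" j] not_less_Least by blast
  qed
  have "I = {..<k}"
  proof safe
    fix i assume "i \<in> I"
    show "i < k"
    proof (rule ccontr)
      assume "\<not> i < k"
      hence "pr k \<le> pr i" by simp
      hence "real (pr k) \<le> real (pr i)" by (rule of_nat_mono)
      moreover have "real (pr i) \<le> y" "\<not> real (pr k) \<le> y"
        using \<open>i \<in> I\<close> k(1) by (simp_all add: I_def)
      ultimately show False by linarith
    qed
  qed (use k in auto)
  moreover from this have "prime_pi y = k" by (simp add: prime_pi_def img card_image[OF inj_pr])
  ultimately have I: "I = {..<prime_pi y}" by simp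
  show "primes_upto y = pr ` {..<prime_pi y}" using img I by simp
  show "real (pr i) \<le> y \<longleftrightarrow> i < prime_pi y" using I by (auto simp: I_def)
qed

interpretation P: weights "\<lambda>i. ln (real (pr i))"
proof
  fix i show "ln (real (pr i)) > 0" using pr_ge_2[of i] by simp
qed

lemma d_eq: "d n y = fps_nth (P.todd_prod (prime_pi y)) n"
  unfolding d_def P.todd_prod_def primes_upto_pr todd_def
  by (subst prod.reindex[OF inj_pr]) simp

lemma E_eq:
  assumes "x > 1"
  shows "E x y = P.volume (prime_pi y) (ln x) *
           trunc (prime_pi y) (ln x) (cutoff x y) (P.todd_prod (prime_pi y))"
proof -
  let ?N = "prime_pi y"
  have u: "ln x > 0" using assms by simp
  have "(\<Prod>p\<in>primes_upto y. ln x / ln (real p)) = (\<Prod>i<?N. ln x / ln (real (pr i)))"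
    unfolding primes_upto_pr by (subst prod.reindex[OF inj_pr]) simp
  moreover have "(\<Sum>n=0..cutoff x y. d n y * ln x powi (- int n) / fact (?N - n)) =
     trunc ?N (ln x) (cutoff x y) (P.todd_prod ?N) / fact ?N"
    unfolding trunc_def sum_divide_distrib atLeast0AtMost
    by (intro sum.cong refl) (use u in \<open>auto simp: d_eq fall_def power_int_minus field_simps\<close>)
  ultimately show ?thesis by (simp add: E_def P.volume_def)
qed

text \<open>Unique factorization identifies smooth numbers with their exponent vectors, and the
  logarithm becomes the weight.\<close>

lemma Psi_eq_cnt:
  assumes x: "x > 1"
  shows "real (Psi x y) = P.cnt {..<prime_pi y} (ln x)"
proof -
  define N where "N = prime_pi y"
  define S where "S = {n::nat. 1 \<le> n \<and> real n \<le> x \<and> (\<forall>p. prime p \<and> p dvd n \<longrightarrow> real p \<le> y)}"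
  define g where "g e = (\<Prod>i<N. pr i ^ e i)" for e :: "nat \<Rightarrow> nat"
  have g0: "g e > 0" for e
    unfolding g_def by (intro prod_pos) auto
  have mult: "multiplicity (pr j) (g e) = e j" if "j < N" for e j
  proof -
    have "multiplicity (pr j) (g e) = (\<Sum>i<N. multiplicity (pr j) (pr i ^ e i))"
      unfolding g_def using prime_pr
      by (intro prime_elem_multiplicity_prod_distrib) (auto dest: prime_gt_0_nat)
    also have "\<dots> = (\<Sum>i<N. if i = j then e i else 0)"
      by (intro sum.cong refl) (auto simp: multiplicity_distinct_prime_power[OF prime_pr prime_pr]
           multiplicity_same_power' prime_pr)
    finally show ?thesis using that by simp
  qed
  have lng: "ln (real (g e)) = P.wt {..<N} e" for e
  proof -
    have "ln (real (g e)) = ln (\<Prod>i<N. real (pr i) ^ e i)" by (simp add: g_def)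
    also have "\<dots> = (\<Sum>i<N. ln (real (pr i) ^ e i))"
      by (rule ln_prod) auto
    also have "\<dots> = P.wt {..<N} e"
      unfolding P.wt_def by (intro sum.cong refl) (auto simp: ln_realpow)
    finally show ?thesis .
  qed
  have "bij_betw g (P.pts {..<N} (ln x)) S"
    unfolding bij_betw_def
  proof
    show "inj_on g (P.pts {..<N} (ln x))"
    proof (rule inj_onI)
      fix e f assume ef: "e \<in> P.pts {..<N} (ln x)" "f \<in> P.pts {..<N} (ln x)" "g e = g f"
      show "e = f"
      proof
        fix i show "e i = f i"
          using mult[of i e] mult[of i f] ef by (cases "i < N") (auto simp: P.pts_def)
      qed
    qed
    show "g ` P.pts {..<N} (ln x) = S"
    proof (intro equalityI subsetI)
      fix n assume "n \<in> g ` P.pts {..<N} (ln x)"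
      then obtain e where e: "e \<in> P.pts {..<N} (ln x)" "n = g e" by auto
      have "ln (real n) \<le> ln x" using e lng[of e] by (simp add: P.pts_def)
      hence "real n \<le> x" using g0[of e] e x by simp
      moreover have "real p \<le> y" if "prime p" "p dvd n" for p
      proof -
        have "\<exists>i\<in>{..<N}. p dvd pr i ^ e i"
          using that e(2) unfolding g_def by (subst prime_dvd_prod_iff[symmetric]) auto
        then obtain i where "i < N" "p dvd pr i ^ e i" by auto
        hence "p = pr i" using that(1) prime_pr[of i] prime_dvd_power primes_dvd_imp_eq by blast
        thus ?thesis using \<open>i < N\<close> pr_le_iff_prime_pi by (simp add: N_def)
      qed
      ultimately show "n \<in> S" using g0[of e] e by (auto simp: S_def)
    next
      fix n assume n: "n \<in> S"
      define e where "e i = (if i < N then multiplicity (pr i) n else 0)" for i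
      have n0: "n > 0" using n by (simp add: S_def)
      have "n = (\<Prod>p\<in>prime_factors n. p ^ multiplicity p n)"
        using prime_factorization_nat[of n] n0 by simp
      also have "\<dots> = (\<Prod>p\<in>primes_upto y. p ^ multiplicity p n)"
      proof (rule prod.mono_neutral_left)
        show "prime_factors n \<subseteq> primes_upto y"
          using n by (auto simp: S_def primes_upto_def in_prime_factors_iff)
        show "\<forall>i\<in>primes_upto y - prime_factors n. i ^ multiplicity i n = 1"
          using n0 by (auto simp: primes_upto_def in_prime_factors_iff not_dvd_imp_multiplicity_0)
      qed auto
      also have "\<dots> = g e"
        unfolding primes_upto_pr g_def e_def N_def by (subst prod.reindex[OF inj_pr]) auto
      finally have ng: "n = g e" .
      have "ln (real n) \<le> ln x" using n n0 x by (intro ln_mono) (auto simp: S_def)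
      hence "P.wt {..<N} e \<le> ln x" using lng[of e] unfolding ng[symmetric] by simp
      hence "e \<in> P.pts {..<N} (ln x)" by (auto simp: P.pts_def e_def)
      thus "n \<in> g ` P.pts {..<N} (ln x)" using ng by blast
    qed
  qed
  from bij_betw_same_card[OF this] show ?thesis
    by (simp add: Psi_def P.cnt_def S_def N_def)
qed

section \<open>The asymptotic formula\<close>

lemma exp_1_ge: "exp (1::real) \<ge> 27 / 10"
proof -
  have "(27/10::real) \<le> (1 + 1/5 + (1/5)^2/2)^5" by (simp add: eval_nat_numeral)
  also have "\<dots> \<le> exp (1/5) ^ 5" by (intro power_mono exp_lower_Taylor_quadratic) auto
  also have "\<dots> = exp 1" by (simp flip: exp_of_nat_mult)
  finally show ?thesis .
qed

text \<open>The maximum of \<open>ln z / z\<close> is \<open>1 / e\<close>, used here at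
  \<open>z = y powr (1/k)\<close>; the rational bound \<open>27/10\<close> for \<open>e\<close>
  keeps the constants explicit.\<close>

lemma ln_le_root:
  fixes y k :: real
  assumes "y \<ge> 1" "k > 0"
  shows "ln y \<le> k / (27/10) * y powr (1 / k)"
proof -
  define z where "z = y powr (1 / k)"
  have "y > 0" using assms by simp
  hence z: "z > 0" and lny: "ln y = k * ln z" using assms by (auto simp: z_def ln_powr)
  have "ln (z / exp 1) \<le> z / exp 1 - 1" by (rule ln_le_minus_one) (use z in auto)
  hence "ln z \<le> z / exp 1" using z by (simp add: ln_div)
  also have "\<dots> \<le> z / (27 / 10)" using z exp_1_ge by (intro divide_left_mono) auto
  finally have "k * ln z \<le> k * (z / (27/10))" using assms by (intro mult_left_mono) auto
  thus ?thesis by (simp add: lny flip: z_def)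
qed

text \<open>From \<open>u >= y powr (4/3)\<close> and \<open>N <= 3 y / 4\<close>, the quantity
  \<open>t = N ln y / u\<close> is at most \<open>(3/4) ln y / y powr (1/3)\<close>. Then
  \<open>ln_le_root\<close> with \<open>k = 3\<close> gives exactly \<open>5/6\<close>; with
  \<open>k = 12\<close>, where \<open>ln y ^ 4\<close> is compared with \<open>y powr (1/3)\<close>,
  it gives \<open>N t^4 <= (3/4)^5 * (12/2.7)^4 < 93\<close>.\<close>

lemma E_ge_volume:
  assumes x: "x > 1" and y: "y \<ge> 2" "y \<le> ln x powr (3/4)"
  shows "E x y \<ge> P.volume (prime_pi y) (ln x) / 2"
    and "P.volume (prime_pi y) (ln x) > 0"
proof -
  define N u where defs: "N = prime_pi y" "u = ln x"
  have u: "u > 0" using x by (simp add: defs)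
  define z where "z = y powr (1/3)"
  have z: "z > 0" using y by (simp add: z_def)
  have z3: "z ^ 3 = y" using y by (simp add: z_def flip: powr_realpow[of "y powr (1/3)"] add: powr_powr)
  have uy: "u \<ge> y * z"
  proof -
    have "y powr (4/3) \<le> (u powr (3/4)) powr (4/3)"
      using y by (intro powr_mono2) (auto simp: defs)
    also have "\<dots> = u" using u by (simp add: powr_powr)
    also have "y powr (4/3) = y * z"
      using powr_add[of y 1 "1/3"] y by (simp add: z_def)
    finally show ?thesis .
  qed
  have N: "real N \<le> 3 / 4 * y" using prime_pi_le_half[of y] y by (simp add: defs)
  define t where "t = ln y * (real N / u)"
  have lny: "ln y > 0" using y by simp
  have t0: "t \<ge> 0" using lny u by (simp add: t_def)
  have tz: "t \<le> 3 / 4 * ln y / z"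
  proof -
    have "real N / u \<le> (3 / 4 * y) / (y * z)"
      using N uy y z by (intro frac_le) auto
    hence "t \<le> ln y * ((3 / 4 * y) / (y * z))" unfolding t_def using lny by (intro mult_left_mono) auto
    thus ?thesis using y by simp
  qed
  have t1: "t \<le> 5 / 6"
  proof -
    have "ln y \<le> 3 / (27/10) * z" unfolding z_def by (rule ln_le_root) (use y in auto)
    hence "3 / 4 * ln y / z \<le> 5 / 6" using z by (simp add: field_simps)
    with tz show ?thesis by linarith
  qed
  have t2: "real N * t ^ 4 \<le> 93"
  proof -
    have "ln y \<le> 12 / (27/10) * y powr (1 / 12)" by (rule ln_le_root) (use y in auto)
    hence "ln y ^ 4 \<le> (12 / (27/10) * y powr (1 / 12)) ^ 4" using lny by (intro power_mono) auto
    also have "\<dots> = (12 / (27/10)) ^ 4 * z"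
      unfolding power_mult_distrib using y by (simp add: z_def powr_powr flip: powr_realpow[of "y powr (1/12)"])
    finally have l4: "ln y ^ 4 \<le> (12 / (27/10)) ^ 4 * z" .
    have "real N * t ^ 4 \<le> (3 / 4 * y) * (3 / 4 * ln y / z) ^ 4"
      using N tz t0 y by (intro mult_mono power_mono) auto
    also have "\<dots> = (3/4)^5 * ln y ^ 4 / z"
      using z by (simp flip: z3 add: field_simps eval_nat_numeral)
    also have "\<dots> \<le> (3/4)^5 * ((12 / (27/10)) ^ 4 * z) / z"
      using l4 z by (intro divide_right_mono mult_left_mono) auto
    also have "\<dots> \<le> 93" using z by (simp add: field_simps)
    finally show ?thesis .
  qed
  have "trunc N u (cutoff x y) (P.todd_prod N) \<ge> 1 / 2"
  proof (rule P.trunc_todd_prod_ge[where l = "ln y"])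
    have "cutoff x y \<le> nat \<lfloor>real N\<rfloor>" unfolding cutoff_def defs
      by (intro nat_mono floor_mono) auto
    thus "cutoff x y \<le> N" by simp
    show "ln (real (pr i)) \<le> ln y" if "i < N" for i
      using that pr_le_iff_prime_pi[of i y] pr_ge_2[of i] y by (auto simp: defs)
  qed (use u t1 t2 in \<open>auto simp: t_def\<close>)
  moreover show v: "P.volume (prime_pi y) (ln x) > 0"
    unfolding P.volume_def using x P.L_pos by (intro divide_pos_pos prod_pos) auto
  ultimately show "E x y \<ge> P.volume (prime_pi y) (ln x) / 2"
    unfolding E_eq[OF x] using mult_left_mono[of "1/2" "trunc N u (cutoff x y) (P.todd_prod N)" "P.volume N u"]
    by (simp add: defs)
qed

lemma Psi_E_large:
  "\<exists>C\<ge>0. \<exists>u0\<ge>2. \<forall>x y. 1 < x \<and> 2 \<le> y \<and> y \<le> ln x powr (3/4) \<and> ln x \<ge> u0 \<longrightarrow>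
     \<bar>real (Psi x y) - E x y\<bar> \<le> C * ln x powr (-1/8) * E x y"
proof -
  obtain K where K: "K \<ge> 1" "\<And>y. y \<ge> 2 \<Longrightarrow> real (prime_pi y) * ln y \<le> K * y"
    using prime_pi_upper by blast
  obtain Y where Y: "Y \<ge> 2" "\<And>y. y \<ge> Y \<Longrightarrow> real (prime_pi y) * ln y \<le> 134 / 100 * y"
    using prime_pi_asymp by blast
  \<comment> \<open>\<open>2 powr Y\<close> makes \<open>log 2 u >= Y\<close>, so that for
    \<open>y < Y\<close> the maximum in the cutoff is at least \<open>N\<close> and nothing is
    truncated; \<open>(24 * K) ^ 4\<close> makes the relative error \<open>\<delta>\<close> at most
    1/2.\<close>
  define u0 where "u0 = max (2 powr Y) ((24 * K) ^ 4)"
  have u02: "u0 \<ge> 2"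
  proof -
    have "2 powr 1 \<le> 2 powr Y" using Y(1) by (intro powr_mono) auto
    thus ?thesis by (simp add: u0_def)
  qed
  define C where "C = 42 * (12 * K) + 20"
  have "\<bar>real (Psi x y) - E x y\<bar> \<le> C * ln x powr (-1/8) * E x y"
    if x: "1 < x" and y: "2 \<le> y" "y \<le> ln x powr (3/4)" and ux: "ln x \<ge> u0" for x y
  proof -
    define N u where defs: "N = prime_pi y" "u = ln x"
    define A Q V where defs2: "A = real (Psi x y)" "Q = P.pol N u" "V = P.volume N u"
    have u: "u \<ge> u0" "u \<ge> 2" "u > 0" using ux u02 by (auto simp: defs)
    have lny: "ln y > 0" using y by simp
    have "2 \<in> primes_upto y" using y by (simp add: primes_upto_def)
    hence N0: "N > 0" using primes_upto_pr[of y] by (cases "prime_pi y = 0") (auto simp: defs)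
    have Ly: "ln (real (pr i)) \<le> ln y" if "i < N" for i
      using that pr_le_iff_prime_pi[of i y] pr_ge_2[of i] y by (auto simp: defs)
    have u14: "u powr (1/4) \<ge> 24 * K"
    proof -
      have "((24 * K) ^ 4) powr (1/4) \<le> u powr (1/4)"
        using u K by (intro powr_mono2) (auto simp: u0_def)
      moreover have "((24 * K) ^ 4) powr (1/4) = 24 * K"
      proof -
        have q: "(24 * K) ^ 4 = (24 * K) powr 4" using K by (subst powr_numeral) auto
        show ?thesis unfolding q powr_powr using K by simp
      qed
      ultimately show ?thesis by simp
    qed
    have yu: "y / u \<le> u powr (-1/4)"
    proof -
      have "y / u \<le> u powr (3/4) / u" using y u by (intro divide_right_mono) (auto simp: defs)
      also have "\<dots> = u powr (3/4) / u powr 1" using u by simp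
      also have "\<dots> = u powr (-1/4)" unfolding powr_diff[symmetric] by simp
      finally show ?thesis .
    qed
    have p1: "u powr (1/4) * u powr (-1/4) = 1" using u by (simp flip: powr_add)
    have NK: "real N * ln y / u \<le> K * u powr (-1/4)"
    proof -
      have "real N * ln y / u \<le> K * y / u" using K(2)[of y] y u by (intro divide_right_mono) (auto simp: defs)
      also have "\<dots> = K * (y / u)" by simp
      also have "\<dots> \<le> K * u powr (-1/4)" using K yu by (intro mult_left_mono) auto
      finally show ?thesis .
    qed
    have K24: "24 * (K * u powr (-1/4)) \<le> 1"
      using mult_right_mono[OF u14, of "u powr (-1/4)"] p1 by (simp add: mult_ac)
    define \<delta> where "\<delta> = 4 * exp 1 * (ln y * real N / u)"
    have \<delta>1: "\<delta> \<le> 12 * (K * u powr (-1/4))"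
    proof -
      have "4 * exp 1 * (ln y * real N / u) \<le> 4 * 3 * (K * u powr (-1/4))"
        using exp_le NK lny u by (intro mult_mono) (auto simp: mult_ac)
      thus ?thesis by (simp add: \<delta>_def)
    qed
    hence \<delta>2: "\<delta> \<le> 1 / 2" using K24 by linarith
    have \<delta>0: "\<delta> \<ge> 0" using lny u by (simp add: \<delta>_def)
    have u18: "u powr (-1/4) \<le> u powr (-1/8)" using u by (intro powr_mono) auto
    have AQ: "\<bar>A - Q\<bar> \<le> \<delta> * A"
    proof -
      have "0 \<le> K * u powr (-1/4)" using K by simp
      hence "real N * ln y / u \<le> 1 / 4" using NK K24 by linarith
      hence "4 * ln y * real N \<le> u" using u by (simp add: field_simps)
      hence "\<bar>P.cnt {..<N} u - P.pol N u\<bar> \<le> 4 * exp 1 * (ln y * real N / u) * P.cnt {..<N} u"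
        by (intro P.cnt_pol_diff_le) (use Ly u N0 in auto)
      thus ?thesis using Psi_eq_cnt[OF x, of y] by (simp add: defs defs2 \<delta>_def)
    qed
    define m where "m = cutoff x y"
    define X where "X = max (log 2 u) (max (exp 1 * ln y) (exp 1 * y\<^sup>2 / (u * ln y)))"
    have X0: "X > 0" using lny by (simp add: X_def less_max_iff_disj)
    have m: "m = nat \<lfloor>min (real N) X\<rfloor>" by (simp add: m_def cutoff_def X_def defs)
    have tail: "\<bar>trunc N u N (P.todd_prod N) - trunc N u m (P.todd_prod N)\<bar> \<le> 10 * u powr (-1/8)"
    proof (cases "X < real N")
      case False
      hence "m = N" by (simp add: m min_def)
      thus ?thesis by simp
    next
      case True
      hence m': "m = nat \<lfloor>X\<rfloor>" by (simp add: m min_def)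
      have mN: "m \<le> N" using True X0 by (simp add: m' nat_le_iff floor_le_iff)
      have Xm: "X < real (m + 1)" using X0 floor_correct[of X] by (simp add: m' add.commute)
      have yY: "y \<ge> Y"
      proof (rule ccontr)
        assume "\<not> y \<ge> Y"
        hence "real N \<le> Y" using prime_pi_le_half[OF y(1)] Y y by (simp add: defs)
        also have "Y \<le> log 2 u" using u by (simp add: le_log_iff u0_def)
        also have "\<dots> \<le> X" by (simp add: X_def)
        finally show False using True by simp
      qed
      have le: "exp 1 * (real N)^2 * ln y \<le> 9 / 10 * (2 * u * X)"
      proof -
        \<comment> \<open>\<open>1.34^2 = 1.7956 <= 9/5 = 2 * 9/10\<close>: here the constant of
          \<open>prime_pi_asymp\<close> is tight.\<close>
        have "(real N * ln y)^2 \<le> (134 / 100 * y)^2"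
          using Y(2)[OF yY] lny by (intro power_mono) (auto simp: defs)
        also have "\<dots> \<le> 9 / 5 * y^2" by (simp add: power_mult_distrib power2_eq_square)
        finally have "exp 1 * (real N * ln y)^2 / ln y \<le> exp 1 * (9 / 5 * y^2) / ln y"
          using lny by (intro divide_right_mono mult_left_mono) auto
        also have "\<dots> = 9 / 5 * (u * (exp 1 * y\<^sup>2 / (u * ln y)))" using u by simp
        also have "\<dots> \<le> 9 / 5 * (u * X)" using u by (intro mult_left_mono) (auto simp: X_def)
        finally show ?thesis using lny by (simp add: power2_eq_square mult_ac)
      qed
      have "\<bar>trunc N u N (P.todd_prod N) - trunc N u m (P.todd_prod N)\<bar> \<le> 10 * (9 / 10) ^ (m + 1)"
        by (rule P.trunc_todd_prod_tail[where X = X and l = "ln y"])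
           (use u mN lny Ly X0 True Xm le in auto)
      also have "(9 / 10 :: real) ^ (m + 1) = (9 / 10) powr real (m + 1)"
        by (subst powr_realpow) auto
      also have "\<dots> \<le> (9 / 10) powr (log 2 u)"
        using Xm by (intro powr_mono') (auto simp: X_def)
      also have "\<dots> = u powr (log 2 (9 / 10))"
        using u by (simp add: powr_def log_def)
      \<comment> \<open>\<open>0.9^8 < 1/2\<close>; this step decides the exponent 1/8.\<close>
      also have "\<dots> \<le> u powr (-1/8)"
      proof (rule powr_mono)
        have "(9 / 10 :: real) ^ 8 \<le> 1 / 2" by (simp add: eval_nat_numeral)
        hence "log 2 ((9 / 10 :: real) ^ 8) \<le> log 2 (1 / 2)" by (subst log_le_cancel_iff) auto
        thus "log 2 (9 / 10) \<le> -1 / (8::real)" by (simp add: log_nat_power log_divide)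
      qed (use u in auto)
      finally show ?thesis by simp
    qed
    have EV: "E x y \<ge> V / 2" "V > 0" using E_ge_volume[OF x y] by (auto simp: defs defs2)
    have QE: "\<bar>Q - E x y\<bar> \<le> 20 * u powr (-1/8) * E x y"
    proof -
      have "Q - E x y = V * (trunc N u N (P.todd_prod N) - trunc N u m (P.todd_prod N))"
        using E_eq[OF x, of y] P.pol_eq_trunc[OF u(3), of N]
        by (simp add: defs2 defs m_def algebra_simps)
      hence "\<bar>Q - E x y\<bar> = V * \<bar>trunc N u N (P.todd_prod N) - trunc N u m (P.todd_prod N)\<bar>"
        using EV by (simp add: abs_mult)
      also have "\<dots> \<le> V * (10 * u powr (-1/8))" using tail EV by (intro mult_left_mono) auto
      also have "\<dots> \<le> (2 * E x y) * (10 * u powr (-1/8))" using EV by (intro mult_right_mono) auto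
      finally show ?thesis by (simp add: mult_ac)
    qed
    have E0: "E x y > 0" using EV by linarith
    \<comment> \<open>\<open>AQ\<close> is relative to \<open>A\<close>, not to \<open>E\<close>. So
      a crude bound \<open>A <= 42 * E x y\<close> is derived first, by
      \<open>\<delta> <= 1/2\<close>, and then fed back into \<open>AQ\<close>.\<close>
    have "u powr (-1/8) \<le> u powr 0" using u by (intro powr_mono) auto
    hence "u powr (-1/8) \<le> 1" using u by simp
    hence "20 * u powr (-1/8) * E x y \<le> 20 * E x y" using E0 by simp
    hence "A - \<delta> * A \<le> 21 * E x y" using AQ QE by linarith
    moreover have "\<delta> * A \<le> 1 / 2 * A" using \<delta>2 by (intro mult_right_mono) (auto simp: defs2)
    ultimately have A42: "A \<le> 42 * E x y" by linarith
    have "\<delta> * A \<le> 12 * (K * u powr (-1/8)) * (42 * E x y)"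
    proof (intro mult_mono)
      have "12 * (K * u powr (-1/4)) \<le> 12 * (K * u powr (-1/8))"
        using u18 K by (intro mult_left_mono) auto
      with \<delta>1 show "\<delta> \<le> 12 * (K * u powr (-1/8))" by linarith
    qed (use A42 K in \<open>auto simp: defs2\<close>)
    hence "\<bar>A - E x y\<bar> \<le> 12 * (K * u powr (-1/8)) * (42 * E x y) + 20 * u powr (-1/8) * E x y"
      using AQ QE by linarith
    also have "\<dots> = C * u powr (-1/8) * E x y" by (simp add: C_def algebra_simps)
    finally show ?thesis by (simp add: defs defs2)
  qed
  moreover have "C \<ge> 0" using K by (simp add: C_def)
  ultimately show ?thesis using u02 by blast
qed

text \<open>Below \<open>u0\<close> the relative error need only be bounded. There
  \<open>Psi\<close> is at most \<open>exp u0\<close>, and \<open>E\<close> is at least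
  \<open>1 / (2 * fact n0)\<close>: every factor \<open>u / ln p\<close> of the volume is at least
  1, since \<open>ln p <= p <= y <= u\<close>, and there are at most \<open>n0\<close> primes. The
  factor \<open>u0 powr (1/8)\<close> in \<open>C'\<close> compensates for
  \<open>u powr (-1/8)\<close>.\<close>

lemma Psi_E_approx:
  "\<exists>C. \<forall>x y. 1 < x \<and> 2 \<le> y \<and> y \<le> ln x powr (3/4) \<longrightarrow>
     (\<exists>r. real (Psi x y) = E x y * (1 + r) \<and> \<bar>r\<bar> \<le> C * ln x powr (-1/8))"
proof -
  obtain C u0 where C: "C \<ge> 0" "u0 \<ge> 2"
    "\<And>x y. 1 < x \<Longrightarrow> 2 \<le> y \<Longrightarrow> y \<le> ln x powr (3/4) \<Longrightarrow> ln x \<ge> u0 \<Longrightarrow>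
       \<bar>real (Psi x y) - E x y\<bar> \<le> C * ln x powr (-1/8) * E x y"
    using Psi_E_large by blast
  define n0 where "n0 = nat \<lceil>u0\<rceil>"
  define C' where "C' = (2 * exp u0 * fact n0 + 1) * u0 powr (1/8)"
  have "\<exists>r. real (Psi x y) = E x y * (1 + r) \<and> \<bar>r\<bar> \<le> max C C' * ln x powr (-1/8)"
    if x: "1 < x" and y: "2 \<le> y" "y \<le> ln x powr (3/4)" for x y
  proof -
    define u where "u = ln x"
    have EV: "E x y \<ge> P.volume (prime_pi y) u / 2" "P.volume (prime_pi y) u > 0"
      using E_ge_volume[OF x y] by (auto simp: u_def)
    have E0: "E x y > 0" using EV by linarith
    define r where "r = (real (Psi x y) - E x y) / E x y"
    have r: "real (Psi x y) = E x y * (1 + r)" using E0 by (simp add: r_def field_simps)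
    have u0: "u > 0" using x by (simp add: u_def)
    have u1: "u > 1"
    proof (rule ccontr)
      assume "\<not> u > 1"
      hence "u powr (3/4) \<le> 1" using u0 by (simp add: powr_le1)
      thus False using y by (simp add: u_def)
    qed
    have "\<bar>r\<bar> \<le> max C C' * u powr (-1/8)"
    proof (cases "u \<ge> u0")
      case True
      hence "\<bar>real (Psi x y) - E x y\<bar> \<le> C * u powr (-1/8) * E x y"
        using C(3)[OF x y] by (simp add: u_def)
      hence "\<bar>r\<bar> \<le> C * u powr (-1/8)" using E0 by (simp add: r_def abs_divide pos_divide_le_eq)
      also have "\<dots> \<le> max C C' * u powr (-1/8)" by (intro mult_right_mono) auto
      finally show ?thesis .
    next
      case False
      have yu: "y \<le> u"
      proof -
        have "u powr (3/4) \<le> u powr 1" using u1 by (intro powr_mono) auto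
        thus ?thesis using y u0 by (simp add: u_def)
      qed
      have "real (prime_pi y) \<le> u0" using prime_pi_le_half[OF y(1)] yu y False by simp
      hence "real (prime_pi y) \<le> real n0" using real_nat_ceiling_ge[of u0] unfolding n0_def by linarith
      hence "prime_pi y \<le> n0" by simp
      hence f: "fact (prime_pi y) \<le> (fact n0 :: real)" by (rule fact_mono)
      have "(\<Prod>i<prime_pi y. 1) \<le> (\<Prod>i<prime_pi y. u / ln (real (pr i)))"
      proof (rule prod_mono)
        fix i assume "i \<in> {..<prime_pi y}"
        hence "real (pr i) \<le> y" by (simp add: pr_le_iff_prime_pi)
        moreover have "ln (real (pr i)) \<le> real (pr i)"
          using ln_bound[of "real (pr i)"] pr_ge_2[of i] by simp
        ultimately show "0 \<le> (1::real) \<and> 1 \<le> u / ln (real (pr i))"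
          using yu P.L_pos[of i] by (simp add: le_divide_eq)
      qed
      hence "1 / fact n0 \<le> P.volume (prime_pi y) u"
        unfolding P.volume_def using f by (intro frac_le) auto
      hence Ege: "1 / (2 * fact n0) \<le> E x y" using EV by simp
      have "real (Psi x y) \<le> exp u0"
      proof -
        have "Psi x y \<le> card {1..nat \<lfloor>x\<rfloor>}" unfolding Psi_def
          by (rule card_mono) (auto simp: le_nat_floor)
        also have "real \<dots> \<le> x" using x by simp
        also have "x = exp u" using x by (simp add: u_def)
        also have "\<dots> \<le> exp u0" using False by simp
        finally show ?thesis by simp
      qed
      hence "real (Psi x y) / E x y \<le> exp u0 / (1 / (2 * fact n0))"
        using Ege by (intro frac_le) auto
      moreover have "r = real (Psi x y) / E x y - 1" using E0 by (simp add: r_def field_simps)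
      moreover have "real (Psi x y) / E x y \<ge> 0" using E0 by simp
      moreover have "exp u0 / (1 / (2 * fact n0)) = 2 * exp u0 * fact n0" by simp
      moreover have "2 * exp u0 * (fact n0 :: real) \<ge> 0" by simp
      ultimately have "\<bar>r\<bar> \<le> 2 * exp u0 * fact n0 + 1" by linarith
      also have "\<dots> = C' * u0 powr (-1/8)"
        using C(2) by (simp add: C'_def mult.assoc flip: powr_add)
      also have "\<dots> \<le> C' * u powr (-1/8)"
        using False u0 by (intro mult_left_mono powr_mono2') (auto simp: C'_def)
      also have "\<dots> \<le> max C C' * u powr (-1/8)" by (intro mult_right_mono) auto
      finally show ?thesis .
    qed
    with r show ?thesis by (auto simp: u_def)
  qed
  thus ?thesis by blast
qed

lemma Psi_E_approx_theta:
  fixes \<theta> \<epsilon> :: real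
  assumes "0 < \<theta>" "\<theta> < 3 / 4" "0 < \<epsilon>"
  shows "\<exists>C :: real. \<forall>x y :: real. 1 < x \<and> 2 \<le> y \<and> y \<le> ln x powr \<theta> \<longrightarrow>
        (\<exists>r. real (Psi x y) = E x y * (1 + r) \<and>
          \<bar>r\<bar> \<le> C * ln x powr (- 1 / 8 + \<epsilon>))"
proof -
  obtain C where C: "\<And>x y. 1 < x \<Longrightarrow> 2 \<le> y \<Longrightarrow> y \<le> ln x powr (3/4) \<Longrightarrow>
     (\<exists>r. real (Psi x y) = E x y * (1 + r) \<and> \<bar>r\<bar> \<le> C * ln x powr (-1/8))"
    using Psi_E_approx by blast
  have "\<exists>r. real (Psi x y) = E x y * (1 + r) \<and> \<bar>r\<bar> \<le> max C 0 * ln x powr (- 1 / 8 + \<epsilon>)"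
    if x: "1 < x" and y: "2 \<le> y" "y \<le> ln x powr \<theta>" for x y
  proof -
    have u0: "ln x > 0" using x by simp
    have u1: "ln x > 1"
    proof (rule ccontr)
      assume "\<not> ln x > 1"
      hence "ln x powr \<theta> \<le> 1" using u0 assms by (simp add: powr_le1)
      thus False using y by simp
    qed
    have "ln x powr \<theta> \<le> ln x powr (3/4)" using u1 assms by (intro powr_mono) auto
    hence "y \<le> ln x powr (3/4)" using y by linarith
    from C[OF x y(1) this] obtain r where r: "real (Psi x y) = E x y * (1 + r)"
      "\<bar>r\<bar> \<le> C * ln x powr (-1/8)" by blast
    have "C * ln x powr (-1/8) \<le> max C 0 * ln x powr (- 1 / 8 + \<epsilon>)"
      using u1 assms by (intro mult_mono powr_mono) auto
    with r show ?thesis by (intro exI[of _ r]) auto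
  qed
  thus ?thesis by blast
qed


section \<open>Reasoning about programs\<close>

text \<open>Total correctness with a budget: only an upper bound for the cost is kept, so that rules
  compose without exact counts.\<close>

definition runs :: "nat \<Rightarrow> com \<Rightarrow> memory \<Rightarrow> nat \<Rightarrow> (memory \<Rightarrow> bool) \<Rightarrow> bool" where
  "runs S P s T Q \<longleftrightarrow> (\<exists>t s'. exec S P s t s' \<and> t \<le> T \<and> Q s')"

lemma ints_set_int [simp]: "ints (set_int a i k s) b j = (if b = a \<and> j = i then k else ints s b j)"
  and reals_set_int [simp]: "reals (set_int a i k s) = reals s"
  and reals_set_real [simp]: "reals (set_real a i u s) b j = (if b = a \<and> j = i then u else reals s b j)"
  and ints_set_real [simp]: "ints (set_real a i u s) = ints s"
  by (auto simp: set_int_def set_real_def)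

lemma ints_set_int_other: "b \<noteq> a \<Longrightarrow> ints (set_int a i k s) b = ints s b"
  and reals_set_real_other: "b \<noteq> a \<Longrightarrow> reals (set_real a i u s) b = reals s b"
  by auto

inductive_cases exec_SkipE: "exec S Skip s t s'"
inductive_cases exec_ISetE: "exec S (ISet a e1 e2) s t s'"
inductive_cases exec_RSetE: "exec S (RSet a e1 e2) s t s'"
inductive_cases exec_SeqE: "exec S (Seq P1 P2) s t s'"
inductive_cases exec_CondE: "exec S (Cond b P1 P2) s t s'"

lemma exec_Skip_iff: "exec S Skip s t s' \<longleftrightarrow> t = 1 \<and> s' = s"
proof
  assume "t = 1 \<and> s' = s"
  thus "exec S Skip s t s'" using exec.Skip[of S s] by blast
qed (auto elim: exec_SkipE)

lemma exec_ISet_iff: "exec S (ISet a e1 e2) s t s' \<longleftrightarrow>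
    iok S s e1 \<and> iok S s e2 \<and> 0 \<le> ival s e1 \<and> ival s e1 < int S \<and>
    t = icost e1 + icost e2 + 1 \<and> s' = set_int a (ival s e1) (ival s e2) s"
proof
  assume "iok S s e1 \<and> iok S s e2 \<and> 0 \<le> ival s e1 \<and> ival s e1 < int S \<and>
    t = icost e1 + icost e2 + 1 \<and> s' = set_int a (ival s e1) (ival s e2) s"
  thus "exec S (ISet a e1 e2) s t s'" using exec.ISet[of S s e1 e2 a] by blast
qed (auto elim: exec_ISetE)

lemma exec_RSet_iff: "exec S (RSet a e1 e2) s t s' \<longleftrightarrow>
    iok S s e1 \<and> rok S s e2 \<and> 0 \<le> ival s e1 \<and> ival s e1 < int S \<and>
    t = icost e1 + rcost e2 + 1 \<and> s' = set_real a (ival s e1) (rval s e2) s"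
proof
  assume "iok S s e1 \<and> rok S s e2 \<and> 0 \<le> ival s e1 \<and> ival s e1 < int S \<and>
    t = icost e1 + rcost e2 + 1 \<and> s' = set_real a (ival s e1) (rval s e2) s"
  thus "exec S (RSet a e1 e2) s t s'" using exec.RSet[of S s e1 e2 a] by blast
qed (auto elim: exec_RSetE)

lemma exec_Seq_iff: "exec S (Seq P1 P2) s t s' \<longleftrightarrow>
    (\<exists>t1 t2 s1. exec S P1 s t1 s1 \<and> exec S P2 s1 t2 s' \<and> t = t1 + t2)"
  by (blast elim: exec_SeqE intro: exec.Seq)

lemma exec_Cond_iff: "exec S (Cond b P1 P2) s t s' \<longleftrightarrow>
    bok S s b \<and> (\<exists>t'. exec S (if bval s b then P1 else P2) s t' s' \<and> t = bcost b + 1 + t')"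
proof
  assume "exec S (Cond b P1 P2) s t s'"
  thus "bok S s b \<and> (\<exists>t'. exec S (if bval s b then P1 else P2) s t' s' \<and> t = bcost b + 1 + t')"
    by (rule exec_CondE) auto
next
  assume "bok S s b \<and> (\<exists>t'. exec S (if bval s b then P1 else P2) s t' s' \<and> t = bcost b + 1 + t')"
  then obtain t' where t': "bok S s b" "exec S (if bval s b then P1 else P2) s t' s'" "t = bcost b + 1 + t'"
    by blast
  show "exec S (Cond b P1 P2) s t s'"
  proof (cases "bval s b")
    case True
    thus ?thesis unfolding t'(3) using t' by (intro exec.CondTrue) auto
  next
    case False
    thus ?thesis unfolding t'(3) using t' by (intro exec.CondFalse) auto
  qed
qed

lemma runs_Skip: "runs S Skip s T Q \<longleftrightarrow> 1 \<le> T \<and> Q s"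
  by (auto simp: runs_def exec_Skip_iff)

lemma runs_ISet: "runs S (ISet a e1 e2) s T Q \<longleftrightarrow>
    iok S s e1 \<and> iok S s e2 \<and> 0 \<le> ival s e1 \<and> ival s e1 < int S \<and>
    icost e1 + icost e2 + 1 \<le> T \<and> Q (set_int a (ival s e1) (ival s e2) s)"
  by (auto simp: runs_def exec_ISet_iff)

lemma runs_RSet: "runs S (RSet a e1 e2) s T Q \<longleftrightarrow>
    iok S s e1 \<and> rok S s e2 \<and> 0 \<le> ival s e1 \<and> ival s e1 < int S \<and>
    icost e1 + rcost e2 + 1 \<le> T \<and> Q (set_real a (ival s e1) (rval s e2) s)"
  by (auto simp: runs_def exec_RSet_iff)

lemma runs_Cond: "runs S (Cond b P1 P2) s T Q \<longleftrightarrow>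
    bok S s b \<and> bcost b + 1 \<le> T \<and> runs S (if bval s b then P1 else P2) s (T - (bcost b + 1)) Q"
proof
  assume "runs S (Cond b P1 P2) s T Q"
  then obtain t' s' where "bok S s b" "exec S (if bval s b then P1 else P2) s t' s'"
    "bcost b + 1 + t' \<le> T" "Q s'"
    by (auto simp: runs_def exec_Cond_iff)
  thus "bok S s b \<and> bcost b + 1 \<le> T \<and> runs S (if bval s b then P1 else P2) s (T - (bcost b + 1)) Q"
    unfolding runs_def by (intro conjI exI[of _ t'] exI[of _ s']) auto
next
  assume A: "bok S s b \<and> bcost b + 1 \<le> T \<and> runs S (if bval s b then P1 else P2) s (T - (bcost b + 1)) Q"
  then obtain t' s' where "exec S (if bval s b then P1 else P2) s t' s'"
    "t' \<le> T - (bcost b + 1)" "Q s'" by (auto simp: runs_def)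
  with A show "runs S (Cond b P1 P2) s T Q"
    unfolding runs_def exec_Cond_iff by (intro exI[of _ "bcost b + 1 + t'"] exI[of _ s']) auto
qed

lemma runs_Seq_exec: "runs S (Seq P1 P2) s T Q \<longleftrightarrow>
    (\<exists>t1 s1. exec S P1 s t1 s1 \<and> t1 \<le> T \<and> runs S P2 s1 (T - t1) Q)"
proof
  assume "runs S (Seq P1 P2) s T Q"
  then obtain t1 t2 s1 s' where "exec S P1 s t1 s1" "exec S P2 s1 t2 s'" "t1 + t2 \<le> T" "Q s'"
    by (auto simp: runs_def exec_Seq_iff)
  thus "\<exists>t1 s1. exec S P1 s t1 s1 \<and> t1 \<le> T \<and> runs S P2 s1 (T - t1) Q"
    unfolding runs_def by (intro exI[of _ t1] exI[of _ s1] conjI exI[of _ t2] exI[of _ s']) auto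
next
  assume "\<exists>t1 s1. exec S P1 s t1 s1 \<and> t1 \<le> T \<and> runs S P2 s1 (T - t1) Q"
  then obtain t1 t2 s1 s' where "exec S P1 s t1 s1" "t1 \<le> T" "exec S P2 s1 t2 s'" "t2 \<le> T - t1" "Q s'"
    by (auto simp: runs_def)
  thus "runs S (Seq P1 P2) s T Q"
    unfolding runs_def exec_Seq_iff by (intro exI[of _ "t1 + t2"] exI[of _ s'] conjI exI[of _ t1] exI[of _ t2] exI[of _ s1]) auto
qed

lemma runs_Seq:
  assumes "runs S P1 s T1 R" "\<And>s'. R s' \<Longrightarrow> runs S P2 s' T2 Q" "T1 + T2 \<le> T"
  shows "runs S (Seq P1 P2) s T Q"
proof -
  obtain t1 s1 where 1: "exec S P1 s t1 s1" "t1 \<le> T1" "R s1" using assms(1) by (auto simp: runs_def)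
  obtain t2 s2 where 2: "exec S P2 s1 t2 s2" "t2 \<le> T2" "Q s2"
    using assms(2)[OF 1(3)] by (auto simp: runs_def)
  show ?thesis unfolding runs_def
    using exec.Seq[OF 1(1) 2(1)] 1 2 assms(3) by (intro exI[of _ "t1 + t2"] exI[of _ s2]) auto
qed

lemma runs_mono:
  assumes "runs S P s T Q" "\<And>s'. Q s' \<Longrightarrow> Q' s'" "T \<le> T'"
  shows "runs S P s T' Q'"
  using assms unfolding runs_def by (meson order_trans)

lemma runs_Seq_ISet: "runs S (Seq (ISet a e1 e2) P) s T Q \<longleftrightarrow>
    iok S s e1 \<and> iok S s e2 \<and> 0 \<le> ival s e1 \<and> ival s e1 < int S \<and>
    icost e1 + icost e2 + 1 \<le> T \<and>
    runs S P (set_int a (ival s e1) (ival s e2) s) (T - (icost e1 + icost e2 + 1)) Q"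
  by (auto simp: runs_Seq_exec exec_ISet_iff)

lemma runs_Seq_RSet: "runs S (Seq (RSet a e1 e2) P) s T Q \<longleftrightarrow>
    iok S s e1 \<and> rok S s e2 \<and> 0 \<le> ival s e1 \<and> ival s e1 < int S \<and>
    icost e1 + rcost e2 + 1 \<le> T \<and>
    runs S P (set_real a (ival s e1) (rval s e2) s) (T - (icost e1 + rcost e2 + 1)) Q"
  by (auto simp: runs_Seq_exec exec_RSet_iff)

lemmas runs_simps = runs_Skip runs_ISet runs_RSet runs_Cond runs_Seq_ISet runs_Seq_RSet

text \<open>The invariant is indexed by the number of completed rounds, which replaces a termination
  measure; the last \<open>bcost b + 1\<close> pays for the failing test.\<close>

lemma runs_While:
  assumes step: "\<And>k s. k < n \<Longrightarrow> I k s \<Longrightarrow> bok S s b \<and> bval s b \<and> runs S P s B (I (Suc k))"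
    and stop: "\<And>s. I n s \<Longrightarrow> bok S s b \<and> \<not> bval s b"
    and init: "I 0 s" and T: "n * (B + bcost b + 1) + bcost b + 1 \<le> T"
    and Q: "\<And>s. I n s \<Longrightarrow> Q s"
  shows "runs S (While b P) s T Q"
proof -
  have "\<exists>t s'. exec S (While b P) s t s' \<and> t \<le> j * (B + bcost b + 1) + bcost b + 1 \<and> I n s'"
    if "I k s" "j = n - k" "k \<le> n" for j k s
    using that
  proof (induction j arbitrary: k s)
    case 0
    hence "I n s" by simp
    with exec.WhileFalse[of S s b P] stop[OF this] show ?case
      by (intro exI[of _ "bcost b + 1"] exI[of _ s]) auto
  next
    case (Suc j)
    hence k: "k < n" by simp
    from step[OF k Suc.prems(1)] obtain t1 s1 where 1: "bok S s b" "bval s b"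
      "exec S P s t1 s1" "t1 \<le> B" "I (Suc k) s1" by (auto simp: runs_def)
    have jk: "j = n - Suc k" "Suc k \<le> n" using Suc.prems k by auto
    from Suc.IH[OF 1(5) jk] obtain t2 s2 where 2: "exec S (While b P) s1 t2 s2"
      "t2 \<le> j * (B + bcost b + 1) + bcost b + 1" "I n s2" by blast
    show ?case using exec.WhileTrue[OF 1(1-3) 2(1)] 1(4) 2(2,3)
      by (intro exI[of _ "bcost b + 1 + t1 + t2"] exI[of _ s2]) auto
  qed
  from this[OF init, of n] T Q show ?thesis unfolding runs_def by (fastforce intro: order_trans)
qed

section \<open>Counting loops and frame conditions\<close>

abbreviation IV :: "nat \<Rightarrow> iexp" where "IV a \<equiv> IGet a (IConst 0)"
abbreviation RV :: "nat \<Rightarrow> rexp" where "RV a \<equiv> RGet a (IConst 0)"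
abbreviation iset :: "nat \<Rightarrow> iexp \<Rightarrow> com" where "iset a e \<equiv> ISet a (IConst 0) e"
abbreviation rset :: "nat \<Rightarrow> rexp \<Rightarrow> com" where "rset a e \<equiv> RSet a (IConst 0) e"

definition For :: "nat \<Rightarrow> iexp \<Rightarrow> com \<Rightarrow> com" where
  "For i e P = Seq (iset i (IConst 0))
     (While (BNot (ILe e (IV i))) (Seq P (iset i (IOp IAdd (IV i) (IConst 1)))))"

text \<open>The limit is evaluated anew before every round, so the invariant has to preserve its
  value. \<open>J\<close> speaks of the memory after the counter has been set, and the body has to
  leave the counter as it found it.\<close>

lemma runs_For:
  assumes S: "S > 0" and init: "J 0 (set_int i 0 0 s)"
    and body: "\<And>k s. k < n \<Longrightarrow> J k s \<Longrightarrow> ints s i 0 = int k \<Longrightarrow>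
       runs S P s B (\<lambda>s'. ints s' i 0 = int k \<and> J (Suc k) (set_int i 0 (int k + 1) s'))"
    and lim: "\<And>k s. k \<le> n \<Longrightarrow> J k s \<Longrightarrow> ints s i 0 = int k \<Longrightarrow> iok S s e \<and> ival s e = int n"
    and T: "n * (B + icost e + 12) + icost e + 12 \<le> T"
    and Q: "\<And>s. J n s \<Longrightarrow> ints s i 0 = int n \<Longrightarrow> Q s"
  shows "runs S (For i e P) s T Q"
proof -
  define I where "I k s \<longleftrightarrow> J k s \<and> ints s i 0 = int k" for k s
  let ?b = "BNot (ILe e (IV i))"
  have "runs S (While ?b (Seq P (iset i (IOp IAdd (IV i) (IConst 1))))) (set_int i 0 0 s)
    (n * ((B + 6) + bcost ?b + 1) + bcost ?b + 1) Q"
  proof (rule runs_While[where I = I])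
    fix k s assume k: "k < n" and I: "I k s"
    have "runs S (Seq P (iset i (IOp IAdd (IV i) (IConst 1)))) s (B + 6) (I (Suc k))"
      by (rule runs_Seq[OF body[OF k]]) (use I S in \<open>auto simp: I_def runs_ISet\<close>)
    thus "bok S s ?b \<and> bval s ?b \<and> runs S (Seq P (iset i (IOp IAdd (IV i) (IConst 1)))) s (B + 6) (I (Suc k))"
      using lim[of k s] k I S by (auto simp: I_def)
  qed (use lim[of n] S init Q in \<open>auto simp: I_def\<close>)
  thus ?thesis unfolding For_def using S T
    by (intro runs_Seq[where R = "\<lambda>s'. s' = set_int i 0 0 s" and ?T1.0 = 3])
       (auto simp: runs_ISet algebra_simps elim!: runs_mono)
qed

text \<open>The frame condition: \<open>A\<close> and \<open>B\<close> are the integer and the real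
  arrays that a program part may write to; facts about all others survive it.\<close>

definition same :: "nat set \<Rightarrow> nat set \<Rightarrow> memory \<Rightarrow> memory \<Rightarrow> bool" where
  "same A B s s' \<longleftrightarrow> (\<forall>a. a \<notin> A \<longrightarrow> ints s' a = ints s a) \<and> (\<forall>b. b \<notin> B \<longrightarrow> reals s' b = reals s b)"

lemma same_ints: "same A B s s' \<Longrightarrow> a \<notin> A \<Longrightarrow> ints s' a = ints s a"
  and same_reals: "same A B s s' \<Longrightarrow> b \<notin> B \<Longrightarrow> reals s' b = reals s b"
  by (auto simp: same_def)

lemma same_refl [simp]: "same A B s s"
  by (simp add: same_def)

lemma same_trans: "same A B s s' \<Longrightarrow> same A' B' s' s'' \<Longrightarrow> A \<subseteq> C \<Longrightarrow> A' \<subseteq> C \<Longrightarrow>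
    B \<subseteq> D \<Longrightarrow> B' \<subseteq> D \<Longrightarrow> same C D s s''"
  unfolding same_def by (metis subsetD)

lemma same_set_int: "same A B s s' \<Longrightarrow> a \<in> A \<Longrightarrow> same A B s (set_int a i k s')"
  by (auto simp: same_def ints_set_int_other fun_eq_iff)

lemma same_set_real: "same A B s s' \<Longrightarrow> b \<in> B \<Longrightarrow> same A B s (set_real b i u s')"
  by (auto simp: same_def reals_set_real_other fun_eq_iff)

section \<open>The discrete Fourier transform\<close>

definition unit_root :: "nat \<Rightarrow> complex" where
  "unit_root M = cis (2 * pi / real M)"

lemma unit_root_power: "unit_root M ^ k = cis (2 * pi * real k / real M)"
  unfolding unit_root_def Complex.DeMoivre by (simp add: field_simps)

lemma unit_root_power_self: "M > 0 \<Longrightarrow> unit_root M ^ M = 1"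
  by (simp add: unit_root_power)

lemma unit_root_power_half: "M = 2 * h \<Longrightarrow> h > 0 \<Longrightarrow> unit_root M ^ h = -1"
  by (simp add: unit_root_power)

definition dft :: "nat \<Rightarrow> (nat \<Rightarrow> complex) \<Rightarrow> nat \<Rightarrow> complex" where
  "dft M z j = (\<Sum>i<M. z i * unit_root M ^ (i * j))"

text \<open>The invariant of the transform at stride \<open>st\<close>: the residue classes modulo \<open>st\<close> hold
  sequences of length \<open>M / st\<close> whose transforms interleave to the transform \<open>X\<close> of the input.\<close>

definition fft_inv :: "nat \<Rightarrow> nat \<Rightarrow> (nat \<Rightarrow> complex) \<Rightarrow> (nat \<Rightarrow> complex) \<Rightarrow> bool" where
  "fft_inv M st X z \<longleftrightarrow> (\<forall>q<st. \<forall>k<M div st.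
     (\<Sum>p<M div st. z (q + st * p) * unit_root M ^ (st * p * k)) = X (q + st * k))"

lemma fft_inv_init: "M > 0 \<Longrightarrow> fft_inv M 1 (dft M z) z"
  by (simp add: fft_inv_def dft_def)

lemma fft_inv_final: "M > 0 \<Longrightarrow> fft_inv M M X z \<Longrightarrow> j < M \<Longrightarrow> z j = X j"
  by (simp add: fft_inv_def)

text \<open>Stockham's self-sorting order: for \<open>i = q + st * p\<close> with
  \<open>q < st\<close>, the sum of a butterfly goes to \<open>q + 2 * st * p\<close> and the
  difference \<open>st\<close> places further. The output appears in natural order, without bit
  reversal.\<close>

definition fft_pos :: "nat \<Rightarrow> nat \<Rightarrow> nat" where
  "fft_pos st i = 2 * i - i mod st"

lemma fft_pos: "q < st \<Longrightarrow> fft_pos st (q + st * p) = q + 2 * st * p"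
  by (simp add: fft_pos_def)

lemma sum_split_half: "(\<Sum>p<2 * (m::nat). f p) = (\<Sum>p<m. f p + f (p + m) :: complex)"
proof -
  have "{..<2*m} = {..<m} \<union> (\<lambda>p. p + m) ` {..<m}"
  proof safe
    fix p assume "p < 2 * m" "p \<notin> (\<lambda>p. p + m) ` {..<m}"
    thus "p < m" by (metis add_diff_inverse_nat image_eqI lessThan_iff mult_2 nat_add_left_cancel_less add.commute)
  qed auto
  hence "(\<Sum>p<2 * m. f p) = (\<Sum>p<m. f p) + (\<Sum>p\<in>(\<lambda>p. p + m) ` {..<m}. f p)"
    by (simp only:) (rule sum.union_disjoint; auto)
  thus ?thesis by (simp add: sum.reindex sum.distrib)
qed

lemma butterfly:
  fixes x a b u v w w' :: complex
  assumes "x = (a - b) * u" "v = - w'" "u * w = w'"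
  shows "x * w = a * w' + b * v"
  unfolding assms(1,2) assms(3)[symmetric] by (simp add: algebra_simps)

text \<open>Decimation in frequency. When \<open>p\<close> is paired with \<open>p + m\<close> in a
  class of length \<open>2 * m\<close>, the sums carry the even frequencies, because
  \<open>unit_root M ^ (2 * h) = 1\<close>, and the differences, twisted by
  \<open>unit_root M ^ (st * p)\<close>, carry the odd ones, because
  \<open>unit_root M ^ h = -1\<close>. The exponent \<open>i - i mod st\<close> is this
  \<open>st * p\<close>.\<close>

lemma fft_inv_step:
  assumes M: "M = 2 * h" "h = st * m" "M > 0"
    and inv: "fft_inv M st X z"
    and z': "\<And>i. i < h \<Longrightarrow> z' (fft_pos st i) = z i + z (i + h)"
      "\<And>i. i < h \<Longrightarrow> z' (fft_pos st i + st) = (z i - z (i + h)) * unit_root M ^ (i - i mod st)"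
  shows "fft_inv M (2 * st) X z'"
  unfolding fft_inv_def
proof (intro allI impI)
  fix q k assume q: "q < 2 * st" and k: "k < M div (2 * st)"
  let ?w = "unit_root M"
  have pos: "st > 0" "h > 0" "m > 0" using M by auto
  have Mm: "M div (2 * st) = m" "M div st = 2 * m" using M pos by auto
  have ih: "(\<Sum>p<m. z (q + st * p) * ?w ^ (st * p * k) + z (q + st * (p + m)) * ?w ^ (st * (p + m) * k))
      = X (q + st * k)" if "q < st" "k < 2 * m" for q k
    using inv that unfolding fft_inv_def Mm sum_split_half by blast
  have bnd: "q + st * p < h" if "q < st" "p < m" for q p
  proof -
    have "q + st * p < st * Suc p" using that by simp
    also have "\<dots> \<le> st * m" using that by (intro mult_le_mono2) auto
    finally show ?thesis using M by simp
  qed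
  show "(\<Sum>p<M div (2 * st). z' (q + 2 * st * p) * ?w ^ (2 * st * p * k)) = X (q + 2 * st * k)"
  proof (cases "q < st")
    case True
    have one: "?w ^ (st * m * (2 * k)) = 1"
    proof -
      have "?w ^ (st * m * (2 * k)) = (?w ^ M) ^ k" using M by (simp add: mult_ac flip: power_mult)
      thus ?thesis using unit_root_power_self[of M] M by simp
    qed
    have "(\<Sum>p<m. z' (q + 2 * st * p) * ?w ^ (2 * st * p * k)) =
      (\<Sum>p<m. z (q + st * p) * ?w ^ (st * p * (2 * k)) + z (q + st * (p + m)) * ?w ^ (st * (p + m) * (2 * k)))"
    proof (rule sum.cong[OF refl])
      fix p assume p: "p \<in> {..<m}"
      have "z' (q + 2 * st * p) = z (q + st * p) + z (q + st * (p + m))"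
        using z'(1)[OF bnd[of q p]] True p M fft_pos[OF True, of p] by (simp add: algebra_simps)
      moreover have "?w ^ (st * (p + m) * (2 * k)) = ?w ^ (st * p * (2 * k))"
        using one by (simp add: distrib_left distrib_right power_add)
      moreover have "2 * st * p * k = st * p * (2 * k)" by simp
      ultimately show "z' (q + 2 * st * p) * ?w ^ (2 * st * p * k) =
        z (q + st * p) * ?w ^ (st * p * (2 * k)) + z (q + st * (p + m)) * ?w ^ (st * (p + m) * (2 * k))"
        by (simp only: distrib_right)
    qed
    also have "\<dots> = X (q + st * (2 * k))" by (rule ih) (use True k Mm in auto)
    finally show ?thesis unfolding Mm by (simp add: mult_ac)
  next
    case False
    define r where "r = q - st"
    have r: "r < st" "q = r + st" using q False by (auto simp: r_def)
    have minus: "?w ^ (st * m * (2 * k + 1)) = -1"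
    proof -
      have "?w ^ (st * m * (2 * k + 1)) = (?w ^ h) ^ (2 * k + 1)" using M by (simp only: power_mult)
      thus ?thesis using unit_root_power_half[OF M(1) pos(2)] by simp
    qed
    have "(\<Sum>p<m. z' (q + 2 * st * p) * ?w ^ (2 * st * p * k)) =
      (\<Sum>p<m. z (r + st * p) * ?w ^ (st * p * (2 * k + 1)) +
         z (r + st * (p + m)) * ?w ^ (st * (p + m) * (2 * k + 1)))"
    proof (rule sum.cong[OF refl])
      fix p assume p: "p \<in> {..<m}"
      have "(r + st * p) - (r + st * p) mod st = st * p" using r by simp
      hence e1: "z' (q + 2 * st * p) = (z (r + st * p) - z (r + st * (p + m))) * ?w ^ (st * p)"
        using z'(2)[OF bnd[of r p]] r p M fft_pos[OF r(1), of p] by (simp add: algebra_simps)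
      have "st * (p + m) * (2 * k + 1) = st * p * (2 * k + 1) + st * m * (2 * k + 1)"
        by (simp add: algebra_simps)
      hence e2: "?w ^ (st * (p + m) * (2 * k + 1)) = - (?w ^ (st * p * (2 * k + 1)))"
        using minus by (simp only: power_add) simp
      have e3: "?w ^ (st * p) * ?w ^ (2 * st * p * k) = ?w ^ (st * p * (2 * k + 1))"
        by (simp add: algebra_simps flip: power_add)
      show "z' (q + 2 * st * p) * ?w ^ (2 * st * p * k) =
        z (r + st * p) * ?w ^ (st * p * (2 * k + 1)) +
        z (r + st * (p + m)) * ?w ^ (st * (p + m) * (2 * k + 1))"
        by (rule butterfly[OF e1 e2 e3])
    qed
    also have "\<dots> = X (r + st * (2 * k + 1))" by (rule ih) (use r k Mm in auto)
    finally show ?thesis unfolding Mm using r by (simp add: algebra_simps)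
  qed
qed

text \<open>Orthogonality of characters. The exponent \<open>a\<close> will be the sum of two
  indices below \<open>M\<close>, hence the range up to \<open>2 * M\<close> and the wraparound case
  \<open>a = j + M\<close>.\<close>

lemma sum_unit_root:
  assumes M: "M > 0" and ab: "a < 2 * M" "j < M"
  shows "(\<Sum>i<M. unit_root M ^ (i * a) * cnj (unit_root M ^ (i * j))) =
    (if a = j \<or> a = j + M then of_nat M else 0)"
proof -
  define \<zeta> where "\<zeta> = cis (2 * pi * (real a - real j) / real M)"
  have "unit_root M ^ (i * a) * cnj (unit_root M ^ (i * j)) = \<zeta> ^ i" for i
  proof -
    have "unit_root M ^ (i * a) * cnj (unit_root M ^ (i * j)) =
      cis (2 * pi * real (i * a) / real M - 2 * pi * real (i * j) / real M)"
      by (simp add: unit_root_power cis_cnj cis_mult)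
    also have "2 * pi * real (i * a) / real M - 2 * pi * real (i * j) / real M =
      real i * (2 * pi * (real a - real j) / real M)"
      by (simp add: diff_divide_distrib algebra_simps)
    finally show ?thesis by (simp only: \<zeta>_def Complex.DeMoivre)
  qed
  hence eq: "(\<Sum>i<M. unit_root M ^ (i * a) * cnj (unit_root M ^ (i * j))) = (\<Sum>i<M. \<zeta> ^ i)" by simp
  show ?thesis
  proof (cases "a = j \<or> a = j + M")
    case True
    hence "\<zeta> = 1" using M by (auto simp: \<zeta>_def)
    thus ?thesis using True eq by simp
  next
    case False
    have "\<zeta> ^ M = cis (2 * pi * of_int (int a - int j))"
      using M by (simp add: \<zeta>_def Complex.DeMoivre)
    also have "\<dots> = 1" by (rule cis_multiple_2pi) (rule Ints_of_int)
    finally have \<zeta>M: "\<zeta> ^ M = 1" .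
    have "\<zeta> \<noteq> 1"
    proof
      assume "\<zeta> = 1"
      hence "cos (2 * pi * (real a - real j) / real M) = 1"
        by (metis \<zeta>_def cis.simps(1) one_complex.simps(1))
      then obtain n :: int where "2 * pi * (real a - real j) / real M = of_int n * 2 * pi"
        by (auto simp: cos_one_2pi_int)
      hence "(2 * pi) * (real a - real j) = (2 * pi) * (of_int n * real M)" using M by (simp add: field_simps)
      hence "real a - real j = of_int n * real M" by (subst (asm) mult_cancel_left) auto
      hence n: "int a - int j = n * int M"
        by (metis of_int_diff of_int_eq_iff of_int_mult of_int_of_nat_eq)
      have "n * int M < 2 * int M" "n * int M > (-1) * int M" using n ab by linarith+
      hence "n < 2" using M by (simp add: mult_less_cancel_right)
      moreover have "n > -1"
      proof (rule ccontr)
        assume "\<not> n > -1"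
        hence "n * int M \<le> (-1) * int M" by (intro mult_right_mono) auto
        thus False using \<open>n * int M > (-1) * int M\<close> by linarith
      qed
      ultimately have "n < 2" "n > -1" .
      hence "n = 0 \<or> n = 1" by auto
      thus False using n False by auto
    qed
    thus ?thesis using False eq \<zeta>M by (simp add: sum_gp_strict)
  qed
qed

text \<open>Conjugation turns the transform into its inverse up to the factor \<open>M\<close>, so
  one program serves both directions. Since \<open>z\<close> vanishes beyond \<open>N\<close> and
  \<open>2 * N < M\<close>, no pair of indices wraps around and the cyclic convolution is the
  ordinary one.\<close>

lemma dft_inverse_square:
  fixes z :: "nat \<Rightarrow> complex"
  assumes M: "2 * N < M" and z: "\<And>i. i > N \<Longrightarrow> i < M \<Longrightarrow> z i = 0" and j: "j \<le> N"
  shows "cnj (dft M (\<lambda>i. cnj (dft M z i ^ 2)) j) = of_nat M * (\<Sum>i\<le>j. z i * z (j - i))"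
proof -
  let ?w = "unit_root M"
  have M0: "M > 0" "j < M" using assms by auto
  have sq: "dft M z i ^ 2 = (\<Sum>a<M. \<Sum>b<M. z a * z b * ?w ^ (i * (a + b)))" for i
    unfolding dft_def power2_eq_square sum_product
    by (intro sum.cong refl) (simp add: algebra_simps power_add)
  have "cnj (dft M (\<lambda>i. cnj (dft M z i ^ 2)) j) = (\<Sum>i<M. (dft M z i ^ 2) * cnj (?w ^ (i * j)))"
    unfolding dft_def[of M "\<lambda>i. cnj (dft M z i ^ 2)"] by simp
  also have "\<dots> = (\<Sum>i<M. \<Sum>a<M. \<Sum>b<M. z a * z b * (?w ^ (i * (a + b)) * cnj (?w ^ (i * j))))"
    unfolding sq sum_distrib_right by (simp add: mult.assoc)
  also have "\<dots> = (\<Sum>a<M. \<Sum>b<M. \<Sum>i<M. z a * z b * (?w ^ (i * (a + b)) * cnj (?w ^ (i * j))))"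
    by (subst sum.swap) (intro sum.cong refl sum.swap)
  also have "\<dots> = (\<Sum>a<M. \<Sum>b<M. if a \<le> j \<and> b = j - a then of_nat M * (z a * z b) else 0)"
  proof (intro sum.cong refl)
    fix a b assume ab: "a \<in> {..<M}" "b \<in> {..<M}"
    have "(\<Sum>i<M. z a * z b * (?w ^ (i * (a + b)) * cnj (?w ^ (i * j)))) =
       z a * z b * (if a + b = j \<or> a + b = j + M then of_nat M else 0)"
      unfolding sum_distrib_left[symmetric] using ab M0 by (subst sum_unit_root) auto
    also have "\<dots> = (if a \<le> j \<and> b = j - a then of_nat M * (z a * z b) else 0)"
    proof (cases "a \<le> N \<and> b \<le> N")
      case True
      hence "a + b \<noteq> j + M" using M by auto
      thus ?thesis by auto
    next
      case False
      hence "z a * z b = 0" using z ab by auto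
      thus ?thesis by auto
    qed
    finally show "(\<Sum>i<M. z a * z b * (?w ^ (i * (a + b)) * cnj (?w ^ (i * j)))) = \<dots>" .
  qed
  also have "\<dots> = (\<Sum>a<M. if a \<le> j then of_nat M * (z a * z (j - a)) else 0)"
  proof (intro sum.cong refl)
    fix a assume a: "a \<in> {..<M}"
    have "j - a < M" using M0 by simp
    thus "(\<Sum>b<M. if a \<le> j \<and> b = j - a then of_nat M * (z a * z b) else 0) =
      (if a \<le> j then of_nat M * (z a * z (j - a)) else 0)"
      by (cases "a \<le> j") (auto simp: sum.delta)
  qed
  also have "\<dots> = (\<Sum>a\<in>{a\<in>{..<M}. a \<le> j}. of_nat M * (z a * z (j - a)))"
    by (rule sum.inter_filter[symmetric]) simp
  also have "{a\<in>{..<M}. a \<le> j} = {..j}" using M0 by auto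
  finally show ?thesis by (simp add: sum_distrib_left)
qed

text \<open>
  With \<open>a\<close> and \<open>b\<close> as real and imaginary parts, the imaginary part of the square is twice the
  product, so that two transforms suffice for a convolution.
\<close>

lemma dft_product:
  fixes a b :: "nat \<Rightarrow> real"
  assumes M: "2 * N < M" and z: "\<And>i. i > N \<Longrightarrow> i < M \<Longrightarrow> a i = 0 \<and> b i = 0" and j: "j \<le> N"
  shows "- Im (dft M (\<lambda>i. cnj (dft M (\<lambda>i. Complex (a i) (b i)) i ^ 2)) j) / (2 * real M) =
           (\<Sum>i\<le>j. a i * b (j - i))"
proof -
  let ?z = "\<lambda>i. Complex (a i) (b i)"
  let ?Y = "dft M (\<lambda>i. cnj (dft M ?z i ^ 2)) j"
  have "cnj ?Y = of_nat M * (\<Sum>i\<le>j. ?z i * ?z (j - i))"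
    by (rule dft_inverse_square[OF M _ j]) (use z in \<open>auto simp: complex_eq_iff\<close>)
  hence "- Im ?Y = Im (of_nat M * (\<Sum>i\<le>j. ?z i * ?z (j - i)))"
    by (metis cnj.simps(2))
  also have "\<dots> = real M * ((\<Sum>i\<le>j. a i * b (j - i)) + (\<Sum>i\<le>j. b i * a (j - i)))"
    by (simp add: Im_sum sum.distrib)
  also have "(\<Sum>i\<le>j. b i * a (j - i)) = (\<Sum>i\<le>j. a i * b (j - i))"
    by (rule sum.reindex_bij_witness[of _ "\<lambda>i. j - i" "\<lambda>i. j - i"]) auto
  finally show ?thesis using M by (simp add: field_simps)
qed


section \<open>The Fourier transform program\<close>

abbreviation iadd :: "iexp \<Rightarrow> iexp \<Rightarrow> iexp" where "iadd \<equiv> IOp IAdd"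
abbreviation isub :: "iexp \<Rightarrow> iexp \<Rightarrow> iexp" where "isub \<equiv> IOp ISub"
abbreviation imul :: "iexp \<Rightarrow> iexp \<Rightarrow> iexp" where "imul \<equiv> IOp IMul"
abbreviation idiv :: "iexp \<Rightarrow> iexp \<Rightarrow> iexp" where "idiv \<equiv> IOp IDiv"
abbreviation imod :: "iexp \<Rightarrow> iexp \<Rightarrow> iexp" where "imod \<equiv> IOp IMod"
abbreviation radd :: "rexp \<Rightarrow> rexp \<Rightarrow> rexp" where "radd \<equiv> ROp RAdd"
abbreviation rsub :: "rexp \<Rightarrow> rexp \<Rightarrow> rexp" where "rsub \<equiv> ROp RSub"
abbreviation rmul :: "rexp \<Rightarrow> rexp \<Rightarrow> rexp" where "rmul \<equiv> ROp RMul"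
abbreviation rdiv :: "rexp \<Rightarrow> rexp \<Rightarrow> rexp" where "rdiv \<equiv> ROp RDiv"

text \<open>
  Memory layout.  Integer array 0 lists the primes.  Integer variables: 1 the number \<open>N\<close> of primes,
  2 the candidate prime, 3 a flag, 4 and 7 loop indices, 5 the length \<open>M\<close> of the transform, 6 its
  stride, 8 the row, 9 \<open>M / 2\<close>, 10 a target position, 11 the cutoff.

  Real arrays: 4 the \<open>c\<^sub>n\<close>, 5 the numbers \<open>(-1)\<^sup>j / (j + 1)!\<close>, 6 and 7 the real and imaginary parts of
  the vector to be transformed, 8 and 9 those of the result of one stage, 10 the current row, 11 a
  power of \<open>log p\<close>, 12 to 14 temporaries, 15 the product and 17 the sum in \<open>E(x, y)\<close>, 16 the factor
  \<open>(log x)\<^sup>-\<^sup>n / (N - n)!\<close>.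
\<close>

definition butterfly_prog :: com where
  "butterfly_prog =
    Seq (iset 10 (isub (iadd (IV 7) (IV 7)) (imod (IV 7) (IV 6))))
   (Seq (rset 12 (rsub (RGet 6 (IV 7)) (RGet 6 (iadd (IV 7) (IV 9)))))
   (Seq (rset 13 (rsub (RGet 7 (IV 7)) (RGet 7 (iadd (IV 7) (IV 9)))))
   (Seq (rset 14 (rdiv (rmul (OfInt (isub (IV 7) (imod (IV 7) (IV 6))))
                             (rmul (OfInt (IConst 8)) (RFun Arctan (OfInt (IConst 1))))) (OfInt (IV 5))))
   (Seq (RSet 8 (IV 10) (radd (RGet 6 (IV 7)) (RGet 6 (iadd (IV 7) (IV 9)))))
   (Seq (RSet 9 (IV 10) (radd (RGet 7 (IV 7)) (RGet 7 (iadd (IV 7) (IV 9)))))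
   (Seq (RSet 8 (iadd (IV 10) (IV 6)) (rsub (rmul (RV 12) (RFun Cos (RV 14))) (rmul (RV 13) (RFun Sin (RV 14)))))
        (RSet 9 (iadd (IV 10) (IV 6)) (radd (rmul (RV 12) (RFun Sin (RV 14))) (rmul (RV 13) (RFun Cos (RV 14)))))))))))"

definition copy_prog :: com where
  "copy_prog = Seq (RSet 6 (IV 7) (RGet 8 (IV 7))) (RSet 7 (IV 7) (RGet 9 (IV 7)))"

definition fft_prog :: com where
  "fft_prog = Seq (iset 6 (IConst 1))
    (While (BNot (ILe (IV 5) (IV 6)))
      (Seq (For 7 (IV 9) butterfly_prog)
      (Seq (For 7 (IV 5) copy_prog)
           (iset 6 (iadd (IV 6) (IV 6))))))"

definition vecA :: "memory \<Rightarrow> nat \<Rightarrow> complex" where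
  "vecA s j = Complex (reals s 6 (int j)) (reals s 7 (int j))"

definition vecB :: "memory \<Rightarrow> nat \<Rightarrow> complex" where
  "vecB s j = Complex (reals s 8 (int j)) (reals s 9 (int j))"

lemma fft_pos_alt: "fft_pos st i = i mod st + st * (2 * (i div st))"
proof -
  have "i = i mod st + st * (i div st)" by simp
  thus ?thesis unfolding fft_pos_def by (metis add_diff_cancel_left' add.commute add.assoc mult_2 mult.left_commute)
qed

text \<open>Divided by \<open>st\<close>, the targets of sums are even and those of differences odd,
  and quotient and remainder determine \<open>i\<close>; so later butterflies do not overwrite the
  results of earlier ones.\<close>

lemma fft_pos_distinct:
  assumes "st > 0" "i \<noteq> k"
  shows "fft_pos st i \<noteq> fft_pos st k" "fft_pos st i + st \<noteq> fft_pos st k" "fft_pos st i \<noteq> fft_pos st k + st"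
proof -
  have d: "fft_pos st i div st = 2 * (i div st)" "(fft_pos st i + st) div st = 2 * (i div st) + 1"
    and m: "fft_pos st i mod st = i mod st" for i
    using assms unfolding fft_pos_alt by auto
  show "fft_pos st i \<noteq> fft_pos st k"
  proof
    assume "fft_pos st i = fft_pos st k"
    hence "i div st = k div st" "i mod st = k mod st" using d(1)[of i] d(1)[of k] m[of i] m[of k] by auto
    thus False using assms(2) by (metis div_mult_mod_eq)
  qed
  show "fft_pos st i + st \<noteq> fft_pos st k" using d(2)[of i] d(1)[of k] by (metis even_mult_iff even_add even_numeral odd_one)
  show "fft_pos st i \<noteq> fft_pos st k + st" using d(1)[of i] d(2)[of k] by (metis even_mult_iff even_add even_numeral odd_one)
qed

lemma fft_pos_less:
  assumes "h = st * m" "i < h"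
  shows "fft_pos st i + st < 2 * h + (if st = 0 then 1 else 0)" "fft_pos st i < 2 * h"
proof -
  have st: "st > 0" using assms by (cases st) auto
  have "i div st < m" using assms st by (simp add: div_less_iff_less_mult mult.commute)
  hence "st * (2 * (i div st) + 2) \<le> st * (2 * m)" by (intro mult_le_mono2) auto
  moreover have "i mod st < st" using st by simp
  ultimately show "fft_pos st i + st < 2 * h + (if st = 0 then 1 else 0)" "fft_pos st i < 2 * h"
    unfolding fft_pos_alt assms(1) by (auto simp: algebra_simps)
qed

lemma runs_butterflies:
  assumes v: "ints s 5 0 = int M" "ints s 9 0 = int h" "ints s 6 0 = int st"
    and M: "M = 2 * h" "h = st * m" "M > 0" "M \<le> S"
  shows "runs S (For 7 (IV 9) butterfly_prog) s (h * 160 + 20) (\<lambda>s'.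
      same {7,10} {8,9,12,13,14} s s' \<and>
      (\<forall>i<h. vecB s' (fft_pos st i) = vecA s i + vecA s (i + h) \<and>
             vecB s' (fft_pos st i + st) = (vecA s i - vecA s (i + h)) * unit_root M ^ (i - i mod st)))"
proof (rule runs_For[where n = h and B = 130 and J = "\<lambda>k s'.
      same {7,10} {8,9,12,13,14} s s' \<and>
      (\<forall>i<k. vecB s' (fft_pos st i) = vecA s i + vecA s (i + h) \<and>
             vecB s' (fft_pos st i + st) = (vecA s i - vecA s (i + h)) * unit_root M ^ (i - i mod st))"])
  fix k s'
  assume k: "k < h" and J: "same {7,10} {8,9,12,13,14} s s' \<and>
      (\<forall>i<k. vecB s' (fft_pos st i) = vecA s i + vecA s (i + h) \<and>
             vecB s' (fft_pos st i + st) = (vecA s i - vecA s (i + h)) * unit_root M ^ (i - i mod st))"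
    and i7: "ints s' 7 0 = int k"
  have sm: "same {7,10} {8,9,12,13,14} s s'" using J by simp
  have v': "ints s' 5 0 = int M" "ints s' 9 0 = int h" "ints s' 6 0 = int st"
    using v same_ints[OF sm] by auto
  have r': "reals s' 6 = reals s 6" "reals s' 7 = reals s 7" using same_reals[OF sm] by auto
  have st: "st > 0" using k M by (cases st) auto
  define p where "p = fft_pos st k"
  have p: "int k + int k - int k mod int st = int p"
  proof -
    have "k mod st \<le> 2 * k" using mod_less_eq_dividend[of k st] by linarith
    thus ?thesis by (simp add: p_def fft_pos_def of_nat_diff zmod_int)
  qed
  have pl: "p + st < M" "p < M" using fft_pos_less[OF M(2) k] M st by (auto simp: p_def)
  have neq: "fft_pos st i \<noteq> p" "fft_pos st i + st \<noteq> p" "fft_pos st i \<noteq> p + st" if "i < k" for i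
    using fft_pos_distinct[OF st, of i k] that by (auto simp: p_def)
  \<comment> \<open>\<open>8 * (pi / 4)\<close> is the program's \<open>8 * arctan 1\<close>, an
    exact \<open>2 * pi\<close>.\<close>
  define ang where "ang = real_of_int (int k - int k mod int st) * (8 * (pi / 4)) / real M"
  have ang: "ang = 2 * pi * real (k - k mod st) / real M"
    by (simp add: ang_def of_nat_diff flip: of_nat_mod)
  have p2: "2 * int k - int k mod int st = int p" using p by simp
  have ang2: "(real k - real_of_int (int k mod int st)) * (2 * pi) / real M = ang" by (simp add: ang_def)
  have ur: "unit_root M ^ (k - k mod st) = cis ang"
    unfolding ang by (rule unit_root_power)
  have bd: "k < S" "int k + int h < int S" "p < S" "int p + int st < int S" "M \<noteq> 0" "st \<noteq> 0" "S > 0"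
    using k M(1,3,4) pl st by auto
  let ?t1 = "reals s 6 (int k) - reals s 6 (int k + int h)"
  let ?t2 = "reals s 7 (int k) - reals s 7 (int k + int h)"
  let ?s2 = "set_real 9 (int p + int st) (?t1 * sin ang + ?t2 * cos ang)
    (set_real 8 (int p + int st) (?t1 * cos ang - ?t2 * sin ang)
    (set_real 9 (int p) (reals s 7 (int k) + reals s 7 (int k + int h))
    (set_real 8 (int p) (reals s 6 (int k) + reals s 6 (int k + int h))
    (set_real 14 0 ang (set_real 13 0 ?t2 (set_real 12 0 ?t1 (set_int 10 0 (int p) s')))))))"
  have final: "same {7,10} {8,9,12,13,14} s (set_int 7 0 (int k + 1) ?s2) \<and>
      (\<forall>i<Suc k. vecB (set_int 7 0 (int k + 1) ?s2) (fft_pos st i) = vecA s i + vecA s (i + h) \<and>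
             vecB (set_int 7 0 (int k + 1) ?s2) (fft_pos st i + st) = (vecA s i - vecA s (i + h)) * unit_root M ^ (i - i mod st))"
  proof (intro conjI allI impI)
    show "same {7,10} {8,9,12,13,14} s (set_int 7 0 (int k + 1) ?s2)"
      by (intro same_set_int same_set_real sm) auto
    fix i assume i: "i < Suc k"
    have a: "vecB (set_int 7 0 (int k + 1) ?s2) (fft_pos st i) = vecA s i + vecA s (i + h) \<and>
      vecB (set_int 7 0 (int k + 1) ?s2) (fft_pos st i + st) = (vecA s i - vecA s (i + h)) * unit_root M ^ (i - i mod st)"
    proof (cases "i = k")
      case True
      thus ?thesis using st
        by (simp add: vecB_def vecA_def p_def[symmetric] ur complex_eq_iff)
    next
      case False
      hence ik: "i < k" using i by simp
      have n: "int (fft_pos st i) \<noteq> int p" "int (fft_pos st i) + int st \<noteq> int p"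
        "int (fft_pos st i) \<noteq> int p + int st" using neq[OF ik] by linarith+
      have "vecB (set_int 7 0 (int k + 1) ?s2) (fft_pos st i) = vecB s' (fft_pos st i)"
        "vecB (set_int 7 0 (int k + 1) ?s2) (fft_pos st i + st) = vecB s' (fft_pos st i + st)"
        using n by (simp_all add: vecB_def)
      thus ?thesis using J ik by simp
    qed
    show "vecB (set_int 7 0 (int k + 1) ?s2) (fft_pos st i) = vecA s i + vecA s (i + h)" using a by blast
    show "vecB (set_int 7 0 (int k + 1) ?s2) (fft_pos st i + st) = (vecA s i - vecA s (i + h)) * unit_root M ^ (i - i mod st)"
      using a by blast
  qed
  show "runs S butterfly_prog s' 130 (\<lambda>s''. ints s'' 7 0 = int k \<and>
      same {7,10} {8,9,12,13,14} s (set_int 7 0 (int k + 1) s'') \<and>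
      (\<forall>i<Suc k. vecB (set_int 7 0 (int k + 1) s'') (fft_pos st i) = vecA s i + vecA s (i + h) \<and>
             vecB (set_int 7 0 (int k + 1) s'') (fft_pos st i + st) = (vecA s i - vecA s (i + h)) * unit_root M ^ (i - i mod st)))"
    unfolding butterfly_prog_def
    using final by (simp add: runs_simps i7 v' r' p2 bd ang2)
next
  fix k s' assume "same {7,10} {8,9,12,13,14} s s' \<and>
      (\<forall>i<k. vecB s' (fft_pos st i) = vecA s i + vecA s (i + h) \<and>
             vecB s' (fft_pos st i + st) = (vecA s i - vecA s (i + h)) * unit_root M ^ (i - i mod st))"
  hence "same {7,10} {8,9,12,13,14} s s'" by simp
  thus "iok S s' (IV 9) \<and> ival s' (IV 9) = int h" using v M(3,4) same_ints[of "{7,10}" _ s s' 9] by auto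
qed (use M(3,4) in \<open>auto intro: same_set_int\<close>)

lemma runs_copy:
  assumes v: "ints s 5 0 = int M" and M: "M \<le> S" "M > 0"
  shows "runs S (For 7 (IV 5) copy_prog) s (M * 50 + 20) (\<lambda>s'.
      same {7} {6,7} s s' \<and> (\<forall>i<M. vecA s' i = vecB s i))"
proof -
  let ?J = "\<lambda>k s'. same {7} {6,7} s s' \<and> (\<forall>i<k. vecA s' i = vecB s i)"
  show ?thesis
  proof (rule runs_For[where n = M and B = 30 and J = ?J])
    fix k s' assume k: "k < M" and J: "?J k s'" and i7: "ints s' 7 0 = int k"
    have r: "reals s' 8 = reals s 8" "reals s' 9 = reals s 9" using same_reals[of "{7}" "{6,7}" s s'] J by auto
    let ?s2 = "set_int 7 0 (int k + 1) (set_real 7 (int k) (reals s 9 (int k)) (set_real 6 (int k) (reals s 8 (int k)) s'))"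
    have "same {7} {6,7} s ?s2" using J by (intro same_set_int same_set_real) auto
    moreover have "\<forall>i<Suc k. vecA ?s2 i = vecB s i"
      using J by (auto simp: vecA_def vecB_def less_Suc_eq)
    ultimately show "runs S copy_prog s' 30 (\<lambda>s''. ints s'' 7 0 = int k \<and>
       ?J (Suc k) (set_int 7 0 (int k + 1) s''))"
      unfolding copy_prog_def using k M by (simp add: runs_simps i7 r)
  next
    fix k s' assume "?J k s'"
    thus "iok S s' (IV 5) \<and> ival s' (IV 5) = int M" using v M same_ints[of "{7}" "{6,7}" s s' 5] by auto
  qed (use M in \<open>auto intro: same_set_int\<close>)
qed

text \<open>After \<open>k\<close> stages the stride is \<open>2 ^ k\<close>; at stride
  \<open>M\<close> every residue class has one entry, which is its own transform. So there are
  \<open>K\<close> stages, each of cost linear in \<open>M\<close>.\<close>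

lemma runs_fft:
  assumes v: "ints s 5 0 = int M" "ints s 9 0 = int h"
    and M: "M = 2 * h" "M = 2 ^ K" "M \<le> S"
  shows "runs S fft_prog s ((K + 1) * (M * 200)) (\<lambda>s'.
      same {6,7,10} {6,7,8,9,12,13,14} s s' \<and> (\<forall>j<M. vecA s' j = dft M (vecA s) j))"
proof -
  have M0: "M > 0" by (simp add: M(2))
  define I where "I k s' \<longleftrightarrow> same {6,7,10} {6,7,8,9,12,13,14} s s' \<and> ints s' 6 0 = 2 ^ k \<and>
      fft_inv M (2 ^ k) (dft M (vecA s)) (vecA s')" for k s'
  let ?body = "Seq (For 7 (IV 9) butterfly_prog) (Seq (For 7 (IV 5) copy_prog) (iset 6 (iadd (IV 6) (IV 6))))"
  have step: "runs S ?body s' (M * 130 + 60) (I (Suc k))" if k: "k < K" and I: "I k s'" for k s'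
  proof -
    define st where "st = (2 :: nat) ^ k"
    have sm: "same {6,7,10} {6,7,8,9,12,13,14} s s'" using I by (simp add: I_def)
    have v': "ints s' 5 0 = int M" "ints s' 9 0 = int h" "ints s' 6 0 = int st"
      using v same_ints[OF sm] I by (auto simp: I_def st_def)
    obtain e where e: "K = Suc (k + e)" using less_imp_Suc_add[OF k] by blast
    have h: "h = st * 2 ^ e" using M by (simp add: e st_def power_add)
    show ?thesis
    proof (rule runs_Seq[OF runs_butterflies[OF v' M(1) h M0 M(3)]])
      fix s1 assume B: "same {7,10} {8,9,12,13,14} s' s1 \<and>
      (\<forall>i<h. vecB s1 (fft_pos st i) = vecA s' i + vecA s' (i + h) \<and>
             vecB s1 (fft_pos st i + st) = (vecA s' i - vecA s' (i + h)) * unit_root M ^ (i - i mod st))"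
      have v1: "ints s1 5 0 = int M" "ints s1 6 0 = int st"
        using v' same_ints[of "{7,10}" "{8,9,12,13,14}" s' s1] B by auto
      show "runs S (Seq (For 7 (IV 5) copy_prog) (iset 6 (iadd (IV 6) (IV 6)))) s1 (M * 50 + 30) (I (Suc k))"
      proof (rule runs_Seq[OF runs_copy[OF v1(1) M(3) M0]])
        fix s2 assume C: "same {7} {6,7} s1 s2 \<and> (\<forall>i<M. vecA s2 i = vecB s1 i)"
        have v2: "ints s2 6 0 = int st" using v1 same_ints[of "{7}" "{6,7}" s1 s2] C by auto
        have "same {6,7,10} {6,7,8,9,12,13,14} s' s2"
          using B C by (elim conjE) (rule same_trans[of "{7,10}" "{8,9,12,13,14}" _ s1 "{7}" "{6,7}"]; auto)
        hence "same {6,7,10} {6,7,8,9,12,13,14} s s2"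
          by (rule same_trans[OF sm]) auto
        hence s3: "same {6,7,10} {6,7,8,9,12,13,14} s (set_int 6 0 (int (2 * st)) s2)"
          by (rule same_set_int) auto
        have "fft_inv M (2 * st) (dft M (vecA s)) (vecA s2)"
        proof (rule fft_inv_step[OF M(1) h M0])
          show "fft_inv M st (dft M (vecA s)) (vecA s')" using I by (simp add: I_def st_def)
          fix i assume i: "i < h"
          have st0: "st > 0" by (simp add: st_def)
          have "fft_pos st i < M" "fft_pos st i + st < M" using fft_pos_less[OF h i] M st0 by auto
          thus "vecA s2 (fft_pos st i) = vecA s' i + vecA s' (i + h)"
            "vecA s2 (fft_pos st i + st) = (vecA s' i - vecA s' (i + h)) * unit_root M ^ (i - i mod st)"
            using B C i by auto
        qed
        moreover have "vecA (set_int 6 0 (int (2 * st)) s2) = vecA s2"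
          by (simp add: vecA_def fun_eq_iff)
        ultimately have "I (Suc k) (set_int 6 0 (int (2 * st)) s2)"
          using s3 by (simp add: I_def st_def)
        moreover have "int st + int st = int (2 * st)" by simp
        ultimately show "runs S (iset 6 (iadd (IV 6) (IV 6))) s2 10 (I (Suc k))"
          using M M0 by (simp add: runs_simps v2)
      qed simp
    qed (use M in simp)
  qed
  have "runs S (While (BNot (ILe (IV 5) (IV 6))) ?body) (set_int 6 0 1 s)
     (K * ((M * 130 + 60) + bcost (BNot (ILe (IV 5) (IV 6))) + 1) + bcost (BNot (ILe (IV 5) (IV 6))) + 1)
     (\<lambda>s'. same {6,7,10} {6,7,8,9,12,13,14} s s' \<and> (\<forall>j<M. vecA s' j = dft M (vecA s) j))"
  proof (rule runs_While[where I = I, OF _ _ _ order_refl])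
    fix k s' assume k: "k < K" and I: "I k s'"
    have "(2::nat) ^ k < 2 ^ K" using k by (intro power_strict_increasing) auto
    hence "(2::int) ^ k < int M" using M(2) by (metis of_nat_less_iff of_nat_numeral of_nat_power)
    moreover have "ints s' 5 0 = int M" using I v by (auto simp: I_def same_def)
    ultimately show "bok S s' (BNot (ILe (IV 5) (IV 6))) \<and> bval s' (BNot (ILe (IV 5) (IV 6))) \<and>
      runs S ?body s' (M * 130 + 60) (I (Suc k))"
      using step[OF k I] I M M0 by (simp add: I_def)
  next
    fix s' assume I: "I K s'"
    have hM: "int M = 2 ^ K" by (simp add: M(2))
    have "ints s' 5 0 = int M" using I v by (auto simp: I_def same_def)
    thus "bok S s' (BNot (ILe (IV 5) (IV 6))) \<and> \<not> bval s' (BNot (ILe (IV 5) (IV 6)))"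
      using I M M0 hM by (simp add: I_def)
    show "same {6,7,10} {6,7,8,9,12,13,14} s s' \<and> (\<forall>j<M. vecA s' j = dft M (vecA s) j)"
      using I fft_inv_final[OF M0, of "dft M (vecA s)" "vecA s'"] M(2) by (simp add: I_def)
  next
    have "vecA (set_int 6 0 1 s) = vecA s" by (simp add: vecA_def fun_eq_iff)
    thus "I 0 (set_int 6 0 1 s)"
      using fft_inv_init[OF M0] by (auto simp: I_def intro: same_set_int)
  qed
  moreover have "3 + (K * ((M * 130 + 60) + bcost (BNot (ILe (IV 5) (IV 6))) + 1) + bcost (BNot (ILe (IV 5) (IV 6))) + 1)
     \<le> (K + 1) * (M * 200)"
  proof -
    have "K * ((M * 130 + 60) + 6 + 1) \<le> K * (M * 200)" using M0 by (intro mult_le_mono2) linarith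
    moreover have "bcost (BNot (ILe (IV 5) (IV 6))) = 6" by simp
    ultimately show ?thesis using M0 by (simp only: distrib_right)
  qed
  ultimately show ?thesis
    unfolding fft_prog_def using M M0
    by (intro runs_Seq[where R = "\<lambda>s'. s' = set_int 6 0 1 s" and ?T1.0 = 3]) (auto simp: runs_ISet)
qed


section \<open>Listing the primes\<close>

lemma prime_pi_mono: "y \<le> z \<Longrightarrow> prime_pi y \<le> prime_pi z"
  unfolding prime_pi_def by (intro card_mono finite_primes_upto) (auto simp: primes_upto_def)

lemma prime_pi_Suc: "prime_pi (real (Suc m)) = prime_pi (real m) + (if prime (Suc m) then 1 else 0)"
proof -
  have "primes_upto (real (Suc m)) = (if prime (Suc m) then insert (Suc m) (primes_upto (real m)) else primes_upto (real m))"
  proof (cases "prime (Suc m)")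
    case True
    thus ?thesis by (auto simp: primes_upto_def)
  next
    case False
    have "p \<le> m" if "prime p" "p \<le> Suc m" for p using that False le_SucE by blast
    thus ?thesis using False by (auto simp: primes_upto_def simp flip: of_nat_Suc)
  qed
  moreover have "Suc m \<notin> primes_upto (real m)" by (simp add: primes_upto_def)
  ultimately show ?thesis by (simp add: prime_pi_def)
qed

lemma pr_prime_pi:
  assumes "prime (Suc m)"
  shows "pr (prime_pi (real m)) = Suc m"
proof -
  obtain i where i: "Suc m = pr i" using prime_imp_pr[OF assms] by blast
  have "i < prime_pi (real (Suc m))" using pr_le_iff_prime_pi[of i "real (Suc m)"] i by simp
  moreover have "\<not> i < prime_pi (real m)" using pr_le_iff_prime_pi[of i "real m"] i[symmetric] by simp
  ultimately have "i = prime_pi (real m)" using prime_pi_Suc[of m] assms by simp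
  thus ?thesis using i by simp
qed

text \<open>Division by the primes already listed decides primality, since a composite number has a
  prime factor smaller than itself.\<close>

lemma prime_iff_no_pr_dvd:
  assumes "m \<ge> 1"
  shows "prime (Suc m) \<longleftrightarrow> \<not> (\<exists>j<prime_pi (real m). pr j dvd Suc m)"
proof
  assume p: "prime (Suc m)"
  show "\<not> (\<exists>j<prime_pi (real m). pr j dvd Suc m)"
  proof safe
    fix j assume j: "j < prime_pi (real m)" "pr j dvd Suc m"
    hence "pr j = Suc m" using p prime_pr primes_dvd_imp_eq by blast
    moreover have "real (pr j) \<le> real m" using j pr_le_iff_prime_pi by blast
    ultimately show False by simp
  qed
next
  assume A: "\<not> (\<exists>j<prime_pi (real m). pr j dvd Suc m)"
  show "prime (Suc m)"
  proof (rule ccontr)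
    assume np: "\<not> prime (Suc m)"
    obtain p where p: "prime p" "p dvd Suc m" using prime_factor_nat[of "Suc m"] assms by auto
    obtain j where j: "p = pr j" using prime_imp_pr p by blast
    have "p \<le> Suc m" using p by (auto dest: dvd_imp_le)
    moreover have "p \<noteq> Suc m" using np p by auto
    ultimately have "real (pr j) \<le> real m" using j by simp
    hence "j < prime_pi (real m)" using pr_le_iff_prime_pi by blast
    thus False using A p j by blast
  qed
qed

definition prime_test_prog :: com where
  "prime_test_prog = Cond (ILe (imod (IV 2) (IGet 0 (IV 4))) (IConst 0)) (iset 3 (IConst 1)) Skip"

definition prime_step_prog :: com where
  "prime_step_prog = Seq (iset 3 (IConst 0)) (Seq (For 4 (IV 1) prime_test_prog)
     (Seq (Cond (ILe (IV 3) (IConst 0)) (Seq (ISet 0 (IV 1) (IV 2)) (iset 1 (iadd (IV 1) (IConst 1)))) Skip)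
          (iset 2 (iadd (IV 2) (IConst 1)))))"

definition prime_prog :: com where
  "prime_prog = Seq (iset 1 (IConst 0)) (Seq (iset 2 (IConst 2))
     (While (RLe (OfInt (IV 2)) (RV 1)) prime_step_prog))"

lemma runs_prime_test:
  assumes v: "ints s 1 0 = int n" "ints s 2 0 = int q" "ints s 3 0 = 0"
    and P: "\<And>j. j < n \<Longrightarrow> ints s 0 (int j) = int (pr j)" and S: "n \<le> S" "S > 0"
  shows "runs S (For 4 (IV 1) prime_test_prog) s (n * 40 + 20) (\<lambda>s'. same {3,4} {} s s' \<and>
    ints s' 3 0 = (if \<exists>j<n. pr j dvd q then 1 else 0))"
proof -
  let ?J = "\<lambda>k s'. same {3,4} {} s s' \<and>
    ints s' 3 0 = (if \<exists>j<k. pr j dvd q then 1 else 0)"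
  show ?thesis
  proof (rule runs_For[where n = n and B = 20 and J = ?J])
    fix k s' assume k: "k < n" and J: "?J k s'"
      and i: "ints s' 4 0 = int k"
    have sm: "same {3,4} {} s s'" using J by simp
    have v': "ints s' 2 0 = int q" "ints s' 0 (int k) = int (pr k)"
      using v P[OF k] same_ints[OF sm] by auto
    have md: "int q mod int (pr k) \<le> 0 \<longleftrightarrow> pr k dvd q"
    proof -
      have "int q mod int (pr k) = int (q mod pr k)" by (simp add: zmod_int)
      thus ?thesis by (simp add: dvd_eq_mod_eq_0)
    qed
    have s3: "same {3,4} {} s (set_int 4 0 (int k + 1) (set_int 3 0 1 s'))" "same {3,4} {} s (set_int 4 0 (int k + 1) s')"
      by (auto intro!: same_set_int sm)
    have ex: "(\<exists>j<Suc k. pr j dvd q) \<longleftrightarrow> pr k dvd q \<or> (\<exists>j<k. pr j dvd q)" by (auto simp: less_Suc_eq)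
    show "runs S prime_test_prog s' 20 (\<lambda>s'. ints s' 4 0 = int k \<and> ?J (Suc k) (set_int 4 0 (int k + 1) s'))"
      unfolding prime_test_prog_def
      using k S s3 J by (simp add: runs_simps i v' md ex)
  next
    fix k s' assume "?J k s'"
    thus "iok S s' (IV 1) \<and> ival s' (IV 1) = int n" using v S same_ints[of "{3,4}" "{}" s s' 1] by auto
  qed (use S v in \<open>auto intro: same_set_int\<close>)
qed

text \<open>Trial division by all smaller primes costs about \<open>y * prime_pi y\<close>, which is
  already of the order \<open>y^2 / ln y\<close>. As the machine has no floor operation, the loop is
  stopped by comparing the candidate with the real number \<open>y\<close>.\<close>

lemma runs_primes:
  assumes y: "y \<ge> 2" "reals s 1 0 = y" and S: "prime_pi y \<le> S" "S > 0"
  shows "runs S prime_prog s (nat \<lfloor>y\<rfloor> * (prime_pi y * 40 + 80) + 80) (\<lambda>s'. same {0,1,2,3,4} {} s s' \<and>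
    ints s' 1 0 = int (prime_pi y) \<and> (\<forall>j<prime_pi y. ints s' 0 (int j) = int (pr j)))"
proof -
  define N where "N = prime_pi y"
  \<comment> \<open>The candidates are the integers from 2 to the floor of \<open>y\<close>; before
    round \<open>k\<close> all numbers up to \<open>Suc k\<close> have been tested.\<close>
  define n where "n = nat \<lfloor>y\<rfloor> - 1"
  have fl: "\<lfloor>y\<rfloor> \<ge> 2" using y by (simp add: le_floor_iff)
  define I where "I k s' \<longleftrightarrow> same {0,1,2,3,4} {} s s' \<and> ints s' 2 0 = 2 + int k \<and>
      ints s' 1 0 = int (prime_pi (real (Suc k))) \<and>
      (\<forall>j<prime_pi (real (Suc k)). ints s' 0 (int j) = int (pr j))" for k s'
  have ymem: "reals s' 1 0 = y" if "I k s'" for k s' using that y same_reals[of "{0,1,2,3,4}" "{}" s s' 1] by (simp add: I_def)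
  have step: "runs S prime_step_prog s' (N * 40 + 60) (I (Suc k))" if k: "k < n" and I: "I k s'" for k s'
  proof -
    define m where "m = prime_pi (real (Suc k))"
    have ky: "real (Suc (Suc k)) \<le> y"
    proof -
      have "int (Suc (Suc k)) \<le> \<lfloor>y\<rfloor>" using k fl by (simp add: n_def)
      thus ?thesis by (simp add: le_floor_iff)
    qed
    have pN: "prime_pi (real (Suc (Suc k))) \<le> N" unfolding N_def by (rule prime_pi_mono[OF ky])
    have mN: "m \<le> N" "m + (if prime (Suc (Suc k)) then 1 else 0) \<le> N"
      using pN prime_pi_Suc[of "Suc k"] by (auto simp: m_def split: if_splits)
    have sm: "same {0,1,2,3,4} {} s s'" and v: "ints s' 2 0 = 2 + int k" "ints s' 1 0 = int m"
      and P: "\<And>j. j < m \<Longrightarrow> ints s' 0 (int j) = int (pr j)" using I by (auto simp: I_def m_def)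
    let ?s0 = "set_int 3 0 0 s'"
    have r: "runs S (For 4 (IV 1) prime_test_prog) ?s0 (m * 40 + 20) (\<lambda>s''. same {3,4} {} ?s0 s'' \<and>
        ints s'' 3 0 = (if \<exists>j<m. pr j dvd Suc (Suc k) then 1 else 0))"
      by (rule runs_prime_test) (use v P mN S in \<open>auto simp: N_def\<close>)
    have "runs S (Seq (For 4 (IV 1) prime_test_prog)
     (Seq (Cond (ILe (IV 3) (IConst 0)) (Seq (ISet 0 (IV 1) (IV 2)) (iset 1 (iadd (IV 1) (IConst 1)))) Skip)
          (iset 2 (iadd (IV 2) (IConst 1))))) ?s0 (N * 40 + 20 + 35) (I (Suc k))"
    proof (rule runs_Seq[OF r])
      fix s2 assume s2: "same {3,4} {} ?s0 s2 \<and> ints s2 3 0 = (if \<exists>j<m. pr j dvd Suc (Suc k) then 1 else 0)"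
      have "same {0,1,2,3,4} {} s ?s0" by (intro same_set_int sm) auto
      from same_trans[OF this conjunct1[OF s2]] have sm2: "same {0,1,2,3,4} {} s s2" by auto
      have v2: "ints s2 2 0 = 2 + int k" "ints s2 1 0 = int m" "ints s2 0 = ints s' 0"
        using v same_ints[of "{3,4}" "{}" ?s0 s2] s2 by (auto simp: fun_eq_iff)
      have fl2: "ints s2 3 0 = (if prime (Suc (Suc k)) then 0 else 1)"
        using s2 prime_iff_no_pr_dvd[of "Suc k"] by (auto simp: m_def)
      let ?t = "\<lambda>s. set_int 2 0 (3 + int k) s"
      have pt: "I (Suc k) (?t (set_int 1 0 (int m + 1) (set_int 0 (int m) (2 + int k) s2)))" if "prime (Suc (Suc k))"
      proof -
        have "pr m = Suc (Suc k)" using pr_prime_pi[OF that] by (simp only: m_def)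
        moreover have "prime_pi (real (Suc (Suc k))) = Suc m" using prime_pi_Suc[of "Suc k"] that by (simp add: m_def)
        moreover have "same {0,1,2,3,4} {} s (?t (set_int 1 0 (int m + 1) (set_int 0 (int m) (2 + int k) s2)))"
          by (intro same_set_int sm2) auto
        ultimately show ?thesis unfolding I_def using P v2
          by (auto simp: less_Suc_eq simp del: of_nat_Suc)
      qed
      have pf: "I (Suc k) (?t s2)" if "\<not> prime (Suc (Suc k))"
      proof -
        have "prime_pi (real (Suc (Suc k))) = m" using prime_pi_Suc[of "Suc k"] that by (simp add: m_def)
        moreover have "same {0,1,2,3,4} {} s (?t s2)" by (intro same_set_int sm2) auto
        ultimately show ?thesis unfolding I_def using P v2 by (auto simp del: of_nat_Suc)
      qed
      have "runs S (Cond (ILe (IV 3) (IConst 0)) (Seq (ISet 0 (IV 1) (IV 2)) (iset 1 (iadd (IV 1) (IConst 1)))) Skip) s2 20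
         (\<lambda>s3. s3 = (if prime (Suc (Suc k)) then set_int 1 0 (int m + 1) (set_int 0 (int m) (2 + int k) s2) else s2))"
        using S mN by (auto simp: runs_simps v2[simplified] fl2 N_def)
      thus "runs S (Seq (Cond (ILe (IV 3) (IConst 0)) (Seq (ISet 0 (IV 1) (IV 2)) (iset 1 (iadd (IV 1) (IConst 1)))) Skip)
          (iset 2 (iadd (IV 2) (IConst 1)))) s2 35 (I (Suc k))"
      proof (rule runs_Seq)
        fix s3 assume s3: "s3 = (if prime (Suc (Suc k)) then set_int 1 0 (int m + 1) (set_int 0 (int m) (2 + int k) s2) else s2)"
        have "ints s3 2 0 = 2 + int k" using v2 by (simp add: s3)
        moreover have "I (Suc k) (?t s3)" using pt pf by (simp add: s3)
        ultimately show "runs S (iset 2 (iadd (IV 2) (IConst 1))) s3 15 (I (Suc k))"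
          using S by (simp add: runs_simps add.commute)
      qed simp
    qed (use mN in simp)
    thus ?thesis unfolding prime_step_prog_def using S
      by (simp add: runs_Seq_ISet runs_mono)
  qed
  have W: "runs S (While (RLe (OfInt (IV 2)) (RV 1)) prime_step_prog) (set_int 2 0 2 (set_int 1 0 0 s))
     (n * ((N * 40 + 60) + bcost (RLe (OfInt (IV 2)) (RV 1)) + 1) + bcost (RLe (OfInt (IV 2)) (RV 1)) + 1)
     (\<lambda>s'. same {0,1,2,3,4} {} s s' \<and>
    ints s' 1 0 = int (prime_pi y) \<and> (\<forall>j<prime_pi y. ints s' 0 (int j) = int (pr j)))"
  proof (rule runs_While[where I = I, OF _ _ _ order_refl])
    fix k s' assume k: "k < n" and I: "I k s'"
    have "2 + int k \<le> \<lfloor>y\<rfloor>" using k fl by (simp add: n_def)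
    hence "2 + real k \<le> y" by (simp add: le_floor_iff)
    thus "bok S s' (RLe (OfInt (IV 2)) (RV 1)) \<and> bval s' (RLe (OfInt (IV 2)) (RV 1)) \<and>
       runs S prime_step_prog s' (N * 40 + 60) (I (Suc k))"
      using step[OF k I] I ymem[OF I] S by (simp add: I_def)
  next
    fix s' assume I: "I n s'"
    have n: "2 + int n = \<lfloor>y\<rfloor> + 1" using fl unfolding n_def by arith
    have rn: "real (Suc n) = of_int \<lfloor>y\<rfloor>"
    proof -
      have "int (Suc n) = \<lfloor>y\<rfloor>" using n by simp
      thus ?thesis by (metis of_int_of_nat_eq)
    qed
    have "y < of_int \<lfloor>y\<rfloor> + 1" by linarith
    hence "\<not> 2 + real n \<le> y" using rn unfolding of_nat_Suc by linarith
    thus "bok S s' (RLe (OfInt (IV 2)) (RV 1)) \<and> \<not> bval s' (RLe (OfInt (IV 2)) (RV 1))"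
      using I ymem[OF I] S by (simp add: I_def)
    have "primes_upto (real (Suc n)) = primes_upto y"
    proof -
      have "real p \<le> of_int \<lfloor>y\<rfloor> \<longleftrightarrow> real p \<le> y" for p
        using le_floor_iff[of "int p" y] by (metis of_int_le_iff of_int_of_nat_eq)
      thus ?thesis unfolding primes_upto_def rn by simp
    qed
    hence "prime_pi (real (Suc n)) = prime_pi y" by (simp add: prime_pi_def)
    thus "same {0,1,2,3,4} {} s s' \<and>
    ints s' 1 0 = int (prime_pi y) \<and> (\<forall>j<prime_pi y. ints s' 0 (int j) = int (pr j))"
      using I by (simp add: I_def)
  next
    have "prime_pi (real (Suc 0)) = 0"
      by (auto simp: prime_pi_def primes_upto_def dest: prime_ge_2_nat)
    thus "I 0 (set_int 2 0 2 (set_int 1 0 0 s))"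
      unfolding I_def by (auto intro!: same_set_int simp del: of_nat_Suc)
  qed
  have "n * ((N * 40 + 60) + 6 + 1) \<le> nat \<lfloor>y\<rfloor> * (N * 40 + 80)"
    by (intro mult_le_mono) (auto simp: n_def)
  thus ?thesis unfolding prime_prog_def using S
    by (simp add: runs_Seq_ISet N_def del: One_nat_def) (rule runs_mono[OF W]; simp add: N_def)
qed

section \<open>The coefficients of the local factors\<close>

definition msize_prog :: com where
  "msize_prog = Seq (iset 5 (IConst 1))
    (Seq (While (BNot (ILe (iadd (iadd (IV 1) (IV 1)) (IConst 2)) (IV 5))) (iset 5 (iadd (IV 5) (IV 5))))
         (iset 9 (idiv (IV 5) (IConst 2))))"

text \<open>The bound \<open>2 * N + 2\<close> ensures \<open>2 * N < M\<close> for the convolution,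
  and \<open>K >= 1\<close>, so that \<open>M\<close> is even; minimality gives
  \<open>M <= 4 * N + 4\<close>, which keeps the transform length in proportion to
  \<open>N\<close>.\<close>

lemma msize_exists: "\<exists>K\<ge>1. 2 * N + 2 \<le> (2::nat) ^ K \<and> 2 ^ K \<le> 4 * N + 4 \<and> (\<forall>k<K. 2 ^ k < 2 * N + 2)"
proof -
  define K where "K = (LEAST k. 2 * N + 2 \<le> (2::nat) ^ k)"
  have ex: "2 * N + 2 \<le> (2::nat) ^ (2 * N + 2)" using less_exp[of "2 * N + 2"] by simp
  have 1: "2 * N + 2 \<le> (2::nat) ^ K" unfolding K_def by (rule LeastI[of "\<lambda>k. 2 * N + 2 \<le> (2::nat) ^ k", OF ex])
  have 2: "2 ^ k < 2 * N + 2" if "k < K" for k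
    using not_less_Least[of k "\<lambda>k. 2 * N + 2 \<le> (2::nat) ^ k"] that by (simp add: K_def)
  have "K \<noteq> 0"
  proof
    assume "K = 0"
    with 1 show False by simp
  qed
  then obtain j where j: "K = Suc j" by (cases K) auto
  have "2 ^ K \<le> 4 * N + 4" using 2[of j] by (simp add: j)
  with 1 2 j show ?thesis by (intro exI[of _ K]) auto
qed

lemma runs_msize:
  assumes v: "ints s 1 0 = int N" and S: "S > 0"
    and K: "K \<ge> 1" "2 * N + 2 \<le> (2::nat) ^ K" "\<And>k. k < K \<Longrightarrow> 2 ^ k < 2 * N + 2"
  shows "runs S msize_prog s (K * 30 + 60) (\<lambda>s'. same {5,9} {} s s' \<and>
    ints s' 5 0 = int (2 ^ K) \<and> ints s' 9 0 = int (2 ^ (K - 1)))"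
proof -
  define I where "I k s' \<longleftrightarrow> same {5,9} {} s s' \<and> ints s' 5 0 = 2 ^ k" for k s'
  let ?b = "BNot (ILe (iadd (iadd (IV 1) (IV 1)) (IConst 2)) (IV 5))"
  have n1: "ints s' 1 0 = int N" if "I k s'" for k s'
    using that v same_ints[of "{5,9}" "{}" s s' 1] by (simp add: I_def)
  have "runs S (While ?b (iset 5 (iadd (IV 5) (IV 5)))) (set_int 5 0 1 s) (K * (10 + bcost ?b + 1) + bcost ?b + 1) (I K)"
  proof (rule runs_While[where I = I, OF _ _ _ order_refl])
    fix k s' assume k: "k < K" and I: "I k s'"
    have "int (2 ^ k) < int (2 * N + 2)" using K(3)[OF k] by (simp only: of_nat_less_iff)
    hence "2 ^ k < 2 * int N + 2" by simp
    moreover have "I (Suc k) (set_int 5 0 (2 ^ k + 2 ^ k) s')" using I by (auto simp: I_def intro: same_set_int)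
    ultimately show "bok S s' ?b \<and> bval s' ?b \<and> runs S (iset 5 (iadd (IV 5) (IV 5))) s' 10 (I (Suc k))"
      using S n1[OF I] I by (simp add: runs_simps I_def)
  next
    fix s' assume I: "I K s'"
    have "int (2 * N + 2) \<le> int (2 ^ K)" using K(2) by (simp only: of_nat_le_iff)
    hence "2 * int N + 2 \<le> 2 ^ K" by simp
    thus "bok S s' ?b \<and> \<not> bval s' ?b" using S n1[OF I] I by (simp add: I_def)
  qed (auto simp: I_def intro: same_set_int)
  hence "runs S (Seq (While ?b (iset 5 (iadd (IV 5) (IV 5)))) (iset 9 (idiv (IV 5) (IConst 2)))) (set_int 5 0 1 s)
     (K * 30 + 50) (\<lambda>s'. same {5,9} {} s s' \<and>
    ints s' 5 0 = int (2 ^ K) \<and> ints s' 9 0 = int (2 ^ (K - 1)))"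
  proof (rule runs_Seq)
    fix s' assume I: "I K s'"
    obtain j where j: "K = Suc j" using K(1) by (cases K) auto
    have "same {5,9} {} s (set_int 9 0 (2 ^ j) s')" using I by (auto simp: I_def intro: same_set_int)
    thus "runs S (iset 9 (idiv (IV 5) (IConst 2))) s' 15 (\<lambda>s'. same {5,9} {} s s' \<and>
      ints s' 5 0 = int (2 ^ K) \<and> ints s' 9 0 = int (2 ^ (K - 1)))"
      using S I by (simp add: runs_simps I_def j)
  qed simp
  thus ?thesis unfolding msize_prog_def using S by (simp add: runs_Seq_ISet) (erule runs_mono; simp)
qed

text \<open>The coefficient of \<open>s ^ Suc j\<close> in \<open>1 - exp (- s)\<close>.\<close>

definition inv_fact_alt :: "nat \<Rightarrow> real" where
  "inv_fact_alt j = (-1) ^ j / fact (Suc j)"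

text \<open>The coefficient of \<open>s ^ (n + 2)\<close> in the identity \<open>fps_c_mult\<close>
  is zero. The machine thus obtains the \<open>c n\<close> by arithmetic operations in quadratic
  time, without evaluating zeta.\<close>

lemma c_recurrence: "c (Suc n) = - (\<Sum>j\<le>n. c (n - j) * inv_fact_alt (Suc j))"
proof -
  have e: "fps_nth (1 - fps_exp (- 1)) (Suc j) = inv_fact_alt j" for j
    by (simp add: inv_fact_alt_def algebra_simps)
  have e0: "fps_nth (1 - fps_exp (- 1 :: real)) 0 = 0" by simp
  have "(0::real) = fps_nth (Abs_fps c * (1 - fps_exp (- 1))) (Suc (Suc n))"
    by (subst fps_c_mult) (simp add: fps_X_def)
  also have "\<dots> = (\<Sum>i\<le>Suc (Suc n). fps_nth (1 - fps_exp (- 1)) i * c (Suc (Suc n) - i))"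
    by (subst mult.commute) (simp add: fps_mult_nth atLeast0AtMost)
  also have "\<dots> = (\<Sum>i\<le>Suc n. inv_fact_alt i * c (Suc n - i))"
    by (subst sum.atMost_Suc_shift) (simp add: e e0 del: fps_sub_nth)
  also have "\<dots> = c (Suc n) + (\<Sum>j\<le>n. inv_fact_alt (Suc j) * c (n - j))"
    by (subst sum.atMost_Suc_shift) (simp add: inv_fact_alt_def)
  finally show ?thesis by (simp add: mult.commute)
qed

definition fact_prog :: com where
  "fact_prog = Seq (RSet 5 (IConst 0) (OfInt (IConst 1)))
     (For 4 (IV 1) (RSet 5 (iadd (IV 4) (IConst 1))
        (rsub (OfInt (IConst 0)) (rdiv (RGet 5 (IV 4)) (OfInt (iadd (IV 4) (IConst 2)))))))"

definition ctab_step_prog :: com where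
  "ctab_step_prog = Seq (RSet 4 (iadd (IV 4) (IConst 1)) (OfInt (IConst 0)))
     (For 7 (iadd (IV 4) (IConst 1))
       (RSet 4 (iadd (IV 4) (IConst 1)) (rsub (RGet 4 (iadd (IV 4) (IConst 1)))
          (rmul (RGet 4 (isub (IV 4) (IV 7))) (RGet 5 (iadd (IV 7) (IConst 1)))))))"

definition ctab_prog :: com where
  "ctab_prog = Seq fact_prog (Seq (RSet 4 (IConst 0) (OfInt (IConst 1))) (For 4 (IV 1) ctab_step_prog))"

lemma runs_fact:
  assumes v: "ints s 1 0 = int N" and S: "N < S"
  shows "runs S fact_prog s (N * 60 + 40) (\<lambda>s'. same {4} {5} s s' \<and> (\<forall>j\<le>N. reals s' 5 (int j) = inv_fact_alt j))"
proof -
  have "runs S (For 4 (IV 1) (RSet 5 (iadd (IV 4) (IConst 1))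
        (rsub (OfInt (IConst 0)) (rdiv (RGet 5 (IV 4)) (OfInt (iadd (IV 4) (IConst 2)))))))
      (set_real 5 0 1 s) (N * 60 + 20) (\<lambda>s'. same {4} {5} s s' \<and> (\<forall>j\<le>N. reals s' 5 (int j) = inv_fact_alt j))"
  proof (rule runs_For[where n = N and B = 30 and J = "\<lambda>k s'. same {4} {5} s s' \<and> (\<forall>j\<le>k. reals s' 5 (int j) = inv_fact_alt j)"])
    fix k s' assume k: "k < N" and J: "same {4} {5} s s' \<and> (\<forall>j\<le>k. reals s' 5 (int j) = inv_fact_alt j)"
      and i: "ints s' 4 0 = int k"
    have r: "reals s' 5 (int k) = inv_fact_alt k" using J by simp
    have f: "- (inv_fact_alt k / (real k + 2)) = inv_fact_alt (Suc k)"
      by (simp add: inv_fact_alt_def field_simps)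
    let ?s2 = "set_int 4 0 (int k + 1) (set_real 5 (int k + 1) (inv_fact_alt (Suc k)) s')"
    have "same {4} {5} s ?s2" using J by (auto intro!: same_set_int same_set_real)
    moreover have "\<forall>j\<le>Suc k. reals ?s2 5 (int j) = inv_fact_alt j" using J by (auto simp: le_Suc_eq)
    ultimately show "runs S (RSet 5 (iadd (IV 4) (IConst 1))
        (rsub (OfInt (IConst 0)) (rdiv (RGet 5 (IV 4)) (OfInt (iadd (IV 4) (IConst 2)))))) s' 30
       (\<lambda>s'. ints s' 4 0 = int k \<and> same {4} {5} s (set_int 4 0 (int k + 1) s') \<and>
          (\<forall>j\<le>Suc k. reals (set_int 4 0 (int k + 1) s') 5 (int j) = inv_fact_alt j))"
      using k S by (simp add: runs_simps i r f)
  next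
    fix k s' assume "same {4} {5} s s' \<and> (\<forall>j\<le>k. reals s' 5 (int j) = inv_fact_alt j)"
    thus "iok S s' (IV 1) \<and> ival s' (IV 1) = int N" using v S same_ints[of "{4}" "{5}" s s' 1] by auto
  qed (use S in \<open>auto intro!: same_set_int same_set_real simp: inv_fact_alt_def\<close>)
  thus ?thesis unfolding fact_prog_def using S by (simp add: runs_Seq_RSet) (erule runs_mono; simp)
qed

lemma runs_ctab_step:
  assumes v: "ints s 4 0 = int k" and S: "k + 1 < S"
    and f: "\<And>j. j \<le> k + 1 \<Longrightarrow> reals s 5 (int j) = inv_fact_alt j"
    and cc: "\<And>j. j \<le> k \<Longrightarrow> reals s 4 (int j) = c j"
  shows "runs S ctab_step_prog s ((k + 1) * 70 + 50) (\<lambda>s'. same {7} {4} s s' \<and>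
     (\<forall>i. i \<noteq> int k + 1 \<longrightarrow> reals s' 4 i = reals s 4 i) \<and> reals s' 4 (int k + 1) = c (Suc k))"
proof -
  let ?body = "RSet 4 (iadd (IV 4) (IConst 1)) (rsub (RGet 4 (iadd (IV 4) (IConst 1)))
          (rmul (RGet 4 (isub (IV 4) (IV 7))) (RGet 5 (iadd (IV 7) (IConst 1)))))"
  define J where "J m s' \<longleftrightarrow> same {7} {4} s s' \<and>
     (\<forall>i. i \<noteq> int k + 1 \<longrightarrow> reals s' 4 i = reals s 4 i) \<and>
     reals s' 4 (int k + 1) = - (\<Sum>j<m. c (k - j) * inv_fact_alt (Suc j))" for m s'
  have "runs S (For 7 (iadd (IV 4) (IConst 1)) ?body) (set_real 4 (int k + 1) 0 s) ((k + 1) * 70 + 30) (J (k + 1))"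
  proof (rule runs_For[where n = "k + 1" and B = 40 and J = J])
    fix m s' assume m: "m < k + 1" and J: "J m s'" and i: "ints s' 7 0 = int m"
    have sm: "same {7} {4} s s'" using J by (simp add: J_def)
    have v': "ints s' 4 0 = int k" "reals s' 5 (int m + 1) = inv_fact_alt (Suc m)"
      "reals s' 4 (int k - int m) = c (k - m)"
      using v same_ints[OF sm, of 4] same_reals[OF sm, of 5] f[of "Suc m"] cc[of "k - m"] J m
      by (auto simp: J_def of_nat_diff add.commute)
    let ?x = "- (\<Sum>j<Suc m. c (k - j) * inv_fact_alt (Suc j))"
    have x: "- (\<Sum>j<m. c (k - j) * inv_fact_alt (Suc j)) - c (k - m) * inv_fact_alt (Suc m) = ?x" by simp
    have r4: "reals s' 4 (int k + 1) = - (\<Sum>j<m. c (k - j) * inv_fact_alt (Suc j))" using J by (simp add: J_def)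
    have "J (Suc m) (set_int 7 0 (int m + 1) (set_real 4 (int k + 1) ?x s'))"
      using J unfolding J_def by (auto intro!: same_set_int same_set_real)
    thus "runs S ?body s' 40 (\<lambda>s'. ints s' 7 0 = int m \<and> J (Suc m) (set_int 7 0 (int m + 1) s'))"
      using m S by (simp add: runs_simps i v' r4 of_nat_diff)
  next
    fix m s' assume "J m s'"
    hence "ints s' 4 0 = int k" using v same_ints[of "{7}" "{4}" s s' 4] by (simp add: J_def)
    thus "iok S s' (iadd (IV 4) (IConst 1)) \<and> ival s' (iadd (IV 4) (IConst 1)) = int (k + 1)"
      using S by simp
  next
    show "J 0 (set_int 7 0 0 (set_real 4 (int k + 1) 0 s))"
      unfolding J_def by (auto intro!: same_set_int same_set_real)
  qed (use S in auto)
  moreover have "J (k + 1) s' \<Longrightarrow> same {7} {4} s s' \<and>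
     (\<forall>i. i \<noteq> int k + 1 \<longrightarrow> reals s' 4 i = reals s 4 i) \<and> reals s' 4 (int k + 1) = c (Suc k)" for s'
    unfolding J_def c_recurrence by (simp add: lessThan_Suc_atMost)
  ultimately show ?thesis unfolding ctab_step_prog_def using S v
    by (simp add: runs_Seq_RSet) (erule runs_mono; simp)
qed

text \<open>The cells beyond \<open>N\<close> are tracked because they still hold their initial
  zeros: loading reads \<open>M > N\<close> cells, and the convolution relies on this
  padding.\<close>

lemma runs_ctab:
  assumes v: "ints s 1 0 = int N" and S: "N + 1 < S"
  shows "runs S ctab_prog s ((N + 1) * ((N + 1) * 70 + 200)) (\<lambda>s'. same {4,7} {4,5} s s' \<and>
     (\<forall>j\<le>N. reals s' 4 (int j) = c j) \<and> (\<forall>i>int N. reals s' 4 i = reals s 4 i))"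
proof -
  have "N < S" using S by simp
  show ?thesis unfolding ctab_prog_def
  proof (rule runs_Seq[OF runs_fact[OF v \<open>N < S\<close>]])
    fix s1 assume s1: "same {4} {5} s s1 \<and> (\<forall>j\<le>N. reals s1 5 (int j) = inv_fact_alt j)"
    define J where "J k s' \<longleftrightarrow> same {4,7} {4,5} s s' \<and> (\<forall>j\<le>N. reals s' 5 (int j) = inv_fact_alt j) \<and>
        (\<forall>j\<le>k. reals s' 4 (int j) = c j) \<and> (\<forall>i>int N. reals s' 4 i = reals s 4 i)" for k s'
    have r41: "reals s1 4 = reals s 4" using same_reals[of "{4}" "{5}" s s1] s1 by simp
    have "same {4,7} {4,5} s s1" using s1 by (auto simp: same_def)
    hence J0: "J 0 (set_int 4 0 0 (set_real 4 0 1 s1))"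
      using s1 r41 unfolding J_def by (auto intro!: same_set_int same_set_real simp: c_def)
    have "runs S (For 4 (IV 1) ctab_step_prog) (set_real 4 0 1 s1) (N * (((N + 1) * 70 + 50) + 2 + 12) + 2 + 12)
      (\<lambda>s'. same {4,7} {4,5} s s' \<and>
     (\<forall>j\<le>N. reals s' 4 (int j) = c j) \<and> (\<forall>i>int N. reals s' 4 i = reals s 4 i))"
    proof (rule runs_For[where n = N and J = J])
      fix k s' assume k: "k < N" and J: "J k s'" and i: "ints s' 4 0 = int k"
      have "runs S ctab_step_prog s' ((k + 1) * 70 + 50) (\<lambda>s''. same {7} {4} s' s'' \<and>
        (\<forall>i. i \<noteq> int k + 1 \<longrightarrow> reals s'' 4 i = reals s' 4 i) \<and> reals s'' 4 (int k + 1) = c (Suc k))"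
        by (rule runs_ctab_step) (use i k S J in \<open>auto simp: J_def\<close>)
      thus "runs S ctab_step_prog s' ((N + 1) * 70 + 50) (\<lambda>s'. ints s' 4 0 = int k \<and> J (Suc k) (set_int 4 0 (int k + 1) s'))"
      proof (rule runs_mono)
        fix s2 assume s2: "same {7} {4} s' s2 \<and>
          (\<forall>i. i \<noteq> int k + 1 \<longrightarrow> reals s2 4 i = reals s' 4 i) \<and> reals s2 4 (int k + 1) = c (Suc k)"
        have "same {4,7} {4,5} s s2"
          using J s2 by (elim conjE) (rule same_trans[of "{4,7}" "{4,5}" s s' "{7}" "{4}"]; auto simp: J_def)
        moreover have "reals s2 5 = reals s' 5" "ints s2 4 = ints s' 4" using s2 by (auto simp: same_def)
        moreover have "reals s2 4 (int j) = c j" if "j \<le> Suc k" for j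
          using that s2 J by (cases "j = Suc k") (auto simp: J_def add.commute)
        moreover have "reals s2 4 i = reals s 4 i" if "i > int N" for i
          using that s2 J k by (auto simp: J_def)
        ultimately show "ints s2 4 0 = int k \<and> J (Suc k) (set_int 4 0 (int k + 1) s2)"
          using i J unfolding J_def by (auto intro!: same_set_int)
      qed (use k in simp)
    next
      fix k s' assume "J k s'"
      thus "iok S s' (IV 1) \<and> ival s' (IV 1) = int N"
        using v S same_ints[of "{4,7}" "{4,5}" s s' 1] by (auto simp: J_def)
    qed (use S J0 in \<open>auto simp: J_def\<close>)
    thus "runs S (Seq (RSet 4 (IConst 0) (OfInt (IConst 1))) (For 4 (IV 1) ctab_step_prog)) s1
      (N * (((N + 1) * 70 + 50) + 2 + 12) + 24) (\<lambda>s'. same {4,7} {4,5} s s' \<and>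
     (\<forall>j\<le>N. reals s' 4 (int j) = c j) \<and> (\<forall>i>int N. reals s' 4 i = reals s 4 i))"
      using S by (simp add: runs_Seq_RSet) (erule runs_mono; simp)
  qed (simp add: algebra_simps)
qed


section \<open>One row of coefficients\<close>

definition load_prog :: com where
  "load_prog = Seq (RSet 6 (IV 4) (RGet 10 (IV 4)))
    (Seq (RSet 7 (IV 4) (rmul (RGet 4 (IV 4)) (RV 11)))
         (rset 11 (rmul (RV 11) (RFun Ln (OfInt (IGet 0 (IV 8)))))))"

text \<open>The conjugate of the square is stored, so that a second forward transform acts as the
  inverse (\<open>dft_inverse_square\<close>). The new real part waits in a temporary because the
  new imaginary part still needs the old one.\<close>

definition square_prog :: com where
  "square_prog = Seq (rset 12 (rsub (rmul (RGet 6 (IV 4)) (RGet 6 (IV 4))) (rmul (RGet 7 (IV 4)) (RGet 7 (IV 4)))))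
    (Seq (RSet 7 (IV 4) (rsub (OfInt (IConst 0)) (rmul (rmul (OfInt (IConst 2)) (RGet 6 (IV 4))) (RGet 7 (IV 4)))))
         (RSet 6 (IV 4) (RV 12)))"

definition extract_prog :: com where
  "extract_prog = RSet 10 (IV 4) (rdiv (rsub (OfInt (IConst 0)) (RGet 7 (IV 4))) (rmul (OfInt (IConst 2)) (OfInt (IV 5))))"

text \<open>Round \<open>k\<close> multiplies by the series of \<open>pr k\<close> and so yields the
  row for \<open>k + 1\<close> primes, which starts at \<open>slot (Suc k) 0\<close>.\<close>

definition store_prog :: com where
  "store_prog = RSet 0 (iadd (idiv (imul (iadd (IV 8) (IConst 1)) (iadd (IV 8) (IConst 2))) (IConst 2)) (IV 4)) (RGet 10 (IV 4))"

definition row_prog :: com where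
  "row_prog = Seq (rset 11 (OfInt (IConst 1))) (Seq (For 4 (IV 5) load_prog) (Seq fft_prog
    (Seq (For 4 (IV 5) square_prog) (Seq fft_prog
    (Seq (For 4 (iadd (IV 1) (IConst 1)) extract_prog) (For 4 (iadd (IV 8) (IConst 2)) store_prog))))))"

lemma runs_load:
  assumes v: "ints s 5 0 = int M" "ints s 8 0 = int k" "ints s 0 (int k) = int p" "reals s 11 0 = 1"
    and S: "M \<le> S" "k < S" "p > 0"
  shows "runs S (For 4 (IV 5) load_prog) s (M * 60 + 20) (\<lambda>s'. same {4} {6,7,11} s s' \<and>
    (\<forall>j<M. vecA s' j = Complex (reals s 10 (int j)) (reals s 4 (int j) * ln (real p) ^ j)))"
proof -
  let ?J = "\<lambda>m s'. same {4} {6,7,11} s s' \<and> reals s' 11 0 = ln (real p) ^ m \<and>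
    (\<forall>j<m. vecA s' j = Complex (reals s 10 (int j)) (reals s 4 (int j) * ln (real p) ^ j))"
  show ?thesis
  proof (rule runs_For[where n = M and B = 40 and J = ?J])
    fix m s' assume m: "m < M" and i: "ints s' 4 0 = int m"
      and J: "?J m s'"
    have v': "ints s' 8 0 = int k" "ints s' 0 (int k) = int p" "reals s' 10 = reals s 10" "reals s' 4 = reals s 4"
      using J v by (auto simp: same_def)
    let ?s2 = "set_int 4 0 (int m + 1) (set_real 11 0 (ln (real p) ^ m * ln (real p))
       (set_real 7 (int m) (reals s 4 (int m) * ln (real p) ^ m) (set_real 6 (int m) (reals s 10 (int m)) s')))"
    have "same {4} {6,7,11} s ?s2" using J by (auto intro!: same_set_int same_set_real)
    moreover have "\<forall>j<Suc m. vecA ?s2 j = Complex (reals s 10 (int j)) (reals s 4 (int j) * ln (real p) ^ j)"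
      using J by (auto simp: less_Suc_eq vecA_def)
    ultimately show "runs S load_prog s' 40 (\<lambda>s'. ints s' 4 0 = int m \<and> ?J (Suc m) (set_int 4 0 (int m + 1) s'))"
      unfolding load_prog_def using m S J by (simp add: runs_simps i v' mult.commute)
  next
    fix m s' assume "?J m s'"
    hence "ints s' 5 = ints s 5" by (simp add: same_def)
    thus "iok S s' (IV 5) \<and> ival s' (IV 5) = int M" using v S by simp
  qed (use S v in \<open>auto intro: same_set_int\<close>)
qed

lemma runs_square:
  assumes v: "ints s 5 0 = int M" and S: "M \<le> S" "S > 0"
  shows "runs S (For 4 (IV 5) square_prog) s (M * 80 + 20) (\<lambda>s'. same {4} {6,7,12} s s' \<and>
    (\<forall>j<M. vecA s' j = cnj (vecA s j ^ 2)))"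
proof -
  let ?J = "\<lambda>m s'. same {4} {6,7,12} s s' \<and>
    (\<forall>j<m. vecA s' j = cnj (vecA s j ^ 2)) \<and> (\<forall>j\<ge>m. vecA s' j = vecA s j)"
  show ?thesis
  proof (rule runs_For[where n = M and B = 60 and J = ?J])
    fix m s' assume m: "m < M" and i: "ints s' 4 0 = int m"
      and J: "?J m s'"
    have "vecA s' m = vecA s m" using J by blast
    hence r: "reals s' 6 (int m) = reals s 6 (int m)" "reals s' 7 (int m) = reals s 7 (int m)" by (auto simp: vecA_def)
    define a where "a = reals s 6 (int m) * reals s 6 (int m) - reals s 7 (int m) * reals s 7 (int m)"
    let ?s2 = "set_int 4 0 (int m + 1) (set_real 6 (int m) a
       (set_real 7 (int m) (- (2 * reals s 6 (int m) * reals s 7 (int m))) (set_real 12 0 a s')))"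
    have "same {4} {6,7,12} s ?s2" using J by (auto intro!: same_set_int same_set_real)
    moreover have "\<forall>j<Suc m. vecA ?s2 j = cnj (vecA s j ^ 2)"
      using J by (auto simp: less_Suc_eq vecA_def complex_eq_iff power2_eq_square a_def)
    moreover have "\<forall>j\<ge>Suc m. vecA ?s2 j = vecA s j" using J by (auto simp: vecA_def)
    ultimately show "runs S square_prog s' 60 (\<lambda>s'. ints s' 4 0 = int m \<and> ?J (Suc m) (set_int 4 0 (int m + 1) s'))"
      unfolding square_prog_def using m S by (simp add: runs_simps i r flip: a_def)
  next
    fix m s' assume "?J m s'"
    hence "ints s' 5 = ints s 5" by (simp add: same_def)
    thus "iok S s' (IV 5) \<and> ival s' (IV 5) = int M" using v S by simp
  qed (use S v in \<open>auto intro: same_set_int simp: vecA_def\<close>)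
qed

lemma runs_extract:
  assumes v: "ints s 5 0 = int M" "ints s 1 0 = int N" and S: "M > 0" "N < S"
  shows "runs S (For 4 (iadd (IV 1) (IConst 1)) extract_prog) s ((N + 1) * 40 + 30) (\<lambda>s'. same {4} {10} s s' \<and>
    (\<forall>j\<le>N. reals s' 10 (int j) = - Im (vecA s j) / (2 * real M)) \<and> (\<forall>i>int N. reals s' 10 i = reals s 10 i))"
proof -
  let ?J = "\<lambda>m s'. same {4} {10} s s' \<and>
    (\<forall>j<m. reals s' 10 (int j) = - Im (vecA s j) / (2 * real M)) \<and> (\<forall>i>int N. reals s' 10 i = reals s 10 i)"
  show ?thesis
  proof (rule runs_For[where n = "N + 1" and B = 20 and J = ?J])
    fix m s' assume m: "m < N + 1" and i: "ints s' 4 0 = int m"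
      and J: "?J m s'"
    have r: "reals s' 7 = reals s 7" "ints s' 5 0 = int M" using J v by (auto simp: same_def)
    let ?s2 = "set_int 4 0 (int m + 1) (set_real 10 (int m) (- (reals s 7 (int m) / (2 * real M))) s')"
    have "same {4} {10} s ?s2" using J by (auto intro!: same_set_int same_set_real)
    moreover have "\<forall>j<Suc m. reals ?s2 10 (int j) = - Im (vecA s j) / (2 * real M)"
      using J by (auto simp: less_Suc_eq vecA_def)
    moreover have "\<forall>i>int N. reals ?s2 10 i = reals s 10 i" using J m by auto
    ultimately show "runs S extract_prog s' 20 (\<lambda>s'. ints s' 4 0 = int m \<and> ?J (Suc m) (set_int 4 0 (int m + 1) s'))"
      unfolding extract_prog_def using m S by (simp add: runs_simps i r)
  next
    fix m s' assume "?J m s'"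
    hence "ints s' 1 = ints s 1" by (simp add: same_def)
    thus "iok S s' (iadd (IV 1) (IConst 1)) \<and> ival s' (iadd (IV 1) (IConst 1)) = int (N + 1)" using v S by simp
  next
    fix s' assume "same {4} {10} s s' \<and> (\<forall>j<N+1. reals s' 10 (int j) = - Im (vecA s j) / (2 * real M)) \<and> (\<forall>i>int N. reals s' 10 i = reals s 10 i)"
    thus "same {4} {10} s s' \<and>
      (\<forall>j\<le>N. reals s' 10 (int j) = - Im (vecA s j) / (2 * real M)) \<and> (\<forall>i>int N. reals s' 10 i = reals s 10 i)"
      by (simp add: less_Suc_eq_le)
  qed (use S v in \<open>auto intro: same_set_int\<close>)
qed

lemma runs_store:
  assumes v: "ints s 8 0 = int k" and S: "slot (Suc k) (Suc k) < S" "k + 2 \<le> S"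
  shows "runs S (For 4 (iadd (IV 8) (IConst 2)) store_prog) s ((k + 2) * 50 + 30) (\<lambda>s'. same {4} {0} s s' \<and>
    (\<forall>n\<le>Suc k. reals s' 0 (int (slot (Suc k) n)) = reals s 10 (int n)) \<and>
    (\<forall>i<slot (Suc k) 0. reals s' 0 (int i) = reals s 0 (int i)))"
proof -
  let ?J = "\<lambda>m s'. same {4} {0} s s' \<and>
    (\<forall>n<m. reals s' 0 (int (slot (Suc k) n)) = reals s 10 (int n)) \<and>
    (\<forall>i<slot (Suc k) 0. reals s' 0 (int i) = reals s 0 (int i))"
  show ?thesis
  proof (rule runs_For[where n = "k + 2" and B = 30 and J = ?J])
    fix m s' assume m: "m < k + 2" and i: "ints s' 4 0 = int m"
      and J: "?J m s'"
    have r: "reals s' 10 = reals s 10" "ints s' 8 0 = int k" using J v by (auto simp: same_def)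
    define sl where "sl = slot (Suc k) m"
    have sl: "(int k + 1) * (int k + 2) div 2 + int m = int sl"
    proof -
      have "int sl = int (Suc k * (Suc k + 1) div 2) + int m" by (simp add: sl_def slot_def)
      also have "int (Suc k * (Suc k + 1) div 2) = (int k + 1) * (int k + 2) div 2"
        by (simp add: zdiv_int algebra_simps)
      finally show ?thesis by simp
    qed
    have slS: "int sl < int S" using S m by (simp add: sl_def slot_def)
    have sln: "slot (Suc k) n = sl \<longleftrightarrow> n = m" for n by (simp add: sl_def slot_def)
    have sl0: "i < slot (Suc k) 0 \<Longrightarrow> i \<noteq> sl" for i by (simp add: sl_def slot_def)
    let ?s2 = "set_int 4 0 (int m + 1) (set_real 0 (int sl) (reals s 10 (int m)) s')"
    have "same {4} {0} s ?s2" using J by (auto intro!: same_set_int same_set_real)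
    moreover have "\<forall>n<Suc m. reals ?s2 0 (int (slot (Suc k) n)) = reals s 10 (int n)"
      using J by (auto simp: less_Suc_eq sln)
    moreover have "\<forall>i<slot (Suc k) 0. reals ?s2 0 (int i) = reals s 0 (int i)" using J sl0 by auto
    ultimately show "runs S store_prog s' 30 (\<lambda>s'. ints s' 4 0 = int m \<and> ?J (Suc m) (set_int 4 0 (int m + 1) s'))"
      unfolding store_prog_def using m S slS by (simp add: runs_simps i r sl)
  next
    fix m s' assume "?J m s'"
    hence "ints s' 8 = ints s 8" by (simp add: same_def)
    thus "iok S s' (iadd (IV 8) (IConst 2)) \<and> ival s' (iadd (IV 8) (IConst 2)) = int (k + 2)" using v S by simp
  next
    fix s' assume "same {4} {0} s s' \<and> (\<forall>n<k+2. reals s' 0 (int (slot (Suc k) n)) = reals s 10 (int n)) \<and>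
      (\<forall>i<slot (Suc k) 0. reals s' 0 (int i) = reals s 0 (int i))"
    thus "same {4} {0} s s' \<and> (\<forall>n\<le>Suc k. reals s' 0 (int (slot (Suc k) n)) = reals s 10 (int n)) \<and>
      (\<forall>i<slot (Suc k) 0. reals s' 0 (int i) = reals s 0 (int i))"
      by (simp add: less_Suc_eq_le)
  qed (use S v in \<open>auto intro: same_set_int\<close>)
qed

text \<open>The invariant before round \<open>k\<close>. The working row is kept up to degree
  \<open>N\<close>, although only degrees up to the row number are stored, because later rows need
  the higher coefficients; beyond \<open>N\<close>, zeros pad the convolution. The table has no row
  0, as there is a prime up to every \<open>y' >= 2\<close>.\<close>

definition row_ready :: "nat \<Rightarrow> nat \<Rightarrow> nat \<Rightarrow> nat \<Rightarrow> memory \<Rightarrow> bool" where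
  "row_ready N M h k s \<longleftrightarrow> ints s 1 0 = int N \<and> ints s 5 0 = int M \<and> ints s 9 0 = int h \<and>
     (\<forall>j<N. ints s 0 (int j) = int (pr j)) \<and>
     (\<forall>j\<le>N. reals s 4 (int j) = c j) \<and> (\<forall>i>int N. reals s 4 i = 0) \<and>
     (\<forall>j\<le>N. reals s 10 (int j) = fps_nth (P.todd_prod k) j) \<and> (\<forall>i>int N. reals s 10 i = 0) \<and>
     (\<forall>k'\<le>k. \<forall>n\<le>k'. k' \<ge> 1 \<longrightarrow> reals s 0 (int (slot k' n)) = fps_nth (P.todd_prod k') n)"

lemma slot_mono: "k < k' \<Longrightarrow> n \<le> k \<Longrightarrow> slot k n < slot k' 0"
proof -
  assume "k < k'" "n \<le> k"
  have "Suc k * (Suc k + 1) div 2 = k * (k + 1) div 2 + Suc k"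
  proof -
    have "Suc k * (Suc k + 1) = k * (k + 1) + Suc k * 2" by simp
    thus ?thesis by (simp only: div_mult_self2[of 2] zero_neq_numeral) simp
  qed
  moreover have "Suc k * (Suc k + 1) div 2 \<le> k' * (k' + 1) div 2"
    using \<open>k < k'\<close> by (intro div_le_mono mult_le_mono) auto
  ultimately show ?thesis using \<open>n \<le> k\<close> by (simp add: slot_def)
qed

text \<open>The two transforms cost \<open>(K + 1) * (M * 200)\<close> each; all other passes are
  linear in \<open>M\<close> and fit into \<open>M * 500\<close>.\<close>

lemma runs_row:
  assumes R: "row_ready N M h k s" and k8: "ints s 8 0 = int k" and k: "k < N"
    and M: "M = 2 * h" "M = 2 ^ K" "2 * N + 2 \<le> M" and S: "M \<le> S" "slot N N < S"
  shows "runs S row_prog s ((K + 1) * (M * 900)) (\<lambda>s'. row_ready N M h (Suc k) s' \<and> ints s' 8 0 = int k \<and>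
    same {4,6,7,10} {0,6,7,8,9,10,11,12,13,14} s s')"
proof -
  let ?Q = "\<lambda>s'. row_ready N M h (Suc k) s' \<and> ints s' 8 0 = int k \<and>
    same {4,6,7,10} {0,6,7,8,9,10,11,12,13,14} s s'"
  let ?p5 = "For 4 (iadd (IV 8) (IConst 2)) store_prog" and ?t5 = "(k + 2) * 50 + 30"
  let ?p4 = "Seq (For 4 (iadd (IV 1) (IConst 1)) extract_prog) ?p5" and ?t4 = "((N + 1) * 40 + 30) + ?t5"
  let ?p3 = "Seq fft_prog ?p4" and ?t3 = "(K + 1) * (M * 200) + ?t4"
  let ?p2 = "Seq (For 4 (IV 5) square_prog) ?p3" and ?t2 = "(M * 80 + 20) + ?t3"
  let ?p1 = "Seq fft_prog ?p2" and ?t1 = "(K + 1) * (M * 200) + ?t2"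
  define p where "p = pr k"
  define L where "L = ln (real p)"
  have M0: "M > 0" "S > 0" using M S by auto
  have kS: "k < S" "k + 2 \<le> S" "N < S" using k M S by auto
  have p0: "p > 0" by (simp add: p_def)
  note Rs = R[unfolded row_ready_def]
  define a where "a j = reals s 10 (int j)" for j
  define b where "b j = reals s 4 (int j) * L ^ j" for j
  define z where "z j = Complex (a j) (b j)" for j
  let ?s0 = "set_real 11 0 1 s"
  let ?A = "{4,6,7,10} :: nat set" and ?B = "{6,7,8,9,11,12,13,14} :: nat set"
  have sm0: "same ?A ?B s ?s0" by (auto intro: same_set_real)
  have loadr: "runs S (For 4 (IV 5) load_prog) ?s0 (M * 60 + 20) (\<lambda>s'. same {4} {6,7,11} ?s0 s' \<and>
    (\<forall>j<M. vecA s' j = Complex (reals ?s0 10 (int j)) (reals ?s0 4 (int j) * ln (real p) ^ j)))"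
    by (rule runs_load[where k = k and p = p]) (use Rs k8 k kS S p0 in \<open>auto simp: p_def\<close>)
  have rest5: "runs S ?p5 s5 ?t5
     ?Q"
    if sm4: "same ?A ?B s s4" and s5: "same {4} {10} s4 s5"
      "\<forall>j\<le>N. reals s5 10 (int j) = - Im (vecA s4 j) / (2 * real M)" "\<forall>i>int N. reals s5 10 i = reals s4 10 i"
      and v4: "\<forall>j<M. vecA s4 j = dft M (\<lambda>j. cnj (dft M z j ^ 2)) j" for s4 s5
  proof -
    have v5: "ints s5 8 0 = int k" using sm4 s5(1) k8 by (simp add: same_def)
    have "slot (Suc k) (Suc k) < S"
    proof (cases "Suc k = N")
      case False
      hence "slot (Suc k) (Suc k) < slot N 0" using k by (intro slot_mono) auto
      also have "\<dots> \<le> slot N N" by (simp add: slot_def)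
      finally show ?thesis using S by simp
    qed (use S in simp)
    from runs_store[OF v5 this kS(2)]
    show ?thesis
    proof (rule runs_mono)
      fix s6 assume s6: "same {4} {0} s5 s6 \<and>
        (\<forall>n\<le>Suc k. reals s6 0 (int (slot (Suc k) n)) = reals s5 10 (int n)) \<and>
        (\<forall>i<slot (Suc k) 0. reals s6 0 (int i) = reals s5 0 (int i))"
      have sm: "same {4,6,7,10} {0,6,7,8,9,10,11,12,13,14} s s6"
        using sm4 s5(1) s6 by (simp add: same_def)
      have cur: "reals s6 10 (int j) = fps_nth (P.todd_prod (Suc k)) j" if "j \<le> N" for j
      proof -
        have "reals s6 10 (int j) = - Im (vecA s4 j) / (2 * real M)"
          using s6 s5 that by (simp add: same_def)
        also have "\<dots> = - Im (dft M (\<lambda>j. cnj (dft M z j ^ 2)) j) / (2 * real M)"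
          using v4 that M(3) by simp
        also have "\<dots> = (\<Sum>i\<le>j. a i * b (j - i))"
          unfolding z_def by (rule dft_product[of N]) (use M that Rs in \<open>auto simp: a_def b_def\<close>)
        \<comment> \<open>Both indices are at most \<open>j <= N\<close>, where the truncated arrays
          hold the true coefficients.\<close>
        also have "\<dots> = (\<Sum>i\<le>j. fps_nth (P.todd_prod k) i * (c (j - i) * L ^ (j - i)))"
        proof (intro sum.cong refl)
          fix i assume i: "i \<in> {..j}"
          have "a i = fps_nth (P.todd_prod k) i" using i that Rs unfolding a_def by simp
          moreover have "reals s 4 (int (j - i)) = c (j - i)"
          proof -
            have "\<forall>j\<le>N. reals s 4 (int j) = c j" using Rs by simp
            moreover have "j - i \<le> N" using that by simp
            ultimately show ?thesis by blast
          qed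
          ultimately show "a i * b (j - i) = fps_nth (P.todd_prod k) i * (c (j - i) * L ^ (j - i))"
            unfolding b_def by simp
        qed
        also have "\<dots> = fps_nth (P.todd_prod (Suc k)) j"
          by (simp add: P.todd_prod_def fps_mult_nth atLeast0AtMost L_def p_def)
        finally show ?thesis .
      qed
      have "row_ready N M h (Suc k) s6"
        unfolding row_ready_def
      proof (intro conjI allI impI)
        fix k' n assume k': "k' \<le> Suc k" "n \<le> k'" "1 \<le> k'"
        show "reals s6 0 (int (slot k' n)) = fps_nth (P.todd_prod k') n"
        proof (cases "k' = Suc k")
          case True
          have "reals s5 10 = reals s6 10" using s6 by (simp add: same_def)
          thus ?thesis using True s6 k' cur[of n] k by simp
        next
          case False
          hence "slot k' n < slot (Suc k) 0" using k' by (intro slot_mono) auto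
          hence "reals s6 0 (int (slot k' n)) = reals s5 0 (int (slot k' n))" using s6 by blast
          also have "reals s5 0 = reals s 0" using sm4 s5(1) by (simp add: same_def)
          finally show ?thesis using Rs k' False by simp
        qed
      next
        fix i assume i: "int N < i"
        have "reals s6 10 i = reals s4 10 i" using s6 s5 i by (simp add: same_def)
        also have "\<dots> = 0" using sm4 Rs i by (simp add: same_def)
        finally show "reals s6 10 i = 0" .
      qed (use sm Rs cur in \<open>simp_all add: same_def\<close>)
      thus "?Q s6"
        using sm k8 by (simp add: same_def)
    qed simp
  qed
  have T: "(M * 60 + 20) + ?t1
      + 4 \<le> (K + 1) * (M * 900)"
  proof -
    have "(N + 1) * 40 + (k + 2) * 50 + 104 \<le> M * 97" using k M(3) by simp
    hence "(M * 60 + 20) + ((M * 80 + 20) + (((N + 1) * 40 + 30) + ((k + 2) * 50 + 30))) + 4 \<le> M * 500" by simp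
    moreover have "(K + 1) * (M * 900) = (K + 1) * (M * 200) + (K + 1) * (M * 200) + (M * 500 + K * (M * 500))"
      by (simp add: algebra_simps)
    ultimately show ?thesis by linarith
  qed
  have "runs S (Seq (For 4 (IV 5) load_prog) ?p1) ?s0
    ((M * 60 + 20) + ?t1)
    ?Q"
  proof (rule runs_Seq[OF loadr _ order_refl])
    fix s1 assume s1: "same {4} {6,7,11} ?s0 s1 \<and>
      (\<forall>j<M. vecA s1 j = Complex (reals ?s0 10 (int j)) (reals ?s0 4 (int j) * ln (real p) ^ j))"
    have sm1: "same ?A ?B s s1" using sm0 s1 by (simp add: same_def)
    have v1: "\<forall>j<M. vecA s1 j = z j" using s1 by (simp add: z_def a_def b_def L_def)
    have i1: "ints s1 5 0 = int M" "ints s1 9 0 = int h" using sm1 Rs by (simp_all add: same_def)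
    show "runs S ?p1 s1
    ?t1
    ?Q"
    proof (rule runs_Seq[OF runs_fft[OF i1 M(1,2) S(1)] _ order_refl])
      fix s2 assume s2: "same {6,7,10} {6,7,8,9,12,13,14} s1 s2 \<and> (\<forall>j<M. vecA s2 j = dft M (vecA s1) j)"
      have sm2: "same ?A ?B s s2" using sm1 s2 by (simp add: same_def)
      have "dft M (vecA s1) = dft M z"
        unfolding dft_def fun_eq_iff using v1 by (intro allI sum.cong) auto
      hence v2: "\<forall>j<M. vecA s2 j = dft M z j" using s2 by simp
      have i2: "ints s2 5 0 = int M" using sm2 Rs by (simp_all add: same_def)
      show "runs S ?p2 s2
    ?t2
    ?Q"
      proof (rule runs_Seq[OF runs_square[OF i2 S(1) M0(2)] _ order_refl])
        fix s3 assume s3: "same {4} {6,7,12} s2 s3 \<and> (\<forall>j<M. vecA s3 j = cnj (vecA s2 j ^ 2))"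
        have sm3: "same ?A ?B s s3" using sm2 s3 by (simp add: same_def)
        have v3: "\<forall>j<M. vecA s3 j = cnj (dft M z j ^ 2)" using s3 v2 by simp
        have i3: "ints s3 5 0 = int M" "ints s3 9 0 = int h" using sm3 Rs by (simp_all add: same_def)
        show "runs S ?p3 s3
          ?t3
          ?Q"
        proof (rule runs_Seq[OF runs_fft[OF i3 M(1,2) S(1)] _ order_refl])
          fix s4 assume s4: "same {6,7,10} {6,7,8,9,12,13,14} s3 s4 \<and> (\<forall>j<M. vecA s4 j = dft M (vecA s3) j)"
          have sm4: "same ?A ?B s s4" using sm3 s4 by (simp add: same_def)
          have "dft M (vecA s3) = dft M (\<lambda>j. cnj (dft M z j ^ 2))"
            unfolding dft_def[of M "vecA s3"] dft_def[of M "\<lambda>j. cnj (dft M z j ^ 2)"] fun_eq_iff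
            using v3 by (intro allI sum.cong) auto
          hence v4: "\<forall>j<M. vecA s4 j = dft M (\<lambda>j. cnj (dft M z j ^ 2)) j" using s4 by simp
          have i4: "ints s4 5 0 = int M" "ints s4 1 0 = int N" using sm4 Rs by (simp_all add: same_def)
          show "runs S ?p4 s4
            ?t4
            ?Q"
            by (rule runs_Seq[OF runs_extract[OF i4 M0(1) kS(3)] _ order_refl]) (rule rest5[OF sm4 _ _ _ v4]; blast)
        qed
      qed
    qed
  qed
  thus ?thesis unfolding row_prog_def using M0 T
    by (simp add: runs_Seq_RSet) (erule runs_mono; simp)
qed

section \<open>The precomputation\<close>

definition precompute_prog :: com where
  "precompute_prog = Seq prime_prog (Seq msize_prog (Seq ctab_prog
     (Seq (RSet 10 (IConst 0) (OfInt (IConst 1))) (For 8 (IV 1) row_prog))))"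

text \<open>The contract between the two phases: besides the coefficients, the evaluation reads
  \<open>y\<close>, the number of primes and the list of primes from the memory left behind.\<close>

definition precomputed :: "real \<Rightarrow> memory \<Rightarrow> bool" where
  "precomputed y s \<longleftrightarrow> ints s 1 0 = int (prime_pi y) \<and> (\<forall>j<prime_pi y. ints s 0 (int j) = int (pr j)) \<and>
     reals s 1 0 = y \<and>
     (\<forall>k\<le>prime_pi y. \<forall>n\<le>k. k \<ge> 1 \<longrightarrow> reals s 0 (int (slot k n)) = fps_nth (P.todd_prod k) n)"

text \<open>The constant 8 is due to the transform, whose length is at most
  \<open>4 * N + 4 <= 8 * N\<close>; the triangle of coefficients takes only about
  \<open>N^2 / 2\<close> cells.\<close>

lemma memory_bounds:
  assumes "N \<ge> 1"
  shows "N \<le> N\<^sup>2" "slot N N < 8 * N\<^sup>2"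
proof -
  show NN: "N \<le> N\<^sup>2" using assms by (simp add: power2_eq_square)
  have "slot N N \<le> N * (N + 1) + N" unfolding slot_def by (simp add: div_le_dividend)
  also have "\<dots> = N\<^sup>2 + 2 * N" by (simp add: power2_eq_square)
  finally show "slot N N < 8 * N\<^sup>2" using NN assms by linarith
qed

lemma runs_precompute:
  assumes y: "y \<ge> 2" and N: "N = prime_pi y" "N \<ge> 1"
    and K: "K \<ge> 1" "2 * N + 2 \<le> (2::nat) ^ K" "2 ^ K \<le> 4 * N + 4" "\<And>k. k < K \<Longrightarrow> 2 ^ k < 2 * N + 2"
  shows "runs (8 * N\<^sup>2) precompute_prog (input_y y blank)
     (nat \<lfloor>y\<rfloor> * (N * 40 + 80) + 80 + (K * 30 + 60) + (N + 1) * ((N + 1) * 70 + 200) + N * ((K + 1) * ((4 * N + 4) * 900) + 14) + 30)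
     (precomputed y)"
proof -
  define M where "M = (2::nat) ^ K"
  define h where "h = (2::nat) ^ (K - 1)"
  define S where "S = 8 * N\<^sup>2"
  have Mh: "M = 2 * h" using K(1) by (cases K) (auto simp: M_def h_def)
  have S: "M \<le> S" "N + 1 < S" "N \<le> S" "S > 0" "slot N N < S"
    using memory_bounds[OF N(2)] N(2) K(3) unfolding S_def M_def by linarith+
  let ?p3 = "Seq (RSet 10 (IConst 0) (OfInt (IConst 1))) (For 8 (IV 1) row_prog)"
  let ?p2 = "Seq ctab_prog ?p3"
  let ?p1 = "Seq msize_prog ?p2"
  let ?t4 = "N * ((K + 1) * (M * 900) + 2 + 12) + 2 + 12"
  let ?t3 = "?t4 + 4"
  let ?t2 = "(N + 1) * ((N + 1) * 70 + 200) + ?t3"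
  let ?t1 = "(K * 30 + 60) + ?t2"
  let ?s0 = "input_y y blank"
  have r10: "runs S prime_prog ?s0 (nat \<lfloor>y\<rfloor> * (N * 40 + 80) + 80) (\<lambda>s'. same {0,1,2,3,4} {} ?s0 s' \<and>
    ints s' 1 0 = int N \<and> (\<forall>j<N. ints s' 0 (int j) = int (pr j)))"
    unfolding N(1) by (rule runs_primes) (use y S in \<open>auto simp: N(1)\<close>)
  have "runs S precompute_prog ?s0 ((nat \<lfloor>y\<rfloor> * (N * 40 + 80) + 80) + ?t1) (precomputed y)"
    unfolding precompute_prog_def
  proof (rule runs_Seq[OF r10 _ order_refl])
    fix s1 assume s1: "same {0,1,2,3,4} {} ?s0 s1 \<and> ints s1 1 0 = int N \<and> (\<forall>j<N. ints s1 0 (int j) = int (pr j))"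
    have n1: "ints s1 1 0 = int N" using s1 by blast
    show "runs S ?p1 s1
      ?t1 (precomputed y)"
    proof (rule runs_Seq[OF runs_msize[OF n1 S(4) K(1,2,4)] _ order_refl])
      fix s2 assume s2: "same {5,9} {} s1 s2 \<and> ints s2 5 0 = int (2 ^ K) \<and> ints s2 9 0 = int (2 ^ (K - 1))"
      have n2: "ints s2 1 0 = int N" using s2 n1 by (simp add: same_def)
      show "runs S ?p2 s2
        ?t2 (precomputed y)"
      proof (rule runs_Seq[OF runs_ctab[OF n2 S(2)] _ order_refl])
        fix s3 assume s3: "same {4,7} {4,5} s2 s3 \<and> (\<forall>j\<le>N. reals s3 4 (int j) = c j) \<and> (\<forall>i>int N. reals s3 4 i = reals s2 4 i)"
        let ?s4 = "set_real 10 0 1 s3"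
        have r3: "reals s3 10 = reals ?s0 10" "reals s2 4 = reals ?s0 4" "reals s3 1 = reals ?s0 1"
          using s1 s2 s3 by (simp_all add: same_def)
        have i3: "ints s3 0 = ints s1 0" "ints s3 1 = ints s1 1" "ints s3 5 = ints s2 5" "ints s3 9 = ints s2 9"
          using s2 s3 by (simp_all add: same_def)
        have b: "reals ?s0 10 i = 0" "reals ?s0 4 i = 0" "reals ?s0 1 0 = y" for i by (simp_all add: blank_def)
        have t0: "fps_nth (P.todd_prod 0) j = (if j = 0 then 1 else 0)" for j
          by (simp add: P.todd_prod_def fps_one_nth)
        have R0: "row_ready N M h 0 ?s4" and y4: "reals ?s4 1 0 = y"
          using s1 s2 s3 r3 i3 b t0 unfolding row_ready_def by (auto simp: M_def h_def)
        define J where "J k s \<longleftrightarrow> row_ready N M h k s \<and> reals s 1 0 = y" for k s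
        have J8: "J k (set_int 8 0 x s)" if "J k s" for k s x
          using that unfolding J_def row_ready_def by simp
        have "runs S (For 8 (IV 1) row_prog) ?s4 ?t4 (precomputed y)"
        proof (rule runs_For[where n = N and J = J])
          show "J 0 (set_int 8 0 0 ?s4)" by (rule J8) (use R0 y4 in \<open>simp add: J_def\<close>)
          fix k s assume k: "k < N" and J: "J k s" and i: "ints s 8 0 = int k"
          show "runs S row_prog s ((K + 1) * (M * 900)) (\<lambda>s'. ints s' 8 0 = int k \<and> J (Suc k) (set_int 8 0 (int k + 1) s'))"
          proof (rule runs_mono[OF runs_row[OF _ i k Mh M_def _ S(1,5)]])
            fix s' assume s': "row_ready N M h (Suc k) s' \<and> ints s' 8 0 = int k \<and>
              same {4,6,7,10} {0,6,7,8,9,10,11,12,13,14} s s'"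
            hence "reals s' 1 0 = y" using J by (simp add: same_def J_def)
            hence "J (Suc k) s'" using s' by (simp add: J_def)
            thus "ints s' 8 0 = int k \<and> J (Suc k) (set_int 8 0 (int k + 1) s')" using J8 s' by blast
          qed (use J K in \<open>auto simp: J_def M_def\<close>)
        next
          fix s assume "J N s"
          thus "precomputed y s" unfolding J_def row_ready_def precomputed_def N(1)[symmetric] by blast
        qed (use S(4) in \<open>auto simp: J_def row_ready_def\<close>)
        thus "runs S ?p3 s3
          ?t3 (precomputed y)"
          using S(4) by (simp add: runs_Seq_RSet del: One_nat_def)
      qed
    qed
  qed
  thus ?thesis unfolding S_def
  proof (rule runs_mono)
    have "(K + 1) * (M * 900) \<le> (K + 1) * ((4 * N + 4) * 900)"
      using K(3) by (intro mult_le_mono2 mult_le_mono1) (simp add: M_def)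
    hence "N * ((K + 1) * (M * 900) + 2 + 12) \<le> N * ((K + 1) * ((4 * N + 4) * 900) + 14)"
      by (intro mult_le_mono2) linarith
    thus "(nat \<lfloor>y\<rfloor> * (N * 40 + 80) + 80) + ?t1 \<le>
      nat \<lfloor>y\<rfloor> * (N * 40 + 80) + 80 + (K * 30 + 60) + (N + 1) * ((N + 1) * 70 + 200) + N * ((K + 1) * ((4 * N + 4) * 900) + 14) + 30"
      by linarith
  qed simp
qed


section \<open>The evaluation\<close>

definition next_term :: rexp where
  "next_term = OfInt (iadd (IV 11) (IConst 1))"

text \<open>The floor is found by counting: \<open>m\<close> is raised as long as
  \<open>m + 1\<close> is at most \<open>N\<close> and at most the maximum. Being at most a maximum
  is a disjunction, expressed by the available connectives. There are at most \<open>N\<close>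
  rounds, which the linear budget allows.\<close>

definition cutoff_guard :: bexp where
  "cutoff_guard = BAnd (ILe (iadd (IV 11) (IConst 1)) (IV 1))
    (BNot (BAnd (BNot (RLe next_term (rdiv (RFun Ln (RFun Ln (RV 2))) (RFun Ln (OfInt (IConst 2))))))
      (BAnd (BNot (RLe next_term (rmul (RFun Exp (OfInt (IConst 1))) (RFun Ln (RV 1)))))
            (BNot (RLe next_term (rdiv (rmul (RFun Exp (OfInt (IConst 1))) (rmul (RV 1) (RV 1)))
               (rmul (RFun Ln (RV 2)) (RFun Ln (RV 1)))))))))"

definition cutoff_prog :: com where
  "cutoff_prog = Seq (iset 11 (IConst 0)) (While cutoff_guard (iset 11 (iadd (IV 11) (IConst 1))))"

definition volume_prog :: com where
  "volume_prog = Seq (rset 15 (rmul (RV 15) (rdiv (RFun Ln (RV 2)) (RFun Ln (OfInt (IGet 0 (IV 4)))))))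
     (rset 16 (rdiv (RV 16) (OfInt (iadd (IV 4) (IConst 1)))))"

text \<open>The factor \<open>(ln x)^(-n) / (N - n)!\<close> is carried along and updated by
  \<open>(N - n) / ln x\<close>, so that every term takes constant time.\<close>

definition term_prog :: com where
  "term_prog = Seq (rset 17 (radd (RV 17)
       (rmul (RGet 0 (iadd (idiv (imul (IV 1) (iadd (IV 1) (IConst 1))) (IConst 2)) (IV 4))) (RV 16))))
     (rset 16 (rdiv (rmul (RV 16) (OfInt (isub (IV 1) (IV 4)))) (RFun Ln (RV 2))))"

definition evaluate_prog :: com where
  "evaluate_prog = Seq cutoff_prog
    (Seq (rset 15 (OfInt (IConst 1))) (Seq (rset 16 (OfInt (IConst 1))) (Seq (For 4 (IV 1) volume_prog)
    (Seq (rset 17 (OfInt (IConst 0))) (Seq (For 4 (iadd (IV 11) (IConst 1)) term_prog)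
         (rset 3 (rmul (RV 15) (RV 17))))))))"

lemma less_cutoff_iff:
  assumes "x > 1" "y \<ge> 2"
  shows "k < cutoff x y \<longleftrightarrow> Suc k \<le> prime_pi y \<and>
    (real (Suc k) \<le> ln (ln x) / ln 2 \<or> real (Suc k) \<le> exp 1 * ln y \<or> real (Suc k) \<le> exp 1 * (y * y) / (ln x * ln y))"
proof -
  have "k < cutoff x y \<longleftrightarrow> int (Suc k) \<le> \<lfloor>min (real (prime_pi y))
     (max (log 2 (ln x)) (max (exp 1 * ln y) (exp 1 * y\<^sup>2 / (ln x * ln y))))\<rfloor>"
    unfolding cutoff_def by linarith
  also have "\<dots> \<longleftrightarrow> real (Suc k) \<le> min (real (prime_pi y))
     (max (log 2 (ln x)) (max (exp 1 * ln y) (exp 1 * y\<^sup>2 / (ln x * ln y))))"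
    by (simp only: le_floor_iff of_int_of_nat_eq)
  also have "\<dots> \<longleftrightarrow> Suc k \<le> prime_pi y \<and>
    (real (Suc k) \<le> ln (ln x) / ln 2 \<or> real (Suc k) \<le> exp 1 * ln y \<or> real (Suc k) \<le> exp 1 * (y * y) / (ln x * ln y))"
    by (simp only: le_max_iff_disj log_def power2_eq_square min.bounded_iff of_nat_le_iff)
  finally show ?thesis .
qed

lemma cutoff_le: "cutoff x y \<le> prime_pi y"
proof -
  have "cutoff x y \<le> nat \<lfloor>real (prime_pi y)\<rfloor>" unfolding cutoff_def by (intro nat_mono floor_mono) auto
  thus ?thesis by simp
qed

lemma runs_cutoff:
  assumes v: "ints s 1 0 = int (prime_pi y)" "reals s 1 0 = y" "reals s 2 0 = x" and xy: "y \<ge> 2" "x > y" and S: "S > 0"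
  shows "runs S cutoff_prog s (prime_pi y * 100 + 100) (\<lambda>s'. same {11} {} s s' \<and> ints s' 11 0 = int (cutoff x y))"
proof -
  define I where "I k s' \<longleftrightarrow> same {11} {} s s' \<and> ints s' 11 0 = int k" for k s'
  have x1: "x > 1" "ln x > 0" "ln y > 0" using xy by auto
  have g: "bok S s' cutoff_guard \<and> (bval s' cutoff_guard \<longleftrightarrow> k < cutoff x y)" if "I k s'" for k s'
  proof -
    have v': "ints s' (Suc 0) 0 = int (prime_pi y)" "reals s' (Suc 0) 0 = y" "reals s' 2 0 = x" "ints s' 11 0 = int k"
      using that v by (simp_all add: I_def same_def)
    have "bok S s' cutoff_guard" using x1 xy S by (simp add: cutoff_guard_def next_term_def v')
    moreover have "bval s' cutoff_guard \<longleftrightarrow> k < cutoff x y"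
      unfolding less_cutoff_iff[OF x1(1) xy(1)] by (simp add: cutoff_guard_def next_term_def v' add.commute) linarith
    ultimately show ?thesis by blast
  qed
  have cost: "bcost cutoff_guard \<le> 70" by (simp add: cutoff_guard_def next_term_def)
  have "runs S (While cutoff_guard (iset 11 (iadd (IV 11) (IConst 1)))) (set_int 11 0 0 s)
     (cutoff x y * (10 + bcost cutoff_guard + 1) + bcost cutoff_guard + 1) (\<lambda>s'. same {11} {} s s' \<and> ints s' 11 0 = int (cutoff x y))"
  proof (rule runs_While[where I = I, OF _ _ _ order_refl])
    fix k s' assume k: "k < cutoff x y" and I: "I k s'"
    have "I (Suc k) (set_int 11 0 (int k + 1) s')" using I by (auto simp: I_def intro: same_set_int)
    thus "bok S s' cutoff_guard \<and> bval s' cutoff_guard \<and> runs S (iset 11 (iadd (IV 11) (IConst 1))) s' 10 (I (Suc k))"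
      using g[OF I] k I S by (simp add: runs_simps I_def)
  qed (use g in \<open>auto simp: I_def intro: same_set_int\<close>)
  moreover have "cutoff x y * (10 + bcost cutoff_guard + 1) + bcost cutoff_guard + 1 \<le> prime_pi y * (10 + 70 + 1) + 70 + 1"
    using cost by (intro add_mono mult_le_mono cutoff_le) auto
  ultimately show ?thesis unfolding cutoff_prog_def using S
    by (simp add: runs_Seq_ISet) (erule runs_mono; simp)
qed

lemma runs_volume:
  assumes v: "ints s 1 0 = int N" "\<And>j. j < N \<Longrightarrow> ints s 0 (int j) = int (pr j)" "reals s 2 0 = x"
    "reals s 15 0 = 1" "reals s 16 0 = 1" and x: "x > 1" and S: "N \<le> S" "S > 0"
  shows "runs S (For 4 (IV 1) volume_prog) s (N * 60 + 20) (\<lambda>s'. same {4} {15,16} s s' \<and>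
    reals s' 15 0 = (\<Prod>i<N. ln x / ln (real (pr i))) \<and> reals s' 16 0 = 1 / fact N)"
proof -
  let ?J = "\<lambda>k s'. same {4} {15,16} s s' \<and>
    reals s' 15 0 = (\<Prod>i<k. ln x / ln (real (pr i))) \<and> reals s' 16 0 = 1 / fact k"
  show ?thesis
  proof (rule runs_For[where n = N and B = 40 and J = ?J])
    fix k s' assume k: "k < N" and i: "ints s' 4 0 = int k" and J: "?J k s'"
    have v': "ints s' 0 (int k) = int (pr k)" "reals s' 2 0 = x" using J v k by (simp_all add: same_def)
    have lp: "ln (real (pr k)) \<noteq> 0" using P.L_pos[of k] by simp
    define P Q where "P = (\<Prod>i<Suc k. ln x / ln (real (pr i)))" and "Q = (1 / fact (Suc k) :: real)"
    have PQ: "(\<Prod>i<k. ln x / ln (real (pr i))) * ln x / ln (real (pr k)) = P" "1 / (fact k * (real k + 1)) = Q"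
      by (simp_all add: P_def Q_def field_simps)
    have "same {4} {15,16} s (set_int 4 0 (int k + 1) (set_real 16 0 Q (set_real 15 0 P s')))"
      using J by (auto intro!: same_set_int same_set_real)
    thus "runs S volume_prog s' 40 (\<lambda>s'. ints s' 4 0 = int k \<and> same {4} {15,16} s (set_int 4 0 (int k + 1) s') \<and>
        reals (set_int 4 0 (int k + 1) s') 15 0 = (\<Prod>i<Suc k. ln x / ln (real (pr i))) \<and>
        reals (set_int 4 0 (int k + 1) s') 16 0 = 1 / fact (Suc k))"
      unfolding volume_prog_def P_def[symmetric] Q_def[symmetric] using J k S x lp
      by (simp add: runs_simps i v' PQ)
  next
    fix k s' assume "?J k s'"
    thus "iok S s' (IV 1) \<and> ival s' (IV 1) = int N" using v S by (simp add: same_def)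
  qed (use S v in \<open>auto intro: same_set_int\<close>)
qed

lemma runs_terms:
  assumes v: "ints s 1 0 = int N" "ints s 11 0 = int m" "reals s 2 0 = x" "reals s 16 0 = 1 / fact N" "reals s 17 0 = 0"
    and D: "\<And>n. n \<le> N \<Longrightarrow> reals s 0 (int (slot N n)) = D n"
    and x: "x > 1" and S: "slot N N < S" and m: "m \<le> N"
  shows "runs S (For 4 (iadd (IV 11) (IConst 1)) term_prog) s ((m + 1) * 80 + 30) (\<lambda>s'. same {4} {16,17} s s' \<and>
    reals s' 17 0 = (\<Sum>n\<le>m. D n * (1 / ln x ^ n / fact (N - n))))"
proof -
  define w where "w n = 1 / ln x ^ n / (fact (N - n) :: real)" for n
  \<comment> \<open>Nothing is claimed of the factor at \<open>k = Suc N\<close>: the last update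
    multiplies it by \<open>N - N = 0\<close>, whereas \<open>w (Suc N)\<close> is nonzero.\<close>
  define J where "J k s' \<longleftrightarrow> same {4} {16,17} s s' \<and> (k \<le> N \<longrightarrow> reals s' 16 0 = w k) \<and>
     reals s' 17 0 = (\<Sum>n<k. D n * w n)" for k s'
  have lx: "ln x > 0" using x by simp
  have "runs S (For 4 (iadd (IV 11) (IConst 1)) term_prog) s ((m + 1) * 80 + 30) (J (m + 1))"
  proof (rule runs_For[where n = "m + 1" and B = 60 and J = J])
    fix k s' assume k: "k < m + 1" and J: "J k s'" and i: "ints s' 4 0 = int k"
    have kN: "k \<le> N" using k m by simp
    have v': "ints s' (Suc 0) 0 = int N" "reals s' 2 0 = x" "reals s' 0 (int (slot N k)) = D k"
      "reals s' 16 0 = w k" "reals s' 17 0 = (\<Sum>n<k. D n * w n)"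
      using J v kN D by (simp_all add: J_def same_def)
    define sl where "sl = slot N k"
    have sl: "int N * (int N + 1) div 2 + int k = int sl"
      by (simp add: sl_def slot_def zdiv_int algebra_simps)
    have slS: "sl < S" using S kN by (simp add: sl_def slot_def)
    define A B where "A = (\<Sum>n<Suc k. D n * w n)" and "B = w k * (real N - real k) / ln x"
    have A: "(\<Sum>n<k. D n * w n) + D k * w k = A" by (simp add: A_def)
    have B: "B = w (Suc k)" if "Suc k \<le> N"
    proof -
      have f: "fact (N - k) = (real N - real k) * fact (N - Suc k)"
        using that by (simp add: fact_reduce of_nat_diff flip: Suc_diff_Suc)
      have "real N - real k \<noteq> 0" using that by simp
      thus ?thesis unfolding B_def w_def f using lx by simp
    qed
    have "J (Suc k) (set_int 4 0 (int k + 1) (set_real 16 0 B (set_real 17 0 A s')))"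
      using J B unfolding J_def A_def by (auto intro!: same_set_int same_set_real)
    thus "runs S term_prog s' 60 (\<lambda>s'. ints s' 4 0 = int k \<and> J (Suc k) (set_int 4 0 (int k + 1) s'))"
      unfolding term_prog_def using slS lx x
      by (simp add: runs_simps i v' sl v'(3)[folded sl_def] A flip: B_def)
  next
    fix k s' assume "J k s'"
    hence "ints s' 11 0 = int m" using v by (simp add: J_def same_def)
    thus "iok S s' (iadd (IV 11) (IConst 1)) \<and> ival s' (iadd (IV 11) (IConst 1)) = int (m + 1)" using S by simp
  qed (use S v in \<open>auto simp: J_def w_def intro: same_set_int\<close>)
  thus ?thesis by (rule runs_mono) (simp_all add: J_def w_def lessThan_Suc_atMost)
qed

lemma runs_evaluate:
  assumes pre: "precomputed y s" and y: "y \<ge> 2" and x: "y < x" and N: "N = prime_pi y" "N \<ge> 1"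
  shows "runs (8 * N\<^sup>2) evaluate_prog (input_x x s) (N * 500) (\<lambda>s'. out_cell s' = E x y)"
proof -
  let ?Q = "\<lambda>s'. out_cell s' = E x y"
  let ?p3 = "Seq (For 4 (iadd (IV 11) (IConst 1)) term_prog) (rset 3 (rmul (RV 15) (RV 17)))"
  let ?p2 = "Seq (rset 17 (OfInt (IConst 0))) ?p3"
  let ?p1 = "Seq (For 4 (IV 1) volume_prog) ?p2"
  define S where "S = 8 * N\<^sup>2"
  define m where "m = cutoff x y"
  let ?t2 = "((m + 1) * 80 + 30) + 15"
  let ?t1 = "(N * 60 + 20) + ?t2"
  have S: "N \<le> S" "S > 0" "slot N N < S"
    using memory_bounds[OF N(2)] N(2) unfolding S_def by linarith+
  have x1: "x > 1" using x y by simp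
  have mN: "m \<le> N" using cutoff_le by (simp add: m_def N)
  let ?s0 = "input_x x s"
  have v0: "ints ?s0 1 0 = int N" "reals ?s0 1 0 = y" "reals ?s0 2 0 = x"
    and P0: "\<And>j. j < N \<Longrightarrow> ints ?s0 0 (int j) = int (pr j)"
    and D0: "\<And>n. n \<le> N \<Longrightarrow> reals ?s0 0 (int (slot N n)) = fps_nth (P.todd_prod N) n"
    using pre N by (auto simp: precomputed_def)
  have E: "E x y = (\<Prod>i<N. ln x / ln (real (pr i))) *
     (\<Sum>n\<le>m. fps_nth (P.todd_prod N) n * (1 / ln x ^ n / fact (N - n)))"
  proof -
    have "(\<Prod>p\<in>primes_upto y. ln x / ln (real p)) = (\<Prod>i<N. ln x / ln (real (pr i)))"
      unfolding primes_upto_pr N by (subst prod.reindex[OF inj_pr]) simp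
    moreover have "(\<Sum>n=0..m. d n y * ln x powi (- int n) / fact (N - n)) =
       (\<Sum>n\<le>m. fps_nth (P.todd_prod N) n * (1 / ln x ^ n / fact (N - n)))"
      unfolding atLeast0AtMost
      by (intro sum.cong refl) (use x1 in \<open>auto simp: d_eq N power_int_minus field_simps\<close>)
    ultimately show ?thesis by (simp add: E_def m_def N)
  qed
  have r1: "runs S cutoff_prog ?s0 (N * 100 + 100) (\<lambda>s'. same {11} {} ?s0 s' \<and> ints s' 11 0 = int m)"
    unfolding N m_def by (rule runs_cutoff) (use v0 y x S N in auto)
  have "runs S evaluate_prog ?s0 ((N * 100 + 100) + ((N * 60 + 20) + ?t2 + 10))
     ?Q"
    unfolding evaluate_prog_def
  proof (rule runs_Seq[OF r1 _ order_refl])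
    fix s1 assume s1: "same {11} {} ?s0 s1 \<and> ints s1 11 0 = int m"
    let ?s2 = "set_real 16 0 1 (set_real 15 0 1 s1)"
    have "runs S (For 4 (IV 1) volume_prog) ?s2 (N * 60 + 20) (\<lambda>s'. same {4} {15,16} ?s2 s' \<and>
      reals s' 15 0 = (\<Prod>i<N. ln x / ln (real (pr i))) \<and> reals s' 16 0 = 1 / fact N)"
      by (rule runs_volume) (use s1 v0 P0 x1 S in \<open>auto simp: same_def\<close>)
    hence "runs S ?p1 ?s2 ?t1 ?Q"
    proof (rule runs_Seq)
      fix s3 assume s3: "same {4} {15,16} ?s2 s3 \<and>
        reals s3 15 0 = (\<Prod>i<N. ln x / ln (real (pr i))) \<and> reals s3 16 0 = 1 / fact N"
      let ?s4 = "set_real 17 0 0 s3"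
      have "runs S (For 4 (iadd (IV 11) (IConst 1)) term_prog) ?s4 ((m + 1) * 80 + 30) (\<lambda>s'. same {4} {16,17} ?s4 s' \<and>
        reals s' 17 0 = (\<Sum>n\<le>m. fps_nth (P.todd_prod N) n * (1 / ln x ^ n / fact (N - n))))"
        by (rule runs_terms) (use s1 s3 v0 D0 x1 S mN in \<open>auto simp: same_def\<close>)
      hence "runs S ?p3 ?s4
         (((m + 1) * 80 + 30) + 10) ?Q"
      proof (rule runs_Seq)
        fix s5 assume s5: "same {4} {16,17} ?s4 s5 \<and>
          reals s5 17 0 = (\<Sum>n\<le>m. fps_nth (P.todd_prod N) n * (1 / ln x ^ n / fact (N - n)))"
        have "reals s5 15 0 = (\<Prod>i<N. ln x / ln (real (pr i)))" using s5 s3 by (simp add: same_def)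
        thus "runs S (rset 3 (rmul (RV 15) (RV 17))) s5 10 ?Q"
          using s5 S by (simp add: runs_simps E)
      qed simp
      thus "runs S ?p2 s3 ?t2 ?Q"
        using S by (simp add: runs_Seq_RSet) (erule runs_mono; simp)
    qed simp
    thus "runs S (Seq (rset 15 (OfInt (IConst 1))) (Seq (rset 16 (OfInt (IConst 1))) ?p1)) s1
      ((N * 60 + 20) + ?t2 + 10) ?Q"
      using S by (simp add: runs_Seq_RSet del: One_nat_def) (erule runs_mono; simp)
  qed
  thus ?thesis unfolding S_def
    by (rule runs_mono) (use mN N(2) in auto)
qed

section \<open>The cost of the precomputation\<close>

text \<open>Up to constants every term is brought to \<open>y * n\<close>, \<open>n * n\<close> or
  \<open>n * n * k\<close>. Chebyshev's bound is applied once for the first two and twice for the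
  last: \<open>k <= 6 * ln y\<close> turns one \<open>n\<close> into
  \<open>n * ln y <= C * y\<close>, and then \<open>y * n <= C * (y^2 / ln y)\<close>. The
  logarithmic factor of the Fourier transform is thus exactly what the density of primes pays
  for.\<close>

lemma precompute_cost:
  "\<exists>C1 :: real. \<forall>y N K. y \<ge> 2 \<longrightarrow> N = prime_pi y \<longrightarrow> N \<ge> 1 \<longrightarrow> 2 ^ K \<le> 4 * N + 4 \<longrightarrow>
     real (nat \<lfloor>y\<rfloor> * (N * 40 + 80) + 80 + (K * 30 + 60) + (N + 1) * ((N + 1) * 70 + 200) +
       N * ((K + 1) * ((4 * N + 4) * 900) + 14) + 30) \<le> C1 * (y\<^sup>2 / ln y)"
proof -
  obtain C where C: "C \<ge> 1" "\<And>y. y \<ge> 2 \<Longrightarrow> real (prime_pi y) * ln y \<le> C * y"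
    using prime_pi_upper by blast
  \<comment> \<open>\<open>8014 = 120 + 680 + 7214\<close> and
    \<open>43380 = 6 * (7200 + 30)\<close> collect the coefficients in \<open>h1\<close> to
    \<open>h4\<close>; 170 is the sum of the constant terms.\<close>
  define C1 where "C1 = 8014 * C + 170 + 43380 * C\<^sup>2"
  have "real (nat \<lfloor>y\<rfloor> * (N * 40 + 80) + 80 + (K * 30 + 60) + (N + 1) * ((N + 1) * 70 + 200) +
       N * ((K + 1) * ((4 * N + 4) * 900) + 14) + 30) \<le> C1 * (y\<^sup>2 / ln y)"
    if y: "y \<ge> 2" and N: "N = prime_pi y" "N \<ge> 1" and K: "(2::nat) ^ K \<le> 4 * N + 4" for y and N K :: nat
  proof -
    define n k f A where defs: "n = real N" "k = real K" "f = real (nat \<lfloor>y\<rfloor>)" "A = y\<^sup>2 / ln y"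
    have n1: "n \<ge> 1" and k0: "k \<ge> 0" and f0: "f \<ge> 0" using N by (auto simp: defs)
    have l: "ln y > 0" using y by simp
    have ny: "n \<le> y" using prime_pi_le_half[OF y] y by (simp add: defs N)
    have fy: "f \<le> y" using y by (simp add: defs)
    have nl: "n * ln y \<le> C * y" using C(2)[OF y] by (simp add: defs N)
    have ln_le: "ln y \<le> y" using ln_bound[of y] y by simp
    have yA: "y \<le> A"
    proof -
      have "y * ln y \<le> y * y" using ln_le y by (intro mult_left_mono) auto
      thus ?thesis using l by (simp add: defs power2_eq_square pos_le_divide_eq)
    qed
    have ynA: "y * n \<le> C * A"
    proof -
      have "y * (n * ln y) \<le> y * (C * y)" using nl y by (intro mult_left_mono) auto
      thus ?thesis using l by (simp add: defs power2_eq_square pos_le_divide_eq mult_ac)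
    qed
    have nnA: "n * n \<le> C * A" using mult_right_mono[OF ny, of n] n1 ynA by linarith
    have kl: "k \<le> 6 * ln y"
    proof -
      have "real (2 ^ K) \<le> real (4 * N + 4)" using K by (simp only: of_nat_le_iff)
      hence "2 ^ K \<le> 4 * n + 4" by (simp add: defs)
      also have "\<dots> \<le> 2 ^ 3 * y" using n1 ny by simp
      finally have "ln ((2::real) ^ K) \<le> ln (2 ^ 3 * y)" using y by (intro ln_mono) auto
      hence "k * ln 2 \<le> ln (2 ^ 3) + ln y" using y by (simp add: ln_mult ln_realpow defs)
      also have "ln ((2::real) ^ 3) = 3 * ln 2" by (subst ln_realpow) auto
      also have "3 * ln 2 + ln y \<le> 4 * ln y" using ln_mono[of 2 y] y by simp
      finally have "k * ln 2 \<le> 4 * ln y" .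
      moreover have "k * (2 / 3) \<le> k * ln 2" using ln2_ge_two_thirds k0 by (intro mult_left_mono) auto
      ultimately show ?thesis by linarith
    qed
    have nnk: "n * n * k \<le> 6 * (C\<^sup>2 * A)"
    proof -
      have "n * n * k \<le> n * n * (6 * ln y)" using kl n1 by (intro mult_left_mono) auto
      also have "\<dots> = 6 * (n * (n * ln y))" by simp
      also have "\<dots> \<le> 6 * (n * (C * y))" using nl n1 by (intro mult_left_mono) auto
      also have "\<dots> = 6 * (C * (y * n))" by simp
      also have "\<dots> \<le> 6 * (C * (C * A))" using ynA C by (intro mult_left_mono) auto
      finally show ?thesis by (simp add: power2_eq_square mult_ac)
    qed
    have h1: "f * (40 * n + 80) \<le> 120 * (y * n)"
    proof -
      have "f * (40 * n + 80) \<le> y * (120 * n)" using fy n1 f0 y by (intro mult_mono) auto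
      thus ?thesis by simp
    qed
    have h2: "30 * k \<le> 30 * (n * n * k)"
    proof -
      have "1 * 1 \<le> n * n" using n1 by (intro mult_mono) auto
      thus ?thesis using mult_right_mono[of 1 "n * n" k] k0 by simp
    qed
    have h3: "(n + 1) * ((n + 1) * 70 + 200) \<le> 680 * (n * n)"
    proof -
      have "(n + 1) * ((n + 1) * 70 + 200) \<le> (2 * n) * (340 * n)" using n1 by (intro mult_mono) auto
      thus ?thesis by simp
    qed
    have h4: "n * ((k + 1) * ((4 * n + 4) * 900) + 14) \<le> 7200 * (n * n * k) + 7214 * (n * n)"
    proof -
      have "(k + 1) * ((4 * n + 4) * 900) + 14 \<le> (k + 1) * ((8 * n) * 900) + 14 * n"
        using n1 k0 by (intro add_mono mult_left_mono) auto
      hence "n * ((k + 1) * ((4 * n + 4) * 900) + 14) \<le> n * ((k + 1) * ((8 * n) * 900) + 14 * n)"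
        using n1 by (intro mult_left_mono) auto
      thus ?thesis by (simp add: algebra_simps)
    qed
    have "real (nat \<lfloor>y\<rfloor> * (N * 40 + 80) + 80 + (K * 30 + 60) + (N + 1) * ((N + 1) * 70 + 200) +
       N * ((K + 1) * ((4 * N + 4) * 900) + 14) + 30) =
       f * (40 * n + 80) + 30 * k + (n + 1) * ((n + 1) * 70 + 200) + n * ((k + 1) * ((4 * n + 4) * 900) + 14) + 170"
      by (simp add: defs algebra_simps)
    also have "\<dots> \<le> 120 * (C * A) + 7894 * (C * A) + 7230 * (6 * (C\<^sup>2 * A)) + 170 * A"
      using h1 h2 h3 h4 ynA nnA nnk yA y by linarith
    also have "\<dots> = C1 * A" by (simp add: C1_def algebra_simps)
    finally show ?thesis by (simp add: defs)
  qed
  thus ?thesis by blast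
qed

lemma precomputed_imp_coeffs_stored:
  assumes "precomputed y s" "slot (prime_pi y) (prime_pi y) < S"
  shows "coeffs_stored S y s"
  unfolding coeffs_stored_def
proof (intro allI impI)
  fix y' n assume A: "2 \<le> y' \<and> y' \<le> y \<and> n \<le> prime_pi y'"
  define k where "k = prime_pi y'"
  have k: "k \<le> prime_pi y" using A prime_pi_mono by (simp add: k_def)
  have "2 \<in> primes_upto y'" using A by (simp add: primes_upto_def)
  hence k1: "k \<ge> 1" by (metis card_0_eq empty_iff finite_primes_upto k_def less_one not_less prime_pi_def)
  have "slot k n \<le> slot (prime_pi y) (prime_pi y)"
  proof (cases "k = prime_pi y")
    case True
    thus ?thesis using A by (simp add: slot_def k_def)
  next
    case False
    hence "slot k n < slot (prime_pi y) 0" using k A by (intro slot_mono) (auto simp: k_def)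
    thus ?thesis by (simp add: slot_def)
  qed
  moreover have "reals s 0 (int (slot k n)) = d n y'"
    using assms(1) k k1 A by (simp add: precomputed_def d_eq k_def)
  ultimately show "slot (prime_pi y') n < S \<and> reals s 0 (int (slot (prime_pi y') n)) = d n y'"
    using assms(2) by (simp add: k_def)
qed

lemma algorithm_exists:
  "\<exists>(precompute :: com) (evaluate :: com).
    (\<exists>(C1 :: real) (C2 :: nat) (C3 :: real). \<forall>y :: real. 2 \<le> y \<longrightarrow>
      (\<exists>s t. exec (C2 * (prime_pi y)\<^sup>2) precompute (input_y y blank) t s \<and>
        real t \<le> C1 * (y\<^sup>2 / ln y) \<and>
        coeffs_stored (C2 * (prime_pi y)\<^sup>2) y s \<and>
        (\<forall>x :: real. y < x \<longrightarrow>
          (\<exists>s' t'. exec (C2 * (prime_pi y)\<^sup>2) evaluate (input_x x s) t' s' \<and>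
            out_cell s' = E x y \<and>
            real t' \<le> C3 * real (prime_pi y)))))"
proof -
  obtain C1 :: real where C1: "\<And>y N K. y \<ge> 2 \<Longrightarrow> N = prime_pi y \<Longrightarrow> N \<ge> 1 \<Longrightarrow> 2 ^ K \<le> 4 * N + 4 \<Longrightarrow>
     real (nat \<lfloor>y\<rfloor> * (N * 40 + 80) + 80 + (K * 30 + 60) + (N + 1) * ((N + 1) * 70 + 200) +
       N * ((K + 1) * ((4 * N + 4) * 900) + 14) + 30) \<le> C1 * (y\<^sup>2 / ln y)"
    using precompute_cost by blast
  have "\<exists>s t. exec (8 * (prime_pi y)\<^sup>2) precompute_prog (input_y y blank) t s \<and>
        real t \<le> C1 * (y\<^sup>2 / ln y) \<and> coeffs_stored (8 * (prime_pi y)\<^sup>2) y s \<and>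
        (\<forall>x :: real. y < x \<longrightarrow>
          (\<exists>s' t'. exec (8 * (prime_pi y)\<^sup>2) evaluate_prog (input_x x s) t' s' \<and>
            out_cell s' = E x y \<and> real t' \<le> 500 * real (prime_pi y)))"
    if y: "2 \<le> y" for y
  proof -
    define N where "N = prime_pi y"
    have "2 \<in> primes_upto y" using y by (simp add: primes_upto_def)
    hence N1: "N \<ge> 1" by (metis N_def card_0_eq empty_iff finite_primes_upto less_one not_less prime_pi_def)
    obtain K where K: "K \<ge> 1" "2 * N + 2 \<le> (2::nat) ^ K" "2 ^ K \<le> 4 * N + 4" "\<And>k. k < K \<Longrightarrow> 2 ^ k < 2 * N + 2"
      using msize_exists[of N] by blast
    from runs_precompute[OF y N_def N1 K] obtain t s where
      1: "exec (8 * N\<^sup>2) precompute_prog (input_y y blank) t s" "precomputed y s" and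
      t: "t \<le> nat \<lfloor>y\<rfloor> * (N * 40 + 80) + 80 + (K * 30 + 60) + (N + 1) * ((N + 1) * 70 + 200) +
        N * ((K + 1) * ((4 * N + 4) * 900) + 14) + 30"
      unfolding runs_def by blast
    have "real t \<le> C1 * (y\<^sup>2 / ln y)"
      by (rule order_trans[OF _ C1[OF y N_def N1 K(3)]]) (use t in \<open>simp only: of_nat_le_iff\<close>)
    moreover have "coeffs_stored (8 * N\<^sup>2) y s"
      by (rule precomputed_imp_coeffs_stored[OF 1(2)]) (use memory_bounds[OF N1] in \<open>simp add: N_def\<close>)
    moreover have "\<exists>s' t'. exec (8 * N\<^sup>2) evaluate_prog (input_x x s) t' s' \<and>
            out_cell s' = E x y \<and> real t' \<le> 500 * real N" if x: "y < x" for x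
    proof -
      from runs_evaluate[OF 1(2) y x N_def N1] obtain t' s' where
        2: "exec (8 * N\<^sup>2) evaluate_prog (input_x x s) t' s'" "out_cell s' = E x y" "t' \<le> N * 500"
        unfolding runs_def by blast
      have "real t' \<le> real (N * 500)" using 2(3) by (simp only: of_nat_le_iff)
      hence "real t' \<le> 500 * real N" by simp
      with 2 show ?thesis by blast
    qed
    ultimately show ?thesis using 1(1) unfolding N_def by blast
  qed
  thus ?thesis by blast
qed

theorem mainTheorem1:
  shows "\<exists>(precompute :: com) (evaluate :: com).
    (\<exists>(C1 :: real) (C2 :: nat) (C3 :: real). \<forall>y :: real. 2 \<le> y \<longrightarrow>
      (\<exists>s t. exec (C2 * (prime_pi y)\<^sup>2) precompute (input_y y blank) t s \<and>
        real t \<le> C1 * (y\<^sup>2 / ln y) \<and>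
        coeffs_stored (C2 * (prime_pi y)\<^sup>2) y s \<and>
        (\<forall>x :: real. y < x \<longrightarrow>
          (\<exists>s' t'. exec (C2 * (prime_pi y)\<^sup>2) evaluate (input_x x s) t' s' \<and>
            out_cell s' = E x y \<and>
            real t' \<le> C3 * real (prime_pi y))))) \<and>
    (\<forall>\<theta> \<epsilon> :: real. 0 < \<theta> \<and> \<theta> < 3 / 4 \<and> 0 < \<epsilon> \<longrightarrow>
      (\<exists>C :: real. \<forall>x y :: real. 1 < x \<and> 2 \<le> y \<and> y \<le> ln x powr \<theta> \<longrightarrow>
        (\<exists>r. real (Psi x y) = E x y * (1 + r) \<and>
          \<bar>r\<bar> \<le> C * ln x powr (- 1 / 8 + \<epsilon>))))"
proof -
  from algorithm_exists obtain precompute evaluate where alg: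
    "\<exists>(C1 :: real) (C2 :: nat) (C3 :: real). \<forall>y :: real. 2 \<le> y \<longrightarrow>
      (\<exists>s t. exec (C2 * (prime_pi y)\<^sup>2) precompute (input_y y blank) t s \<and>
        real t \<le> C1 * (y\<^sup>2 / ln y) \<and>
        coeffs_stored (C2 * (prime_pi y)\<^sup>2) y s \<and>
        (\<forall>x :: real. y < x \<longrightarrow>
          (\<exists>s' t'. exec (C2 * (prime_pi y)\<^sup>2) evaluate (input_x x s) t' s' \<and>
            out_cell s' = E x y \<and>
            real t' \<le> C3 * real (prime_pi y))))" by blast
  show ?thesis
    by (intro exI[of _ precompute] exI[of _ evaluate] conjI alg allI impI)
       (elim conjE, rule Psi_E_approx_theta)
qed

end
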